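(* Let $f(x,\xi)=h(c(x,\xi))$ and $\omega$ satisfy: (i) the samples $\{\xi^k\}$ are drawn i.i.d. from $\Xi$; (ii) $\omega$ is $L_\omega$-Lipschitz continuous over its domain; (iii) $\omega$ is $\kappa$-weakly convex; (iv) $h$ is convex and $L_h$-Lipschitz continuous over its domain, $c(\cdot,\xi)$ has $C(\xi)$-Lipschitz continuous gradient and is $L_c(\xi)$-Lipschitz continuous over $\operatorname{dom}\omega$, with $\mathbb{E}_\xi[C(\xi)^2]\le C^2$ and $\mathbb{E}_\xi[L_c(\xi)^2]\le L_c^2$; (v) the distribution of the independent stochastic delays $\{\tau_k\}$ has bounded first and second moments, i.e. $\mathbb{E}[\tau_k]\le\bar\tau<\infty$ and $\mathbb{E}[\tau_k^2]\le\tau_{\sigma^2}<\infty$ for all $k$. Put $L_f=L_hL_c$ and $\lambda=L_hC$. Let $\rho>2\lambda+\kappa$, and run the delayed stochastic prox-linear method (DSPL) with $\gamma_k\equiv\gamma=\rho+6\lambda+\kappa+\sqrt{K}/\alpha$ for some $\alpha>0$. Let $k^*$ be chosen uniformly between $1$ and $K$. Then $$\mathbb{E}\big[\|\nabla\psi_{1/\rho}(x^{k^*})\|^2\big]\le\frac{2\rho}{\rho-2\lambda-\kappa}\left[\frac{(\rho+4\lambda)D}{K}+\frac{D}{\sqrt{K}\,\alpha}+\frac{2\rho L_f^2\alpha}{\sqrt{K}}+\frac{6\rho\lambda(L_f+L_\omega)^2\alpha^2}{K}\Delta_2\right],$$ where $D=\psi_{1/\rho}(x^1)-\inf_x\psi(x)$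 and $\Delta_2=\frac1K\sum_{k=1}^K\tau_k^2$.
   Context: Problem: $\min_{x\in\mathbb{R}^n}\psi(x):=f(x)+\omega(x)$ with $f(x):=\mathbb{E}_{\xi\sim\Xi}[f(x,\xi)]$, $f(x,\xi)=h(c(x,\xi))$, where $h:\mathbb{R}\to\mathbb{R}$ is convex and nonsmooth, $c(\cdot,\xi):\mathbb{R}^n\to\mathbb{R}$ is smooth and possibly nonconvex, and $\omega$ is lower semicontinuous. A function $g$ is $\kappa$-weakly convex if $g+\frac{\kappa}{2}\|\cdot\|^2$ is convex ($\kappa\ge0$). Partial linearization: $f_z(x,\xi):=h\big(c(z,\xi)+\langle\nabla c(z,\xi),x-z\rangle\big)$. Moreau envelope (for $\rho$ larger than the weak convexity constant of $\psi$): $\psi_{1/\rho}(x)=\min_y\{\psi(y)+\frac{\rho}{2}\|x-y\|^2\}$, $\operatorname{prox}_{\psi/\rho}(x)=\arg\min_y\{\psi(y)+\frac{\rho}{2}\|x-y\|^2\}$; $\psi_{1/\rho}$ is differentiable with $\nabla\psi_{1/\rho}(x)=\rho(x-\operatorname{prox}_{\psi/\rho}(x))$. DSPL: given an input point $x^1$, for $k=1,2,\dots$ a worker computes, with delay $\tau_k$, the values $c(x^{k-\tau_k},\xi^{k-\tau_k})$ and $\nabla c(x^{k-\tau_k},\xi^{k-\tau_k})$, and the master node sets $$x^{k+1}=\arg\min_{x\in\mathbb{R}^n}\Big\{f_{x^{k-\tau_k}}(x,\xi^{k-\tau_k})+\omega(x)+\frac{\gamma_k}{2}\|x-x^k\|^2\Big\}.$$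 The delays $\{\tau_k\}$ are regarded as a pre-defined random sequence independent of the data sampling and of the algorithm; the expectation in the bound is with this delay sequence given. Convention: $x^{k-j}=x^1$ if $j\ge k$.
   Formalization: Each update uses its own fresh i.i.d. sample, even when several updates share the index k−τ_k (with one shared ξ^{k−τ_k} the bound can fail), and the input point x^1 is assumed to lie in dom ω, the only set on which (iv) controls c. *)

theory Defs
  imports "HOL-Probability.Probability"
begin

text \<open>
  Extended-real-valued functions model terms such as \<open>\<omega>\<close> that may take the value \<open>\<infinity>\<close> (never
  \<open>-\<infinity>\<close>, which is a separate hypothesis wherever it matters).
\<close>

definition edom :: "('a \<Rightarrow> ereal) \<Rightarrow> 'a set" where
  "edom g = {x. g x < \<infinity>}"

definition lower_semicontinuous :: "('a::topological_space \<Rightarrow> ereal) \<Rightarrow> bool" where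
  "lower_semicontinuous g \<longleftrightarrow> (\<forall>x. g x \<le> Liminf (nhds x) g)"

definition ereal_convex :: "('a::real_vector \<Rightarrow> ereal) \<Rightarrow> bool" where
  "ereal_convex g \<longleftrightarrow>
     (\<forall>x y t. 0 \<le> t \<longrightarrow> t \<le> 1 \<longrightarrow>
        g ((1 - t) *\<^sub>R x + t *\<^sub>R y) \<le> ereal (1 - t) * g x + ereal t * g y)"

definition weakly_convex :: "real \<Rightarrow> ('a::real_normed_vector \<Rightarrow> ereal) \<Rightarrow> bool" where
  "weakly_convex \<kappa> g \<longleftrightarrow> 0 \<le> \<kappa> \<and> ereal_convex (\<lambda>x. g x + ereal (\<kappa> / 2 * (norm x)\<^sup>2))"

definition gradient :: "('a::real_inner \<Rightarrow> real) \<Rightarrow> 'a \<Rightarrow> 'a" where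
  "gradient g x = (THE D. GDERIV g x :> D)"

definition objective ::
  "'s measure \<Rightarrow> (real \<Rightarrow> real) \<Rightarrow> ('a \<Rightarrow> 's \<Rightarrow> real) \<Rightarrow> ('a \<Rightarrow> ereal) \<Rightarrow> 'a \<Rightarrow> ereal" where
  "objective \<Xi> h c \<omega> x = ereal (\<integral>s. h (c x s) \<partial>\<Xi>) + \<omega> x"

text \<open>\<open>moreau \<psi> \<rho>\<close> is the envelope usually written with subscript \<open>1/\<rho>\<close>.\<close>

definition moreau :: "('a::real_normed_vector \<Rightarrow> ereal) \<Rightarrow> real \<Rightarrow> 'a \<Rightarrow> ereal" where
  "moreau \<psi> \<rho> x = (INF y. \<psi> y + ereal (\<rho> / 2 * (norm (x - y))\<^sup>2))"

definition grad_moreau :: "('a::real_inner \<Rightarrow> ereal) \<Rightarrow> real \<Rightarrow> 'a \<Rightarrow> 'a" where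
  "grad_moreau \<psi> \<rho> = gradient (\<lambda>y. real_of_ereal (moreau \<psi> \<rho> y))"

definition partial_lin ::
  "(real \<Rightarrow> real) \<Rightarrow> ('a::real_inner \<Rightarrow> 's \<Rightarrow> real) \<Rightarrow> 'a \<Rightarrow> 'a \<Rightarrow> 's \<Rightarrow> real" where
  "partial_lin h c z x s = h (c z s + gradient (\<lambda>y. c y s) z \<bullet> (x - z))"

text \<open>The index \<open>k - d\<close>, with the convention that it is \<open>1\<close> when \<open>d \<ge> k\<close>.\<close>

definition stale :: "nat \<Rightarrow> nat \<Rightarrow> nat" where
  "stale k d = (if d \<ge> k then 1 else k - d)"

text \<open>
  \<open>dspl h c \<omega> \<gamma> x1 \<xi> \<tau> x\<close>: along one realization \<open>\<tau>\<close> of the delays and \<open>\<xi>\<close> of the samples, the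
  sequence \<open>x\<close> (indexed from 1) is a run of the delayed stochastic prox-linear method.

  The sample used in update \<open>k\<close> is the one superscripted \<open>k - \<tau> k\<close>, i.e. the sample drawn by the
  worker that started from the iterate \<open>x (k - \<tau> k)\<close>.  Nothing prevents \<open>k - \<tau> k\<close> from taking
  the same value for several \<open>k\<close> (several workers start from \<open>x 1\<close>, say), and each worker draws its
  own sample.  Therefore \<open>\<xi> j k\<close> carries a second index: it is the sample drawn by the worker that
  reads \<open>x j\<close> and reports in update \<open>k\<close>.  With one shared sample per superscript the iterate \<open>x k\<close>
  could already depend on the sample used in update \<open>k\<close>; for instance with \<open>\<tau> k = k - 1\<close> only one
  sample would ever be used, and no bound vanishing as the number of iterations grows could hold.
\<close>

definition dspl ::
  "(real \<Rightarrow> real) \<Rightarrow> ('a::real_inner \<Rightarrow> 's \<Rightarrow> real) \<Rightarrow> ('a \<Rightarrow> ereal) \<Rightarrow> (nat \<Rightarrow> real) \<Rightarrow> 'a \<Rightarrow>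
   (nat \<Rightarrow> nat \<Rightarrow> 's) \<Rightarrow> (nat \<Rightarrow> nat) \<Rightarrow> (nat \<Rightarrow> 'a) \<Rightarrow> bool" where
  "dspl h c \<omega> \<gamma> x1 \<xi> \<tau> x \<longleftrightarrow>
     x 1 = x1 \<and>
     (\<forall>k\<ge>1. is_arg_min
        (\<lambda>y. ereal (partial_lin h c (x (stale k (\<tau> k))) y (\<xi> (stale k (\<tau> k)) k))
             + \<omega> y + ereal (\<gamma> k / 2 * (norm (y - x k))\<^sup>2))
        (\<lambda>_. True) (x (Suc k)))"

text \<open>
  The \<open>\<sigma>\<close>-algebras generated by the samples, by the delays, and by both.  Expectations ``with the
  delay sequence given'' are conditional expectations with respect to \<open>delay_algebra\<close>.
\<close>

definition sample_space :: "'s measure \<Rightarrow> (nat \<times> nat \<Rightarrow> 's) measure" where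
  "sample_space \<Xi> = (\<Pi>\<^sub>M jk\<in>{1..} \<times> {1..}. \<Xi>)"

definition sample_seq :: "(nat \<Rightarrow> nat \<Rightarrow> 'w \<Rightarrow> 's) \<Rightarrow> 'w \<Rightarrow> nat \<times> nat \<Rightarrow> 's" where
  "sample_seq \<xi> w = (\<lambda>(j, k)\<in>{1..} \<times> {1..}. \<xi> j k w)"

definition delay_space :: "(nat \<Rightarrow> nat) measure" where
  "delay_space = (\<Pi>\<^sub>M k\<in>{1..}. count_space UNIV)"

definition delay_seq :: "(nat \<Rightarrow> 'w \<Rightarrow> nat) \<Rightarrow> 'w \<Rightarrow> nat \<Rightarrow> nat" where
  "delay_seq \<tau> w = (\<lambda>k\<in>{1..}. \<tau> k w)"

definition sample_algebra :: "'w measure \<Rightarrow> 's measure \<Rightarrow> (nat \<Rightarrow> nat \<Rightarrow> 'w \<Rightarrow> 's) \<Rightarrow> 'w measure" where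
  "sample_algebra M \<Xi> \<xi> = vimage_algebra (space M) (sample_seq \<xi>) (sample_space \<Xi>)"

definition delay_algebra :: "'w measure \<Rightarrow> (nat \<Rightarrow> 'w \<Rightarrow> nat) \<Rightarrow> 'w measure" where
  "delay_algebra M \<tau> = vimage_algebra (space M) (delay_seq \<tau>) delay_space"

definition run_algebra ::
  "'w measure \<Rightarrow> 's measure \<Rightarrow> (nat \<Rightarrow> nat \<Rightarrow> 'w \<Rightarrow> 's) \<Rightarrow> (nat \<Rightarrow> 'w \<Rightarrow> nat) \<Rightarrow> 'w measure" where
  "run_algebra M \<Xi> \<xi> \<tau> =
     vimage_algebra (space M) (\<lambda>w. (sample_seq \<xi> w, delay_seq \<tau> w)) (sample_space \<Xi> \<Otimes>\<^sub>M delay_space)"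

end

theory Submission
  imports Defs
begin

text \<open>
  The progress measure is the Moreau envelope of \<open>\<psi>\<close>.  Its gradient at \<open>x\<close> is \<open>\<rho> (x - p x)\<close> with \<open>p\<close> the
  proximal map of \<open>\<psi>\<close> (\<open>grad_moreau_eq\<close>), so the theorem is a bound on the mean of \<open>|p x - x|\<^sup>2\<close> along
  the run.

  The domain of \<open>\<omega>\<close> is closed and convex, and on it \<open>\<psi>\<close> and all models are Lipschitz and weakly convex.
  Every update and every proximal point is therefore the unique minimiser of a strongly convex function,
  with quadratic growth around it.  Adding the growth inequality of the update, tested at \<open>p x\<close>, to
  that of \<open>p x\<close>, tested at the new iterate, shows that an update moves towards \<open>p x\<close> up to a slope
  term of size \<open>1 / (\<gamma> - \<rho>)\<close> and a noise term (\<open>one_step\<close>); moving towards \<open>p x\<close> lowers the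
  envelope (\<open>env_descent\<close>).  Summed along a path the envelope differences telescope to at most
  the gap between the envelope at the starting point and the infimum of \<open>\<psi>\<close>.

  Fix the delays.  The sample of update \<open>k\<close> is independent of the current and of the stale iterate,
  so in the mean the noise is only the linearisation error, bounded by squared distances to the stale
  iterate (\<open>noise_expectation_le\<close>).  A stale iterate is at most \<open>\<tau> k\<close> updates old and an update has length
  \<open>O(1/\<gamma>)\<close>, which gives the term with the squared delays (\<open>drift_le\<close>).  Together this is
  \<open>sum_residual_le\<close>; inserting the value of \<open>\<gamma>\<close> gives the rate (\<open>mean_rate\<close>).

  To pass to random delays, note that only the first \<open>K\<close> delays matter and that they take countably
  many values.  On the event that they take a given value the run is a fixed function of the
  samples, which are independent of the delays, and the output index is independent of both.  Hence
  the conditional expectation is the uniform average of the expectations for frozen delays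
  (\<open>nn_cond_exp_random_index\<close>).  This needs the iterates to be measurable: a minimiser with quadratic
  growth is a limit of near-minimisers taken from a countable dense set (\<open>measurable_minimiser\<close>).
\<close>

section \<open>Weakly convex functions and their proximal maps\<close>

text \<open>
  The inequality form of \<open>m\<close>-weak convexity: the defect of convexity along a segment is controlled
  by the quadratic \<open>m/2 t (1 - t) |x - y|\<^sup>2\<close>, which is exactly the strong convexity gain of
  \<open>m/2 |\<cdot>|\<^sup>2\<close>.  In this form weak convexity is additive and survives integration.
\<close>

definition weakly_convex_on :: "'a::real_inner set \<Rightarrow> real \<Rightarrow> ('a \<Rightarrow> real) \<Rightarrow> bool" where
  "weakly_convex_on S m g \<longleftrightarrow>
     (\<forall>x\<in>S. \<forall>y\<in>S. \<forall>t. 0 \<le> t \<longrightarrow> t \<le> 1 \<longrightarrow>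
        g ((1 - t) *\<^sub>R x + t *\<^sub>R y) \<le> (1 - t) * g x + t * g y + m / 2 * (t * (1 - t)) * (norm (x - y))\<^sup>2)"

lemma weakly_convex_onD:
  assumes "weakly_convex_on S m g" "x \<in> S" "y \<in> S" "0 \<le> t" "t \<le> 1"
  shows "g ((1 - t) *\<^sub>R x + t *\<^sub>R y) \<le> (1 - t) * g x + t * g y + m / 2 * (t * (1 - t)) * (norm (x - y))\<^sup>2"
  using assms unfolding weakly_convex_on_def by blast

lemma weakly_convex_on_add:
  assumes "weakly_convex_on S m f" "weakly_convex_on S n g"
  shows "weakly_convex_on S (m + n) (\<lambda>x. f x + g x)"
  unfolding weakly_convex_on_def
proof (intro ballI allI impI)
  fix x y t assume a: "x \<in> S" "y \<in> S" "0 \<le> t" "t \<le> (1::real)"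
  show "f ((1 - t) *\<^sub>R x + t *\<^sub>R y) + g ((1 - t) *\<^sub>R x + t *\<^sub>R y)
      \<le> (1 - t) * (f x + g x) + t * (f y + g y) + (m + n) / 2 * (t * (1 - t)) * (norm (x - y))\<^sup>2"
    using weakly_convex_onD[OF assms(1) a] weakly_convex_onD[OF assms(2) a]
    by (simp add: algebra_simps add_divide_distrib)
qed

lemma norm_sq_convex_combination:
  fixes x y :: "'a::real_inner"
  shows "(norm ((1 - t) *\<^sub>R x + t *\<^sub>R y))\<^sup>2 =
    (1 - t) * (norm x)\<^sup>2 + t * (norm y)\<^sup>2 - t * (1 - t) * (norm (x - y))\<^sup>2"
proof -
  have "x \<bullet> y = y \<bullet> x" by (rule inner_commute)
  then show ?thesis
    unfolding power2_norm_eq_inner inner_add inner_diff inner_scaleR_left inner_scaleR_right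
    by (simp add: algebra_simps)
qed

definition prox :: "'a::real_normed_vector set \<Rightarrow> ('a \<Rightarrow> real) \<Rightarrow> real \<Rightarrow> 'a \<Rightarrow> 'a" where
  "prox S \<phi> \<gamma> x = arg_min_on (\<lambda>y. \<phi> y + \<gamma> / 2 * (norm (y - x))\<^sup>2) S"

locale prox_function =
  fixes S :: "'a::euclidean_space set" and \<phi> :: "'a \<Rightarrow> real" and L m \<gamma> :: real
  assumes S_nonempty: "S \<noteq> {}" and S_closed: "closed S" and S_convex: "convex S"
    and lipschitz: "L-lipschitz_on S \<phi>"
    and wconvex: "weakly_convex_on S m \<phi>"
    and m_nonneg: "0 \<le> m" and \<gamma>_gt: "m < \<gamma>"
begin

text \<open>
  The Lipschitz function decreases at most linearly, so the quadratic term confines the relevant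
  sublevel set to a ball and compactness gives a minimiser.
\<close>

lemma prox_minimises:
  "prox S \<phi> \<gamma> x \<in> S \<and>
   (\<forall>y\<in>S. \<phi> (prox S \<phi> \<gamma> x) + \<gamma> / 2 * (norm (prox S \<phi> \<gamma> x - x))\<^sup>2 \<le> \<phi> y + \<gamma> / 2 * (norm (y - x))\<^sup>2)"
proof -
  let ?g = "\<lambda>y. \<phi> y + \<gamma> / 2 * (norm (y - x))\<^sup>2"
  have g0: "0 < \<gamma>" using m_nonneg \<gamma>_gt by simp
  have L0: "0 \<le> L" using lipschitz by (rule lipschitz_on_nonneg)
  obtain a where a: "a \<in> S" using S_nonempty by blast
  define B where "B = L * norm (a - x) + \<gamma> / 2 * (norm (a - x))\<^sup>2"
  have B0: "0 \<le> B" unfolding B_def using L0 g0 by simp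
  define R where "R = max (norm (a - x)) (max 1 (2 * (L + B) / \<gamma>))"
  have outside: "?g a < ?g y" if y: "y \<in> S" "R < norm (y - x)" for y
  proof -
    let ?r = "norm (y - x)"
    have r1: "1 < ?r" and r2: "2 * (L + B) / \<gamma> < ?r" using y(2) by (auto simp: R_def)
    have "\<phi> a - \<phi> y \<le> L * norm (a - y)"
      using lipschitz_onD[OF lipschitz a y(1)] by (simp add: dist_norm)
    also have "norm (a - y) \<le> norm (a - x) + ?r"
      using norm_triangle_ineq4[of "a - x" "y - x"] by simp
    then have "L * norm (a - y) \<le> L * (norm (a - x) + ?r)" using L0 by (rule mult_left_mono)
    finally have 1: "\<phi> a \<le> \<phi> y + L * norm (a - x) + L * ?r" by (simp add: algebra_simps)
    have "2 * (L + B) < ?r * \<gamma>" using r2 g0 by (simp add: pos_divide_less_eq)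
    then have "2 * (L + B) * ?r < ?r * \<gamma> * ?r" using r1 by (intro mult_strict_right_mono) auto
    moreover have "B \<le> B * ?r" using B0 r1 by (simp add: mult_le_cancel_left1)
    ultimately have "L * ?r + B < \<gamma> / 2 * ?r\<^sup>2" by (simp add: algebra_simps power2_eq_square)
    then show ?thesis using 1 unfolding B_def by simp
  qed
  have cont: "continuous_on (S \<inter> cball x R) ?g"
    by (intro continuous_intros continuous_on_subset[OF lipschitz_on_continuous_on[OF lipschitz]]) auto
  have aS: "a \<in> S \<inter> cball x R" using a by (simp add: R_def dist_norm norm_minus_commute)
  have "compact (S \<inter> cball x R)" by (rule closed_Int_compact[OF S_closed]) simp
  then obtain u where u: "u \<in> S \<inter> cball x R" "\<And>y. y \<in> S \<inter> cball x R \<Longrightarrow> ?g u \<le> ?g y"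
    using continuous_attains_inf[OF _ _ cont] aS by (metis empty_iff)
  have min: "?g u \<le> ?g y" if "y \<in> S" for y
  proof (cases "R < norm (y - x)")
    case True
    then show ?thesis using outside[OF that True] u(2)[OF aS] by linarith
  next
    case False
    then show ?thesis using that by (intro u(2)) (simp add: dist_norm norm_minus_commute)
  qed
  have "is_arg_min ?g (\<lambda>y. y \<in> S) u"
    using u(1) min by (auto simp: is_arg_min_linorder)
  then have "is_arg_min ?g (\<lambda>y. y \<in> S) (prox S \<phi> \<gamma> x)"
    unfolding prox_def arg_min_on_def arg_min_def by (rule someI)
  then show ?thesis by (simp add: is_arg_min_linorder)
qed

lemma prox_in: "prox S \<phi> \<gamma> x \<in> S"
  using prox_minimises by blast

text \<open>
  Comparing a minimiser \<open>u\<close> with the point \<open>(1 - t) u + t y\<close>, dividing by \<open>t\<close> and letting \<open>t\<close>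
  tend to 0 upgrades minimality to quadratic growth with modulus \<open>\<gamma> - m\<close>.
\<close>

lemma minimiser_quadratic_growth:
  assumes u: "u \<in> S" and min: "\<And>y. y \<in> S \<Longrightarrow> \<phi> u + \<gamma> / 2 * (norm (u - x))\<^sup>2 \<le> \<phi> y + \<gamma> / 2 * (norm (y - x))\<^sup>2"
    and y: "y \<in> S"
  shows "\<phi> u + \<gamma> / 2 * (norm (u - x))\<^sup>2 + (\<gamma> - m) / 2 * (norm (y - u))\<^sup>2 \<le> \<phi> y + \<gamma> / 2 * (norm (y - x))\<^sup>2"
proof -
  let ?g = "\<lambda>y. \<phi> y + \<gamma> / 2 * (norm (y - x))\<^sup>2"
  let ?q = "(\<gamma> - m) / 2 * (norm (y - u))\<^sup>2"
  have step: "?g u + (1 - t) * ?q \<le> ?g y" if t: "0 < t" "t < 1" for t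
  proof -
    let ?v = "(1 - t) *\<^sub>R u + t *\<^sub>R y"
    have "?v \<in> S" using S_convex u y t by (auto simp: convex_alt)
    then have "?g u \<le> ?g ?v" by (rule min)
    also have "?v - x = (1 - t) *\<^sub>R (u - x) + t *\<^sub>R (y - x)" by (simp add: algebra_simps)
    also have "(norm ((1 - t) *\<^sub>R (u - x) + t *\<^sub>R (y - x)))\<^sup>2 =
        (1 - t) * (norm (u - x))\<^sup>2 + t * (norm (y - x))\<^sup>2 - t * (1 - t) * (norm (u - y))\<^sup>2"
      using norm_sq_convex_combination[of t "u - x" "y - x"] by simp
    also have "\<phi> ?v \<le> (1 - t) * \<phi> u + t * \<phi> y + m / 2 * (t * (1 - t)) * (norm (u - y))\<^sup>2"
      using wconvex u y t by (intro weakly_convex_onD) auto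
    finally have "?g u \<le> (1 - t) * \<phi> u + t * \<phi> y + m / 2 * (t * (1 - t)) * (norm (u - y))\<^sup>2 +
        \<gamma> / 2 * ((1 - t) * (norm (u - x))\<^sup>2 + t * (norm (y - x))\<^sup>2 - t * (1 - t) * (norm (u - y))\<^sup>2)"
      by simp
    then have "t * (?g u + (1 - t) * ?q) \<le> t * ?g y"
      by (simp add: norm_minus_commute[of y u] field_simps)
    then show ?thesis using t by simp
  qed
  have "((\<lambda>t. ?g u + (1 - t) * ?q) \<longlongrightarrow> ?g u + (1 - 0) * ?q) (at_right 0)"
    by (intro tendsto_intros)
  moreover have "\<forall>\<^sub>F t in at_right 0. ?g u + (1 - t) * ?q \<le> ?g y"
    unfolding eventually_at_right_field using step by (intro exI[of _ 1]) auto
  ultimately have "?g u + (1 - 0) * ?q \<le> ?g y"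
    by (intro tendsto_upperbound) auto
  then show ?thesis by simp
qed

lemma prox_quadratic_growth:
  assumes "y \<in> S"
  shows "\<phi> (prox S \<phi> \<gamma> x) + \<gamma> / 2 * (norm (prox S \<phi> \<gamma> x - x))\<^sup>2 + (\<gamma> - m) / 2 * (norm (y - prox S \<phi> \<gamma> x))\<^sup>2
    \<le> \<phi> y + \<gamma> / 2 * (norm (y - x))\<^sup>2"
  using prox_minimises assms by (intro minimiser_quadratic_growth) auto

lemma prox_unique:
  assumes u: "u \<in> S" and min: "\<And>y. y \<in> S \<Longrightarrow> \<phi> u + \<gamma> / 2 * (norm (u - x))\<^sup>2 \<le> \<phi> y + \<gamma> / 2 * (norm (y - x))\<^sup>2"
  shows "u = prox S \<phi> \<gamma> x"
proof -
  have "(\<gamma> - m) / 2 * (norm (u - prox S \<phi> \<gamma> x))\<^sup>2 \<le> 0"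
    using prox_quadratic_growth[OF u, of x] min[OF prox_in, of x] by linarith
  then have "(norm (u - prox S \<phi> \<gamma> x))\<^sup>2 \<le> 0"
    using \<gamma>_gt by (simp add: mult_le_0_iff)
  then show ?thesis by simp
qed

text \<open>Starting inside \<open>S\<close>, a proximal step cannot be longer than slope over curvature.\<close>

lemma prox_step_le:
  assumes x: "x \<in> S"
    and slope: "\<phi> x - \<phi> (prox S \<phi> \<gamma> x) \<le> l * norm (x - prox S \<phi> \<gamma> x)" and l: "0 \<le> l"
  shows "norm (prox S \<phi> \<gamma> x - x) \<le> l / (\<gamma> - m / 2)"
proof -
  let ?n = "norm (x - prox S \<phi> \<gamma> x)"
  have pos: "0 < \<gamma> - m / 2" using \<gamma>_gt m_nonneg by linarith
  have "\<gamma> / 2 * ?n\<^sup>2 + (\<gamma> - m) / 2 * ?n\<^sup>2 \<le> \<phi> x - \<phi> (prox S \<phi> \<gamma> x)"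
    using prox_quadratic_growth[OF x, of x] by (simp add: norm_minus_commute)
  also have "\<dots> \<le> l * ?n" by (rule slope)
  finally have "(\<gamma> - m / 2) * ?n * ?n \<le> l * ?n" by (simp add: field_simps power2_eq_square)
  then have "(\<gamma> - m / 2) * ?n \<le> l" using l
    by (cases "?n = 0") (simp_all add: mult_le_cancel_right)
  then show ?thesis using pos by (simp add: pos_le_divide_eq mult.commute norm_minus_commute)
qed

text \<open>Adding the growth inequalities at two centres gives the cocoercivity-type Lipschitz bound.\<close>

lemma prox_lipschitz: "(\<gamma> / (\<gamma> - m))-lipschitz_on UNIV (prox S \<phi> \<gamma>)"
proof (rule lipschitz_onI)
  show "0 \<le> \<gamma> / (\<gamma> - m)" using \<gamma>_gt m_nonneg by simp
  fix x y :: 'a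
  let ?u = "prox S \<phi> \<gamma> x" and ?v = "prox S \<phi> \<gamma> y"
  have pos: "0 < \<gamma> - m" "0 < \<gamma>" using \<gamma>_gt m_nonneg by simp_all
  have "(\<gamma> - m) * (norm (?u - ?v))\<^sup>2 \<le> \<gamma> / 2 * ((norm (?v - x))\<^sup>2 - (norm (?u - x))\<^sup>2 + (norm (?u - y))\<^sup>2 - (norm (?v - y))\<^sup>2)"
    using prox_quadratic_growth[OF prox_in, of x y] prox_quadratic_growth[OF prox_in, of y x]
    by (simp add: norm_minus_commute[of ?v ?u] field_simps)
  also have "\<dots> = \<gamma> * ((?u - ?v) \<bullet> (x - y))"
    by (simp add: power2_norm_eq_inner inner_diff inner_commute algebra_simps)
  also have "\<dots> \<le> \<gamma> * (norm (?u - ?v) * norm (x - y))"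
    using pos by (intro mult_left_mono norm_cauchy_schwarz) auto
  finally have "((\<gamma> - m) * norm (?u - ?v)) * norm (?u - ?v) \<le> (\<gamma> * norm (x - y)) * norm (?u - ?v)"
    by (simp add: power2_eq_square mult_ac)
  then have "(\<gamma> - m) * norm (?u - ?v) \<le> \<gamma> * norm (x - y)"
    using pos by (cases "norm (?u - ?v) = 0") (auto simp only: mult_le_cancel_right norm_ge_zero, auto)
  then show "dist ?u ?v \<le> \<gamma> / (\<gamma> - m) * dist x y"
    using pos by (simp add: dist_norm field_simps)
qed

section \<open>The Moreau envelope\<close>

definition env :: "'a \<Rightarrow> real" where
  "env x = \<phi> (prox S \<phi> \<gamma> x) + \<gamma> / 2 * (norm (prox S \<phi> \<gamma> x - x))\<^sup>2"

lemma env_le: "y \<in> S \<Longrightarrow> env x \<le> \<phi> y + \<gamma> / 2 * (norm (y - x))\<^sup>2"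
  unfolding env_def using prox_minimises by blast

lemma env_shift_le: "env (x + v) \<le> env x + \<gamma> * ((x - prox S \<phi> \<gamma> x) \<bullet> v) + \<gamma> / 2 * (norm v)\<^sup>2"
proof -
  let ?u = "prox S \<phi> \<gamma> x"
  have "(norm (?u - (x + v)))\<^sup>2 = (norm (?u - x))\<^sup>2 + 2 * ((x - ?u) \<bullet> v) + (norm v)\<^sup>2"
    by (simp add: power2_norm_eq_inner inner_add inner_diff inner_commute algebra_simps)
  then have "env (x + v) \<le> \<phi> ?u + \<gamma> / 2 * ((norm (?u - x))\<^sup>2 + 2 * ((x - ?u) \<bullet> v) + (norm v)\<^sup>2)"
    using env_le[OF prox_in, of "x + v" x] by metis
  then show ?thesis by (simp add: env_def distrib_left)
qed

text \<open>
  The upper bound of the previous lemma, used once at \<open>x\<close> and once at \<open>x + v\<close>, encloses the increment of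
  the envelope; the two linear terms differ by \<open>O(|v|\<^sup>2)\<close> because the proximal map is Lipschitz.
\<close>

lemma GDERIV_env: "GDERIV env x :> \<gamma> *\<^sub>R (x - prox S \<phi> \<gamma> x)"
proof -
  let ?p = "prox S \<phi> \<gamma>"
  have pos: "0 < \<gamma> - m" "0 < \<gamma>" using \<gamma>_gt m_nonneg by simp_all
  define B where "B = \<gamma> * (1 + \<gamma> / (\<gamma> - m)) + \<gamma>"
  have B0: "0 \<le> B" unfolding B_def using pos by simp
  have up: "env (x + v) - env x - \<gamma> * ((x - ?p x) \<bullet> v) \<le> B * (norm v)\<^sup>2" for v
  proof -
    have "\<gamma> / 2 * (norm v)\<^sup>2 \<le> B * (norm v)\<^sup>2"
      using pos by (intro mult_right_mono) (auto simp: B_def add_increasing)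
    then show ?thesis using env_shift_le[of x v] by linarith
  qed
  have low: "- (B * (norm v)\<^sup>2) \<le> env (x + v) - env x - \<gamma> * ((x - ?p x) \<bullet> v)" for v
  proof -
    have 1: "env x \<le> env (x + v) - \<gamma> * ((x + v - ?p (x + v)) \<bullet> v) + \<gamma> / 2 * (norm v)\<^sup>2"
      using env_shift_le[of "x + v" "- v"] by simp
    have "\<bar>((x - ?p x) - (x + v - ?p (x + v))) \<bullet> v\<bar> \<le> norm ((x - ?p x) - (x + v - ?p (x + v))) * norm v"
      by (rule Cauchy_Schwarz_ineq2)
    also have "norm ((x - ?p x) - (x + v - ?p (x + v))) \<le> norm v + norm (?p (x + v) - ?p x)"
      using norm_triangle_ineq[of "- v" "?p (x + v) - ?p x"] by (simp add: algebra_simps)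
    also have "norm (?p (x + v) - ?p x) \<le> \<gamma> / (\<gamma> - m) * norm v"
      using lipschitz_onD[OF prox_lipschitz, of "x + v" x] by (simp add: dist_norm)
    finally have "\<bar>((x - ?p x) - (x + v - ?p (x + v))) \<bullet> v\<bar> \<le> (1 + \<gamma> / (\<gamma> - m)) * (norm v)\<^sup>2"
      by (simp add: power2_eq_square algebra_simps mult_right_mono)
    then have "\<gamma> * \<bar>((x - ?p x) - (x + v - ?p (x + v))) \<bullet> v\<bar> \<le> \<gamma> * ((1 + \<gamma> / (\<gamma> - m)) * (norm v)\<^sup>2)"
      using pos by (intro mult_left_mono) auto
    moreover have "\<gamma> * (((x - ?p x) - (x + v - ?p (x + v))) \<bullet> v) \<le> \<gamma> * \<bar>((x - ?p x) - (x + v - ?p (x + v))) \<bullet> v\<bar>"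
      using pos by (intro mult_left_mono) auto
    ultimately have 2: "\<gamma> * ((x - ?p x) \<bullet> v) \<le> \<gamma> * ((x + v - ?p (x + v)) \<bullet> v) + \<gamma> * (1 + \<gamma> / (\<gamma> - m)) * (norm v)\<^sup>2"
      by (simp add: inner_diff_left algebra_simps)
    have "\<gamma> * (1 + \<gamma> / (\<gamma> - m)) * (norm v)\<^sup>2 + \<gamma> / 2 * (norm v)\<^sup>2 \<le> B * (norm v)\<^sup>2"
      unfolding distrib_right[symmetric] using pos by (intro mult_right_mono) (auto simp: B_def)
    then show ?thesis using 1 2 by linarith
  qed
  have bound: "\<bar>env (x + v) - env x - v \<bullet> (\<gamma> *\<^sub>R (x - ?p x))\<bar> \<le> B * (norm v)\<^sup>2" for v
    using up[of v] low[of v] by (simp add: inner_commute)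
  have "((\<lambda>v. norm (env (x + v) - env x - v \<bullet> (\<gamma> *\<^sub>R (x - ?p x))) / norm v) \<longlongrightarrow> 0) (at 0)"
  proof (rule tendsto_sandwich[of "\<lambda>_. 0" _ _ "\<lambda>v. B * norm v"])
    show "((\<lambda>v::'a. B * norm v) \<longlongrightarrow> 0) (at 0)"
      by (rule tendsto_eq_intros tendsto_norm_zero tendsto_ident_at refl)+ simp
    show "\<forall>\<^sub>F v in at 0. norm (env (x + v) - env x - v \<bullet> (\<gamma> *\<^sub>R (x - ?p x))) / norm v \<le> B * norm v"
    proof (intro always_eventually allI)
      fix v :: 'a
      show "norm (env (x + v) - env x - v \<bullet> (\<gamma> *\<^sub>R (x - ?p x))) / norm v \<le> B * norm v"
        using bound[of v] by (cases "v = 0") (simp_all add: field_simps power2_eq_square)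
    qed
  qed auto
  then show ?thesis
    unfolding gderiv_def has_derivative_at by (intro conjI bounded_linear_inner_left)
qed

end

lemma gradient_eqI:
  assumes "GDERIV g x :> D"
  shows "gradient g x = D"
  unfolding gradient_def
proof (rule the_equality)
  fix D' assume "GDERIV g x :> D'"
  then have "(\<lambda>h. h \<bullet> D') = (\<lambda>h. h \<bullet> D)"
    using assms unfolding gderiv_def by (rule has_derivative_unique)
  then have "\<forall>h. h \<bullet> D' = h \<bullet> D" by (simp add: fun_eq_iff)
  then show "D' = D" by (simp only: vector_eq_rdot inner_commute[of _ D'] inner_commute[of _ D] vector_eq_ldot)
qed (rule assms)

text \<open>
  On \<open>\<psi>\<close> taking the value \<open>\<infinity>\<close> outside \<open>S\<close> the extended-real envelope is the real one, so its
  gradient is the scaled proximal residual.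
\<close>

lemma (in prox_function) moreau_eq_env:
  assumes "\<And>y. y \<in> S \<Longrightarrow> \<psi> y = ereal (\<phi> y)" and "\<And>y. y \<notin> S \<Longrightarrow> \<psi> y = \<infinity>"
  shows "moreau \<psi> \<gamma> x = ereal (env x)"
  unfolding moreau_def
proof (rule antisym)
  show "(INF y. \<psi> y + ereal (\<gamma> / 2 * (norm (x - y))\<^sup>2)) \<le> ereal (env x)"
    by (rule INF_lower2[of "prox S \<phi> \<gamma> x"]) (simp_all add: assms prox_in env_def norm_minus_commute)
  show "ereal (env x) \<le> (INF y. \<psi> y + ereal (\<gamma> / 2 * (norm (x - y))\<^sup>2))"
  proof (rule INF_greatest)
    fix y
    show "ereal (env x) \<le> \<psi> y + ereal (\<gamma> / 2 * (norm (x - y))\<^sup>2)"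
      using assms env_le[of y x] by (cases "y \<in> S") (auto simp: norm_minus_commute)
  qed
qed

lemma (in prox_function) grad_moreau_eq:
  assumes "\<And>y. y \<in> S \<Longrightarrow> \<psi> y = ereal (\<phi> y)" and "\<And>y. y \<notin> S \<Longrightarrow> \<psi> y = \<infinity>"
  shows "grad_moreau \<psi> \<gamma> x = \<gamma> *\<^sub>R (x - prox S \<phi> \<gamma> x)"
  unfolding grad_moreau_def by (rule gradient_eqI) (simp add: moreau_eq_env[OF assms] GDERIV_env)

section \<open>Measurability of compositions and of minimisers\<close>

text \<open>
  A function continuous in one argument and measurable in the other may be composed with measurable
  maps: approximate the continuous argument by maps with finitely many values.
\<close>

lemma measurable_caratheodory:
  fixes c :: "'a::{metric_space, second_countable_topology} \<Rightarrow> 's \<Rightarrow> real"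
  assumes c: "\<And>y. (\<lambda>s. c y s) \<in> borel_measurable X"
    and cont: "\<And>s. s \<in> space X \<Longrightarrow> continuous_on UNIV (\<lambda>y. c y s)"
    and Z: "Z \<in> borel_measurable N" and s: "s \<in> N \<rightarrow>\<^sub>M X"
  shows "(\<lambda>w. c (Z w) (s w)) \<in> borel_measurable N"
proof -
  obtain F where F: "\<And>i. simple_function N (F i)" "\<And>w. w \<in> space N \<Longrightarrow> (\<lambda>i. F i w) \<longlonglongrightarrow> Z w"
    using borel_measurable_implies_sequence_metric[OF Z] by metis
  have "(\<lambda>w. c (F i w) (s w)) \<in> borel_measurable N" for i
  proof (rule measurable_compose_countable'[where g = "F i" and I = "F i ` space N"])
    show "(\<lambda>w. c y (s w)) \<in> borel_measurable N" for y
      by (rule measurable_compose[OF s c])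
    show "F i \<in> N \<rightarrow>\<^sub>M count_space (F i ` space N)"
      using F(1)[of i] by (subst measurable_count_space_eq2) (auto simp: simple_function_def)
    show "countable (F i ` space N)"
      using F(1)[of i] by (simp add: simple_function_def countable_finite)
  qed
  then show ?thesis
  proof (rule borel_measurable_LIMSEQ_metric)
    fix w assume w: "w \<in> space N"
    then have "s w \<in> space X" using s by (rule measurable_space[rotated])
    then have "isCont (\<lambda>y. c y (s w)) (Z w)" using cont by (simp add: continuous_on_eq_continuous_at)
    then show "(\<lambda>i. c (F i w) (s w)) \<longlonglongrightarrow> c (Z w) (s w)"
      using F(2)[OF w] by (rule isCont_tendsto_compose)
  qed
qed

text \<open>
  Near-minimisers chosen from a countable dense subset are measurable; quadratic growth makes them
  converge to the minimiser.
\<close>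

lemma measurable_minimiser:
  fixes \<Phi> :: "'a::euclidean_space \<Rightarrow> 'w \<Rightarrow> real"
  assumes meas: "\<And>y. y \<in> S \<Longrightarrow> (\<lambda>w. \<Phi> y w) \<in> borel_measurable N"
    and cont: "\<And>w. w \<in> space N \<Longrightarrow> continuous_on S (\<lambda>y. \<Phi> y w)"
    and u: "\<And>w. w \<in> space N \<Longrightarrow> u w \<in> S"
    and growth: "\<And>w y. w \<in> space N \<Longrightarrow> y \<in> S \<Longrightarrow> \<Phi> (u w) w + \<mu> * (norm (y - u w))\<^sup>2 \<le> \<Phi> y w"
    and \<mu>: "0 < \<mu>" and S: "S \<noteq> {}"
  shows "u \<in> borel_measurable N"
proof -
  obtain T where T: "countable T" "T \<subseteq> S" "S \<subseteq> closure T" by (rule separable)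
  have T0: "T \<noteq> {}" using T S by auto
  define q where "q = from_nat_into T"
  have q: "q i \<in> S" for i using from_nat_into[OF T0] T(2) by (auto simp: q_def)
  have rq: "range q = T" unfolding q_def by (rule range_from_nat_into[OF T0 T(1)])
  define m where "m w = (INF i. \<Phi> (q i) w)" for w
  have min: "\<Phi> (u w) w \<le> \<Phi> y w" if "w \<in> space N" "y \<in> S" for w y
  proof -
    have "0 \<le> \<mu> * (norm (y - u w))\<^sup>2" using \<mu> by simp
    then show ?thesis using growth[OF that] by linarith
  qed
  have near: "\<exists>i. \<Phi> (q i) w < \<Phi> (u w) w + e" if w: "w \<in> space N" and e: "0 < e" for w e
  proof -
    obtain d where d: "0 < d" "\<And>y. y \<in> S \<Longrightarrow> dist y (u w) < d \<Longrightarrow> dist (\<Phi> y w) (\<Phi> (u w) w) < e"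
      using cont[OF w] u[OF w] e unfolding continuous_on_iff by blast
    obtain y where y: "y \<in> T" "dist y (u w) < d"
      using T(3) u[OF w] d(1) by (meson closure_approachable subsetD)
    obtain i where "y = q i" using rq y(1) by blast
    then have "dist (\<Phi> (q i) w) (\<Phi> (u w) w) < e" using d(2)[OF q[of i]] y(2) by simp
    then show ?thesis by (intro exI[of _ i]) (simp add: dist_real_def)
  qed
  have bdd: "bdd_below (range (\<lambda>i. \<Phi> (q i) w))" if "w \<in> space N" for w
    using min[OF that q] by (intro bdd_belowI2)
  have m_meas [measurable]: "m \<in> borel_measurable N"
    unfolding m_def by (rule borel_measurable_cINF[OF _ meas[OF q] bdd]) auto
  have m: "m w = \<Phi> (u w) w" if w: "w \<in> space N" for w
  proof (rule antisym)
    show "\<Phi> (u w) w \<le> m w" unfolding m_def by (rule cINF_greatest) (use min[OF w q] in auto)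
    show "m w \<le> \<Phi> (u w) w"
    proof (rule field_le_epsilon)
      fix e :: real assume "0 < e"
      then obtain i where "\<Phi> (q i) w < \<Phi> (u w) w + e" using near[OF w] by blast
      moreover have "m w \<le> \<Phi> (q i) w" unfolding m_def by (rule cINF_lower[OF bdd[OF w]]) simp
      ultimately show "m w \<le> \<Phi> (u w) w + e" by linarith
    qed
  qed
  define I where "I n w = (LEAST i. \<Phi> (q i) w < m w + inverse (real (Suc n)))" for n w
  have q_meas [measurable]: "(\<lambda>w. \<Phi> (q i) w) \<in> borel_measurable N" for i by (rule meas[OF q])
  have [measurable]: "I n \<in> N \<rightarrow>\<^sub>M count_space UNIV" for n
    unfolding I_def by measurable
  have I: "\<Phi> (q (I n w)) w < m w + inverse (real (Suc n))" if w: "w \<in> space N" for n w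
    unfolding I_def using near[OF w, of "inverse (real (Suc n))"] m[OF w] by (auto intro: LeastI_ex)
  show ?thesis
  proof (rule borel_measurable_LIMSEQ_metric)
    show "(\<lambda>w. q (I n w)) \<in> borel_measurable N" for n by measurable
    fix w assume w: "w \<in> space N"
    have "(\<lambda>n. (norm (q (I n w) - u w))\<^sup>2) \<longlonglongrightarrow> 0"
    proof (rule tendsto_sandwich[of "\<lambda>_. 0" _ _ "\<lambda>n. inverse (real (Suc n)) / \<mu>"])
      show "(\<lambda>n. inverse (real (Suc n)) / \<mu>) \<longlonglongrightarrow> 0"
        using tendsto_divide[OF LIMSEQ_inverse_real_of_nat tendsto_const[of \<mu>]] \<mu> by simp
      show "\<forall>\<^sub>F n in sequentially. (norm (q (I n w) - u w))\<^sup>2 \<le> inverse (real (Suc n)) / \<mu>"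
      proof (intro always_eventually allI)
        fix n
        have "\<mu> * (norm (q (I n w) - u w))\<^sup>2 \<le> inverse (real (Suc n))"
          using growth[OF w q, of "I n w"] I[OF w, of n] m[OF w] by linarith
        then show "(norm (q (I n w) - u w))\<^sup>2 \<le> inverse (real (Suc n)) / \<mu>"
          using \<mu> by (simp add: pos_le_divide_eq mult.commute)
      qed
    qed auto
    then have "(\<lambda>n. sqrt ((norm (q (I n w) - u w))\<^sup>2)) \<longlonglongrightarrow> sqrt 0" by (rule tendsto_real_sqrt)
    then have "(\<lambda>n. q (I n w) - u w) \<longlonglongrightarrow> 0" by (simp add: tendsto_norm_zero_iff)
    then show "(\<lambda>n. q (I n w)) \<longlonglongrightarrow> u w" by (simp add: LIM_zero_iff)
  qed
qed

lemma abs_integral_le: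
  fixes f g :: "'s \<Rightarrow> real"
  assumes "integrable N f" "integrable N g" "\<And>x. x \<in> space N \<Longrightarrow> \<bar>f x\<bar> \<le> g x"
  shows "\<bar>\<integral>x. f x \<partial>N\<bar> \<le> (\<integral>x. g x \<partial>N)"
  by (rule order_trans[OF integral_abs_bound integral_mono]) (use assms in auto)

text \<open>
  Fubini for independent \<open>U\<close> and \<open>V\<close>: a bound on the average over \<open>V\<close> that holds for every frozen
  value of \<open>U\<close> survives averaging over \<open>U\<close>.
\<close>

lemma (in prob_space) expectation_le_by_conditioning:
  fixes g :: "'u \<Rightarrow> 'u \<Rightarrow> real" and b :: "'a \<Rightarrow> real"
  assumes indep: "indep_var A U B V"
    and g: "case_prod g \<in> borel_measurable (A \<Otimes>\<^sub>M B)"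
    and int: "integrable M (\<lambda>w. g (U w) (V w))"
    and b: "integrable M b"
    and le: "\<And>w. w \<in> space M \<Longrightarrow> (\<integral>v. g (U w) (V v) \<partial>M) \<le> b w"
  shows "(\<integral>w. g (U w) (V w) \<partial>M) \<le> (\<integral>w. b w \<partial>M)"
proof -
  have rv [measurable]: "U \<in> M \<rightarrow>\<^sub>M A" "V \<in> M \<rightarrow>\<^sub>M B"
    and eq: "distr M A U \<Otimes>\<^sub>M distr M B V = distr M (A \<Otimes>\<^sub>M B) (\<lambda>x. (U x, V x))"
    using indep unfolding indep_var_distribution_eq by auto
  note g [measurable]
  interpret U: prob_space "distr M A U" by (rule prob_space_distr) simp
  interpret V: prob_space "distr M B V" by (rule prob_space_distr) simp
  interpret P: pair_prob_space "distr M A U" "distr M B V" ..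
  have int': "integrable (distr M A U \<Otimes>\<^sub>M distr M B V) (case_prod g)"
    unfolding eq using int by (subst integrable_distr_eq) auto
  have inner: "(\<integral>v. g (U w) v \<partial>distr M B V) = (\<integral>v. g (U w) (V v) \<partial>M)" if "w \<in> space M" for w
    using measurable_space[OF rv(1) that] by (subst integral_distr) auto
  have "(\<integral>w. g (U w) (V w) \<partial>M) = (\<integral>p. case_prod g p \<partial>(distr M A U \<Otimes>\<^sub>M distr M B V))"
    unfolding eq by (subst integral_distr) auto
  also have "\<dots> = (\<integral>u. (\<integral>v. g u v \<partial>distr M B V) \<partial>distr M A U)"
    using P.integral_fst'[OF int'] by simp
  also have "\<dots> = (\<integral>w. (\<integral>v. g (U w) v \<partial>distr M B V) \<partial>M)"
    by (subst integral_distr) (auto intro!: V.borel_measurable_lebesgue_integral)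
  also have "\<dots> = (\<integral>w. (\<integral>v. g (U w) (V v) \<partial>M) \<partial>M)"
    using inner by (intro Bochner_Integration.integral_cong) auto
  also have "\<dots> \<le> (\<integral>w. b w \<partial>M)"
  proof (rule integral_mono[OF _ b le])
    have "integrable (distr M A U) (\<lambda>u. \<integral>v. g u v \<partial>distr M B V)"
      using P.integrable_fst'[OF int'] by simp
    then have "integrable M (\<lambda>w. \<integral>v. g (U w) v \<partial>distr M B V)"
      by (subst (asm) integrable_distr_eq) (auto intro!: V.borel_measurable_lebesgue_integral)
    then show "integrable M (\<lambda>w. \<integral>v. g (U w) (V v) \<partial>M)"
      using inner by (simp cong: Bochner_Integration.integrable_cong)
  qed
  finally show ?thesis .
qed

section \<open>The composite problem and its partial linearisation\<close>

text \<open>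
  \<open>S\<close> and \<open>r\<close> stand for the domain of the extended-real term and its finite values there.  On \<open>S\<close> all
  objectives are real, Lipschitz and weakly convex, so extended reals are needed only for the link
  with the envelope and with the minimisation over the whole space.
\<close>

locale composite_problem = law: prob_space \<Xi>
  for \<Xi> :: "'s measure" +
  fixes h :: "real \<Rightarrow> real" and c :: "'a::euclidean_space \<Rightarrow> 's \<Rightarrow> real"
    and S :: "'a set" and r :: "'a \<Rightarrow> real"
    and Cs Lcs :: "'s \<Rightarrow> real" and C Lc Lh L\<omega> \<kappa> :: real
  assumes S_nonempty: "S \<noteq> {}" and S_closed: "closed S" and S_convex: "convex S"
    and c_measurable [measurable]: "\<And>y. (\<lambda>s. c y s) \<in> borel_measurable \<Xi>"
    and h_c_integrable: "\<And>y. y \<in> S \<Longrightarrow> integrable \<Xi> (\<lambda>s. h (c y s))"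
    and c_differentiable: "\<And>s y. s \<in> space \<Xi> \<Longrightarrow> (\<lambda>z. c z s) differentiable (at y)"
    and r_lipschitz: "L\<omega>-lipschitz_on S r"
    and r_weakly_convex: "weakly_convex_on S \<kappa> r" and \<kappa>_nonneg: "0 \<le> \<kappa>"
    and h_convex: "convex_on UNIV h" and h_lipschitz: "Lh-lipschitz_on UNIV h"
    and gradient_lipschitz: "\<And>s. s \<in> space \<Xi> \<Longrightarrow> (Cs s)-lipschitz_on S (gradient (\<lambda>z. c z s))"
    and c_lipschitz: "\<And>s. s \<in> space \<Xi> \<Longrightarrow> (Lcs s)-lipschitz_on S (\<lambda>z. c z s)"
    and Cs_measurable [measurable]: "Cs \<in> borel_measurable \<Xi>"
    and Cs_sq_integrable: "integrable \<Xi> (\<lambda>s. (Cs s)\<^sup>2)"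
    and C_nonneg: "0 \<le> C" and Cs_second_moment: "(\<integral>s. (Cs s)\<^sup>2 \<partial>\<Xi>) \<le> C\<^sup>2"
    and Lcs_measurable [measurable]: "Lcs \<in> borel_measurable \<Xi>"
    and Lcs_sq_integrable: "integrable \<Xi> (\<lambda>s. (Lcs s)\<^sup>2)"
    and Lc_nonneg: "0 \<le> Lc" and Lcs_second_moment: "(\<integral>s. (Lcs s)\<^sup>2 \<partial>\<Xi>) \<le> Lc\<^sup>2"
begin

abbreviation "lam \<equiv> Lh * C"
abbreviation "Lf \<equiv> Lh * Lc"

lemma Lh_nonneg: "0 \<le> Lh" using h_lipschitz by (rule lipschitz_on_nonneg)
lemma L\<omega>_nonneg: "0 \<le> L\<omega>" using r_lipschitz by (rule lipschitz_on_nonneg)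
lemma Lcs_nonneg: "s \<in> space \<Xi> \<Longrightarrow> 0 \<le> Lcs s" using c_lipschitz by (rule lipschitz_on_nonneg)
lemma lam_nonneg: "0 \<le> lam" using Lh_nonneg C_nonneg by simp
lemma Lf_nonneg: "0 \<le> Lf" using Lh_nonneg Lc_nonneg by simp

lemma h_abs_diff_le: "\<bar>h a - h b\<bar> \<le> Lh * \<bar>a - b\<bar>"
  using lipschitz_onD[OF h_lipschitz, of a b] by (simp add: dist_real_def)

lemma h_measurable [measurable]: "h \<in> borel_measurable borel"
  by (intro borel_measurable_continuous_onI lipschitz_on_continuous_on[OF h_lipschitz])

text \<open>Jensen, in the form that a variance is nonnegative.\<close>

lemma first_moment_le:
  fixes f :: "'s \<Rightarrow> real"
  assumes [measurable]: "f \<in> borel_measurable \<Xi>" and "integrable \<Xi> (\<lambda>s. (f s)\<^sup>2)"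
    and "(\<integral>s. (f s)\<^sup>2 \<partial>\<Xi>) \<le> B\<^sup>2" and "0 \<le> B"
  shows "integrable \<Xi> f \<and> (\<integral>s. f s \<partial>\<Xi>) \<le> B"
proof
  show "integrable \<Xi> f" using assms(1,2) by (rule law.square_integrable_imp_integrable)
  then have "0 \<le> law.variance f" and "law.variance f = (\<integral>s. (f s)\<^sup>2 \<partial>\<Xi>) - (\<integral>s. f s \<partial>\<Xi>)\<^sup>2"
    using assms(2) by (auto intro!: law.variance_positive law.variance_eq)
  then have "(\<integral>s. f s \<partial>\<Xi>)\<^sup>2 \<le> B\<^sup>2" using assms(3) by linarith
  then show "(\<integral>s. f s \<partial>\<Xi>) \<le> B" using assms(4) by (rule power2_le_imp_le)
qed

lemma Cs_integrable: "integrable \<Xi> Cs" and Cs_mean: "(\<integral>s. Cs s \<partial>\<Xi>) \<le> C"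
  using first_moment_le[OF Cs_measurable Cs_sq_integrable Cs_second_moment C_nonneg] by auto

lemma Lcs_integrable: "integrable \<Xi> Lcs" and Lcs_mean: "(\<integral>s. Lcs s \<partial>\<Xi>) \<le> Lc"
  using first_moment_le[OF Lcs_measurable Lcs_sq_integrable Lcs_second_moment Lc_nonneg] by auto

lemma GDERIV_c:
  assumes "s \<in> space \<Xi>"
  shows "GDERIV (\<lambda>y. c y s) z :> gradient (\<lambda>y. c y s) z"
proof -
  obtain D where D: "((\<lambda>y. c y s) has_derivative D) (at z)"
    using c_differentiable[OF assms] unfolding differentiable_def by blast
  then have "linear D" by (rule has_derivative_linear)
  then have "D = (\<lambda>v. v \<bullet> adjoint D 1)" by (simp add: adjoint_works fun_eq_iff)
  then have "GDERIV (\<lambda>y. c y s) z :> adjoint D 1" using D unfolding gderiv_def by simp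
  then show ?thesis using gradient_eqI by metis
qed

lemma c_line_derivative:
  assumes "s \<in> space \<Xi>"
  shows "((\<lambda>t. c (z + t *\<^sub>R v) s) has_real_derivative gradient (\<lambda>y. c y s) (z + t *\<^sub>R v) \<bullet> v) (at t)"
proof -
  have "((\<lambda>t. c (z + t *\<^sub>R v) s) has_derivative (\<lambda>a. (a *\<^sub>R v) \<bullet> gradient (\<lambda>y. c y s) (z + t *\<^sub>R v))) (at t)"
    using GDERIV_c[OF assms, of "z + t *\<^sub>R v"] unfolding gderiv_def
    by (rule has_derivative_compose[rotated]) (auto intro!: derivative_eq_intros)
  then show ?thesis
    unfolding has_field_derivative_def
    by (rule has_derivative_eq_rhs) (simp add: fun_eq_iff inner_commute)
qed

lemma c_continuous: "s \<in> space \<Xi> \<Longrightarrow> continuous_on UNIV (\<lambda>y. c y s)"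
  using c_differentiable by (simp add: continuous_on_eq_continuous_at differentiable_imp_continuous_within)

lemma segment_in_S:
  assumes "z \<in> S" "x \<in> S" "0 \<le> t" "t \<le> 1"
  shows "z + t *\<^sub>R (x - z) \<in> S"
proof -
  have "(1 - t) *\<^sub>R z + t *\<^sub>R x \<in> S" using S_convex assms by (auto simp: convex_alt)
  then show ?thesis by (simp add: algebra_simps)
qed

lemma c_taylor:
  assumes s: "s \<in> space \<Xi>" and z: "z \<in> S" and x: "x \<in> S"
  shows "\<bar>c x s - c z s - gradient (\<lambda>y. c y s) z \<bullet> (x - z)\<bar> \<le> Cs s / 2 * (norm (x - z))\<^sup>2"
proof -
  let ?g = "gradient (\<lambda>y. c y s)"
  let ?v = "x - z"
  have side: "\<sigma> * (c x s - c z s - ?g z \<bullet> ?v) \<le> Cs s / 2 * (norm ?v)\<^sup>2" if \<sigma>: "\<bar>\<sigma>\<bar> = 1" for \<sigma> :: real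
  proof -
    let ?\<phi> = "\<lambda>t. \<sigma> * (c (z + t *\<^sub>R ?v) s - t * (?g z \<bullet> ?v)) - Cs s / 2 * t\<^sup>2 * (norm ?v)\<^sup>2"
    have "?\<phi> 1 \<le> ?\<phi> 0"
    proof (rule DERIV_nonpos_imp_nonincreasing[of 0 1 ?\<phi>])
      fix t :: real assume t: "0 \<le> t" "t \<le> 1"
      have "(?\<phi> has_real_derivative \<sigma> * (?g (z + t *\<^sub>R ?v) \<bullet> ?v - ?g z \<bullet> ?v) - Cs s * t * (norm ?v)\<^sup>2) (at t)"
        by (auto intro!: derivative_eq_intros c_line_derivative[OF s])
      moreover have "\<sigma> * (?g (z + t *\<^sub>R ?v) \<bullet> ?v - ?g z \<bullet> ?v) \<le> Cs s * t * (norm ?v)\<^sup>2"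
      proof -
        have "\<sigma> * (?g (z + t *\<^sub>R ?v) \<bullet> ?v - ?g z \<bullet> ?v) \<le> \<bar>\<sigma> * ((?g (z + t *\<^sub>R ?v) - ?g z) \<bullet> ?v)\<bar>"
          by (simp add: inner_diff_left)
        also have "\<dots> = \<bar>(?g (z + t *\<^sub>R ?v) - ?g z) \<bullet> ?v\<bar>" using \<sigma> by (simp add: abs_mult)
        also have "\<dots> \<le> norm (?g (z + t *\<^sub>R ?v) - ?g z) * norm ?v" by (rule Cauchy_Schwarz_ineq2)
        also have "\<dots> \<le> (Cs s * (t * norm ?v)) * norm ?v"
          using lipschitz_onD[OF gradient_lipschitz[OF s] segment_in_S[OF z x t] z] t
          by (intro mult_right_mono) (simp_all add: dist_norm)
        finally show ?thesis by (simp add: power2_eq_square mult_ac)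
      qed
      ultimately show "\<exists>y. (?\<phi> has_real_derivative y) (at t) \<and> y \<le> 0" by (intro exI conjI) auto
    qed simp
    then show ?thesis by (simp add: algebra_simps)
  qed
  show ?thesis using side[of 1] side[of "-1"] by (intro abs_leI) simp_all
qed

text \<open>
  If \<open>S\<close> has no interior, the gradient may be longer than the Lipschitz constant of \<open>c\<close> on \<open>S\<close>, but not
  in directions between points of \<open>S\<close>.  At \<open>z + t (y - z)\<close> the segment towards
  \<open>z + t (y - z) + t (x - y)\<close> stays in \<open>S\<close>, so the directional derivative there is bounded; then
  \<open>t\<close> tends to 0 and continuity of the gradient on \<open>S\<close> gives the bound at \<open>z\<close>.
\<close>

lemma gradient_inner_le:
  assumes s: "s \<in> space \<Xi>" and z: "z \<in> S" and x: "x \<in> S" and y: "y \<in> S"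
  shows "\<bar>gradient (\<lambda>y. c y s) z \<bullet> (x - y)\<bar> \<le> Lcs s * norm (x - y)"
proof -
  let ?g = "gradient (\<lambda>y. c y s)"
  let ?v = "x - y"
  have inner_le: "\<bar>?g (z + t *\<^sub>R (y - z)) \<bullet> ?v\<bar> \<le> Lcs s * norm ?v" if t: "0 < t" "t \<le> 1" for t
  proof -
    let ?p = "z + t *\<^sub>R (y - z)"
    have p: "?p \<in> S" using z y t by (intro segment_in_S) auto
    have q: "?p + t *\<^sub>R ?v \<in> S"
      using segment_in_S[OF z x, of t] t by (simp add: algebra_simps)
    have "((\<lambda>a. c (?p + a *\<^sub>R ?v) s) has_real_derivative ?g (?p + 0 *\<^sub>R ?v) \<bullet> ?v) (at 0)"
      by (rule c_line_derivative[OF s])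
    then have "((\<lambda>a. (c (?p + a *\<^sub>R ?v) s - c ?p s) / a) \<longlongrightarrow> ?g ?p \<bullet> ?v) (at_right 0)"
      unfolding DERIV_def by (auto intro: tendsto_within_subset)
    then have lim: "((\<lambda>a. \<bar>(c (?p + a *\<^sub>R ?v) s - c ?p s) / a\<bar>) \<longlongrightarrow> \<bar>?g ?p \<bullet> ?v\<bar>) (at_right 0)"
      by (rule tendsto_rabs)
    have "\<forall>\<^sub>F a in at_right 0. \<bar>(c (?p + a *\<^sub>R ?v) s - c ?p s) / a\<bar> \<le> Lcs s * norm ?v"
      unfolding eventually_at_right_field
    proof (intro exI[of _ t] conjI allI impI)
      fix a :: real assume a: "0 < a" "a < t"
      have "?p + (a / t) *\<^sub>R ((?p + t *\<^sub>R ?v) - ?p) \<in> S"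
        using a t by (intro segment_in_S[OF p q]) auto
      then have "?p + a *\<^sub>R ?v \<in> S" using t by simp
      from lipschitz_onD[OF c_lipschitz[OF s] this p]
      have "\<bar>c (?p + a *\<^sub>R ?v) s - c ?p s\<bar> \<le> Lcs s * (a * norm ?v)"
        using a by (simp add: dist_real_def dist_norm)
      then show "\<bar>(c (?p + a *\<^sub>R ?v) s - c ?p s) / a\<bar> \<le> Lcs s * norm ?v"
        using a by (simp add: field_simps)
    qed (use t in auto)
    with lim show ?thesis by (intro tendsto_upperbound) auto
  qed
  have "((\<lambda>t. ?g (z + t *\<^sub>R (y - z))) \<longlongrightarrow> ?g z) (at_right 0)"
  proof (rule Lim_transform_eventually)
    have "continuous_on {0..1} (\<lambda>t. ?g (z + t *\<^sub>R (y - z)))"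
      by (intro continuous_on_compose2[OF lipschitz_on_continuous_on[OF gradient_lipschitz[OF s]]] continuous_intros)
        (auto intro: segment_in_S[OF z y])
    then have "((\<lambda>t. ?g (z + t *\<^sub>R (y - z))) \<longlongrightarrow> ?g (z + 0 *\<^sub>R (y - z))) (at 0 within {0..1})"
      unfolding continuous_on_def by (elim ballE[of _ _ 0]) auto
    then show "((\<lambda>t. ?g (z + t *\<^sub>R (y - z))) \<longlongrightarrow> ?g z) (at_right 0)"
      by (simp add: at_within_Icc_at_right)
  qed simp
  then have "((\<lambda>t. \<bar>?g (z + t *\<^sub>R (y - z)) \<bullet> ?v\<bar>) \<longlongrightarrow> \<bar>?g z \<bullet> ?v\<bar>) (at_right 0)"
    by (intro tendsto_intros)
  moreover have "\<forall>\<^sub>F t in at_right 0. \<bar>?g (z + t *\<^sub>R (y - z)) \<bullet> ?v\<bar> \<le> Lcs s * norm ?v"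
    unfolding eventually_at_right_field using inner_le by (intro exI[of _ 1]) auto
  ultimately show ?thesis by (intro tendsto_upperbound) auto
qed

text \<open>Averaging the Taylor bounds at the intermediate point towards both end points.\<close>

lemma c_segment:
  assumes s: "s \<in> space \<Xi>" and x: "x \<in> S" and y: "y \<in> S" and t: "0 \<le> t" "t \<le> 1"
  shows "\<bar>c ((1 - t) *\<^sub>R x + t *\<^sub>R y) s - ((1 - t) * c x s + t * c y s)\<bar>
    \<le> Cs s / 2 * (t * (1 - t)) * (norm (x - y))\<^sup>2"
proof -
  let ?u = "(1 - t) *\<^sub>R x + t *\<^sub>R y"
  let ?g = "gradient (\<lambda>y. c y s) ?u"
  have u: "?u \<in> S" using S_convex x y t by (auto simp: convex_alt)
  define a where "a = c x s - c ?u s - ?g \<bullet> (x - ?u)"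
  define b where "b = c y s - c ?u s - ?g \<bullet> (y - ?u)"
  have xu: "x - ?u = t *\<^sub>R (x - y)" and yu: "y - ?u = - ((1 - t) *\<^sub>R (x - y))"
    by (simp_all add: algebra_simps)
  have a: "\<bar>a\<bar> \<le> Cs s / 2 * (t\<^sup>2 * (norm (x - y))\<^sup>2)"
    using c_taylor[OF s u x] unfolding a_def by (simp add: xu power_mult_distrib)
  have b: "\<bar>b\<bar> \<le> Cs s / 2 * ((1 - t)\<^sup>2 * (norm (x - y))\<^sup>2)"
    using c_taylor[OF s u y] unfolding b_def by (simp add: yu power_mult_distrib)
  have "(1 - t) * (?g \<bullet> (x - ?u)) + t * (?g \<bullet> (y - ?u)) = 0" by (simp add: xu yu)
  then have "c ?u s - ((1 - t) * c x s + t * c y s) = - ((1 - t) * a + t * b)"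
    unfolding a_def b_def right_diff_distrib by algebra
  then have "\<bar>c ?u s - ((1 - t) * c x s + t * c y s)\<bar> \<le> (1 - t) * \<bar>a\<bar> + t * \<bar>b\<bar>"
    using t abs_triangle_ineq[of "(1 - t) * a" "t * b"] by (simp add: abs_mult)
  also have "\<dots> \<le> (1 - t) * (Cs s / 2 * (t\<^sup>2 * (norm (x - y))\<^sup>2)) + t * (Cs s / 2 * ((1 - t)\<^sup>2 * (norm (x - y))\<^sup>2))"
    using a b t by (intro add_mono mult_left_mono) auto
  also have "\<dots> = Cs s / 2 * (t * (1 - t)) * (norm (x - y))\<^sup>2"
    by (simp add: field_simps power2_eq_square)
  finally show ?thesis .
qed

lemma h_c_weakly_convex:
  assumes s: "s \<in> space \<Xi>"
  shows "weakly_convex_on S (Lh * Cs s) (\<lambda>y. h (c y s))"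
  unfolding weakly_convex_on_def
proof (intro ballI allI impI)
  fix x y t assume x: "x \<in> S" and y: "y \<in> S" and t: "0 \<le> t" "t \<le> (1::real)"
  let ?u = "(1 - t) *\<^sub>R x + t *\<^sub>R y"
  let ?a = "(1 - t) * c x s + t * c y s"
  have "h (c ?u s) \<le> h ?a + Lh * \<bar>c ?u s - ?a\<bar>" using h_abs_diff_le[of "c ?u s" ?a] by linarith
  also have "h ?a \<le> (1 - t) * h (c x s) + t * h (c y s)"
    using convex_onD[OF h_convex, of t "c x s" "c y s"] t by simp
  also have "Lh * \<bar>c ?u s - ?a\<bar> \<le> Lh * (Cs s / 2 * (t * (1 - t)) * (norm (x - y))\<^sup>2)"
    by (rule mult_left_mono[OF c_segment[OF s x y t] Lh_nonneg])
  finally show "h (c ?u s) \<le> (1 - t) * h (c x s) + t * h (c y s) + Lh * Cs s / 2 * (t * (1 - t)) * (norm (x - y))\<^sup>2"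
    by simp
qed

lemma partial_lin_convex: "weakly_convex_on S 0 (\<lambda>y. partial_lin h c z y s)"
  unfolding weakly_convex_on_def
proof (intro ballI allI impI)
  fix x y t assume t: "0 \<le> t" "t \<le> (1::real)"
  let ?l = "\<lambda>x. c z s + gradient (\<lambda>y. c y s) z \<bullet> (x - z)"
  have "?l ((1 - t) *\<^sub>R x + t *\<^sub>R y) = (1 - t) * ?l x + t * ?l y"
    by (simp add: inner_diff_right inner_add_right algebra_simps)
  then show "partial_lin h c z ((1 - t) *\<^sub>R x + t *\<^sub>R y) s
      \<le> (1 - t) * partial_lin h c z x s + t * partial_lin h c z y s + 0 / 2 * (t * (1 - t)) * (norm (x - y))\<^sup>2"
    using convex_onD[OF h_convex, of t "?l x" "?l y"] t by (simp add: partial_lin_def)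
qed

text \<open>
  Taylor's bound for \<open>c\<close> and the Lipschitz bound on directional derivatives pass through \<open>h\<close>: the
  model is as Lipschitz as the sampled loss, and off by a quadratic term only.
\<close>

lemma partial_lin_diff_le:
  assumes s: "s \<in> space \<Xi>" and z: "z \<in> S" and x: "x \<in> S" and y: "y \<in> S"
  shows "\<bar>partial_lin h c z x s - partial_lin h c z y s\<bar> \<le> Lh * Lcs s * norm (x - y)"
proof -
  let ?g = "gradient (\<lambda>y. c y s) z"
  have "\<bar>partial_lin h c z x s - partial_lin h c z y s\<bar> \<le> Lh * \<bar>?g \<bullet> (x - y)\<bar>"
    unfolding partial_lin_def using h_abs_diff_le[of "c z s + ?g \<bullet> (x - z)" "c z s + ?g \<bullet> (y - z)"]
    by (simp add: inner_diff_right)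
  also have "\<dots> \<le> Lh * (Lcs s * norm (x - y))"
    by (rule mult_left_mono[OF gradient_inner_le[OF s z x y] Lh_nonneg])
  finally show ?thesis by simp
qed

lemma partial_lin_error:
  assumes s: "s \<in> space \<Xi>" and z: "z \<in> S" and x: "x \<in> S"
  shows "\<bar>partial_lin h c z x s - h (c x s)\<bar> \<le> Lh * Cs s / 2 * (norm (x - z))\<^sup>2"
proof -
  let ?g = "gradient (\<lambda>y. c y s) z"
  have "\<bar>partial_lin h c z x s - h (c x s)\<bar> \<le> Lh * \<bar>(c z s + ?g \<bullet> (x - z)) - c x s\<bar>"
    unfolding partial_lin_def by (rule h_abs_diff_le)
  also have "\<bar>(c z s + ?g \<bullet> (x - z)) - c x s\<bar> \<le> Cs s / 2 * (norm (x - z))\<^sup>2"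
    using c_taylor[OF s z x] by (simp add: abs_minus_commute algebra_simps)
  then have "Lh * \<bar>(c z s + ?g \<bullet> (x - z)) - c x s\<bar> \<le> Lh * (Cs s / 2 * (norm (x - z))\<^sup>2)"
    using Lh_nonneg by (rule mult_left_mono)
  finally show ?thesis by simp
qed

text \<open>
  The gradient is a pointwise limit of difference quotients, so no selection of gradients has to be
  measured directly.
\<close>

lemma partial_lin_measurable:
  assumes [measurable]: "Z \<in> borel_measurable N" "V \<in> borel_measurable N" "\<zeta> \<in> N \<rightarrow>\<^sub>M \<Xi>"
  shows "(\<lambda>w. partial_lin h c (Z w) (V w) (\<zeta> w)) \<in> borel_measurable N"
proof -
  have c_comp: "(\<lambda>w. c (Y w) (\<zeta> w)) \<in> borel_measurable N" if "Y \<in> borel_measurable N" for Y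
    by (rule measurable_caratheodory[OF c_measurable c_continuous that assms(3)])
  have [measurable]: "(\<lambda>w. gradient (\<lambda>y. c y (\<zeta> w)) (Z w) \<bullet> (V w - Z w)) \<in> borel_measurable N"
  proof (rule borel_measurable_LIMSEQ_metric)
    show "(\<lambda>w. (c (Z w + inverse (real (Suc n)) *\<^sub>R (V w - Z w)) (\<zeta> w) - c (Z w) (\<zeta> w)) / inverse (real (Suc n)))
        \<in> borel_measurable N" for n
      by (intro borel_measurable_divide borel_measurable_diff c_comp) measurable
    fix w assume "w \<in> space N"
    then have "\<zeta> w \<in> space \<Xi>" by (rule measurable_space[OF assms(3)])
    from c_line_derivative[OF this, of "Z w" "V w - Z w" 0]
    have "((\<lambda>a. (c (Z w + a *\<^sub>R (V w - Z w)) (\<zeta> w) - c (Z w) (\<zeta> w)) / a) \<longlongrightarrow>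
        gradient (\<lambda>y. c y (\<zeta> w)) (Z w) \<bullet> (V w - Z w)) (at 0)"
      by (simp add: DERIV_def)
    moreover have "filterlim (\<lambda>n. inverse (real (Suc n))) (at 0) sequentially"
      using LIMSEQ_inverse_real_of_nat by (simp add: filterlim_at del: of_nat_Suc)
    ultimately show "(\<lambda>n. (c (Z w + inverse (real (Suc n)) *\<^sub>R (V w - Z w)) (\<zeta> w) - c (Z w) (\<zeta> w)) / inverse (real (Suc n)))
        \<longlonglongrightarrow> gradient (\<lambda>y. c y (\<zeta> w)) (Z w) \<bullet> (V w - Z w)"
      by (rule filterlim_compose)
  qed
  note [measurable] = c_comp[of Z]
  show ?thesis unfolding partial_lin_def by measurable
qed

lemma partial_lin_integrable:
  assumes z: "z \<in> S" and x: "x \<in> S"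
  shows "integrable \<Xi> (\<lambda>s. partial_lin h c z x s)"
proof -
  have [measurable]: "(\<lambda>s. partial_lin h c z x s) \<in> borel_measurable \<Xi>"
    using partial_lin_measurable[of "\<lambda>_. z" \<Xi> "\<lambda>_. x" "\<lambda>s. s"] by simp
  have "integrable \<Xi> (\<lambda>s. partial_lin h c z x s - h (c x s))"
  proof (rule Bochner_Integration.integrable_bound)
    show "integrable \<Xi> (\<lambda>s. Lh * Cs s / 2 * (norm (x - z))\<^sup>2)" using Cs_integrable by simp
    show "AE s in \<Xi>. norm (partial_lin h c z x s - h (c x s)) \<le> norm (Lh * Cs s / 2 * (norm (x - z))\<^sup>2)"
      using partial_lin_error[OF _ z x] by (intro AE_I2) (force intro: order_trans[OF _ abs_ge_self])
  qed measurable
  from Bochner_Integration.integrable_add[OF this h_c_integrable[OF x]] show ?thesis by simp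
qed

definition f :: "'a \<Rightarrow> real" where
  "f y = (\<integral>s. h (c y s) \<partial>\<Xi>)"

lemma f_lipschitz: "Lf-lipschitz_on S f"
proof (rule lipschitz_onI[OF _ Lf_nonneg])
  fix x y assume x: "x \<in> S" and y: "y \<in> S"
  have "\<bar>f x - f y\<bar> = \<bar>\<integral>s. h (c x s) - h (c y s) \<partial>\<Xi>\<bar>"
    unfolding f_def using x y by (simp add: h_c_integrable)
  also have "\<dots> \<le> (\<integral>s. Lh * norm (x - y) * Lcs s \<partial>\<Xi>)"
  proof (rule abs_integral_le)
    show "integrable \<Xi> (\<lambda>s. h (c x s) - h (c y s))" using x y by (simp add: h_c_integrable)
    show "integrable \<Xi> (\<lambda>s. Lh * norm (x - y) * Lcs s)" using Lcs_integrable by simp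
    fix s assume s: "s \<in> space \<Xi>"
    have "\<bar>h (c x s) - h (c y s)\<bar> \<le> Lh * \<bar>c x s - c y s\<bar>" by (rule h_abs_diff_le)
    also have "\<dots> \<le> Lh * (Lcs s * norm (x - y))"
      using lipschitz_onD[OF c_lipschitz[OF s] x y] Lh_nonneg
      by (intro mult_left_mono) (simp_all add: dist_real_def dist_norm)
    finally show "\<bar>h (c x s) - h (c y s)\<bar> \<le> Lh * norm (x - y) * Lcs s" by (simp add: mult_ac)
  qed
  also have "\<dots> \<le> Lh * norm (x - y) * Lc"
    using Lcs_mean Lh_nonneg by (simp add: mult_left_mono)
  finally show "dist (f x) (f y) \<le> Lf * dist x y" by (simp add: dist_real_def dist_norm mult_ac)
qed

lemma f_weakly_convex: "weakly_convex_on S lam f"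
  unfolding weakly_convex_on_def
proof (intro ballI allI impI)
  fix x y t assume x: "x \<in> S" and y: "y \<in> S" and t: "0 \<le> t" "t \<le> (1::real)"
  let ?u = "(1 - t) *\<^sub>R x + t *\<^sub>R y"
  let ?q = "t * (1 - t) * (norm (x - y))\<^sup>2 / 2"
  have u: "?u \<in> S" using S_convex x y t by (auto simp: convex_alt)
  note [simp] = h_c_integrable[OF x] h_c_integrable[OF y] Cs_integrable
  have "f ?u \<le> (\<integral>s. (1 - t) * h (c x s) + t * h (c y s) + Lh * ?q * Cs s \<partial>\<Xi>)"
    unfolding f_def
  proof (rule integral_mono[OF h_c_integrable[OF u]])
    fix s assume "s \<in> space \<Xi>"
    from weakly_convex_onD[OF h_c_weakly_convex[OF this] x y t]
    show "h (c ?u s) \<le> (1 - t) * h (c x s) + t * h (c y s) + Lh * ?q * Cs s" by (simp add: mult_ac)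
  qed simp
  also have "\<dots> = (1 - t) * f x + t * f y + Lh * ?q * (\<integral>s. Cs s \<partial>\<Xi>)"
    unfolding f_def by simp
  also have "\<dots> \<le> (1 - t) * f x + t * f y + Lh * ?q * C"
    using Cs_mean Lh_nonneg t by (intro add_left_mono mult_left_mono) auto
  finally show "f ?u \<le> (1 - t) * f x + t * f y + lam / 2 * (t * (1 - t)) * (norm (x - y))\<^sup>2"
    by (simp add: mult_ac)
qed

lemma f_measurable_comp:
  assumes "V \<in> borel_measurable N" and "\<And>w. w \<in> space N \<Longrightarrow> V w \<in> S"
  shows "(\<lambda>w. f (V w)) \<in> borel_measurable N"
proof (rule measurable_compose[where N = "restrict_space borel S"])
  show "V \<in> N \<rightarrow>\<^sub>M restrict_space borel S" using assms by (intro measurable_restrict_space2) auto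
  show "f \<in> borel_measurable (restrict_space borel S)"
    by (intro borel_measurable_continuous_on_restrict lipschitz_on_continuous_on[OF f_lipschitz])
qed

lemma mean_partial_lin_error:
  assumes z: "z \<in> S" and x: "x \<in> S"
  shows "\<bar>(\<integral>s. partial_lin h c z x s \<partial>\<Xi>) - f x\<bar> \<le> lam / 2 * (norm (x - z))\<^sup>2"
proof -
  let ?q = "(norm (x - z))\<^sup>2 / 2"
  have "\<bar>(\<integral>s. partial_lin h c z x s \<partial>\<Xi>) - f x\<bar> = \<bar>\<integral>s. partial_lin h c z x s - h (c x s) \<partial>\<Xi>\<bar>"
    unfolding f_def by (simp add: partial_lin_integrable[OF z x] h_c_integrable[OF x])
  also have "\<dots> \<le> (\<integral>s. Lh * ?q * Cs s \<partial>\<Xi>)"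
    using partial_lin_error[OF _ z x]
    by (intro abs_integral_le)
      (simp_all add: partial_lin_integrable[OF z x] h_c_integrable[OF x] Cs_integrable mult_ac)
  also have "\<dots> \<le> Lh * ?q * C"
    using Cs_mean Lh_nonneg by (simp add: mult_left_mono)
  finally show ?thesis by (simp add: mult_ac)
qed

lemma prox_function_objective:
  assumes "lam + \<kappa> < \<rho>"
  shows "prox_function S (\<lambda>y. f y + r y) (Lf + L\<omega>) (lam + \<kappa>) \<rho>"
  using assms S_nonempty S_closed S_convex lam_nonneg \<kappa>_nonneg
  by unfold_locales
    (auto intro!: lipschitz_on_add f_lipschitz r_lipschitz weakly_convex_on_add f_weakly_convex r_weakly_convex)

lemma prox_function_model:
  assumes s: "s \<in> space \<Xi>" and z: "z \<in> S" and \<gamma>: "\<kappa> < \<gamma>"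
  shows "prox_function S (\<lambda>y. partial_lin h c z y s + r y) (Lh * Lcs s + L\<omega>) \<kappa> \<gamma>"
proof unfold_locales
  have "(Lh * Lcs s)-lipschitz_on S (\<lambda>y. partial_lin h c z y s)"
    using partial_lin_diff_le[OF s z] Lh_nonneg Lcs_nonneg[OF s]
    by (intro lipschitz_onI) (simp_all add: dist_real_def dist_norm)
  then show "(Lh * Lcs s + L\<omega>)-lipschitz_on S (\<lambda>y. partial_lin h c z y s + r y)"
    using r_lipschitz by (rule lipschitz_on_add)
  show "weakly_convex_on S \<kappa> (\<lambda>y. partial_lin h c z y s + r y)"
    using weakly_convex_on_add[OF partial_lin_convex r_weakly_convex] by simp
qed (use \<gamma> S_nonempty S_closed S_convex \<kappa>_nonneg in auto)

end

context composite_problem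
begin

text \<open>One update keeps measurability, because it is a minimiser with quadratic growth.\<close>

lemma prox_model_measurable:
  assumes Z [measurable]: "Z \<in> borel_measurable N" and ZS: "\<And>w. w \<in> space N \<Longrightarrow> Z w \<in> S"
    and x [measurable]: "x \<in> borel_measurable N" and \<zeta> [measurable]: "\<zeta> \<in> N \<rightarrow>\<^sub>M \<Xi>" and \<gamma>: "\<kappa> < \<gamma>"
  shows "(\<lambda>w. prox S (\<lambda>y. partial_lin h c (Z w) y (\<zeta> w) + r y) \<gamma> (x w)) \<in> borel_measurable N"
proof (rule measurable_minimiser[where S = S and \<mu> = "(\<gamma> - \<kappa>) / 2"
    and \<Phi> = "\<lambda>y w. partial_lin h c (Z w) y (\<zeta> w) + r y + \<gamma> / 2 * (norm (y - x w))\<^sup>2"])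
  have model: "prox_function S (\<lambda>y. partial_lin h c (Z w) y (\<zeta> w) + r y) (Lh * Lcs (\<zeta> w) + L\<omega>) \<kappa> \<gamma>"
    if "w \<in> space N" for w
    by (intro prox_function_model measurable_space[OF \<zeta>] ZS that \<gamma>)
  show "(\<lambda>w. partial_lin h c (Z w) y (\<zeta> w) + r y + \<gamma> / 2 * (norm (y - x w))\<^sup>2) \<in> borel_measurable N" for y
  proof -
    have [measurable]: "(\<lambda>w. partial_lin h c (Z w) y (\<zeta> w)) \<in> borel_measurable N"
      by (rule partial_lin_measurable) auto
    show ?thesis by measurable
  qed
  fix w assume w: "w \<in> space N"
  interpret m: prox_function S "\<lambda>y. partial_lin h c (Z w) y (\<zeta> w) + r y" "Lh * Lcs (\<zeta> w) + L\<omega>" \<kappa> \<gamma>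
    by (rule model[OF w])
  show "continuous_on S (\<lambda>y. partial_lin h c (Z w) y (\<zeta> w) + r y + \<gamma> / 2 * (norm (y - x w))\<^sup>2)"
    by (intro continuous_intros lipschitz_on_continuous_on[OF m.lipschitz])
  show "prox S (\<lambda>y. partial_lin h c (Z w) y (\<zeta> w) + r y) \<gamma> (x w) \<in> S"
    by (rule m.prox_in)
  fix y assume "y \<in> S"
  from m.prox_quadratic_growth[OF this, of "x w"]
  show "partial_lin h c (Z w) (prox S (\<lambda>y. partial_lin h c (Z w) y (\<zeta> w) + r y) \<gamma> (x w)) (\<zeta> w)
      + r (prox S (\<lambda>y. partial_lin h c (Z w) y (\<zeta> w) + r y) \<gamma> (x w))
      + \<gamma> / 2 * (norm (prox S (\<lambda>y. partial_lin h c (Z w) y (\<zeta> w) + r y) \<gamma> (x w) - x w))\<^sup>2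
      + (\<gamma> - \<kappa>) / 2 * (norm (y - prox S (\<lambda>y. partial_lin h c (Z w) y (\<zeta> w) + r y) \<gamma> (x w)))\<^sup>2
      \<le> partial_lin h c (Z w) y (\<zeta> w) + r y + \<gamma> / 2 * (norm (y - x w))\<^sup>2"
    by simp
qed (use \<gamma> S_nonempty in auto)

end

section \<open>One update\<close>

locale delayed_run = composite_problem +
  fixes \<gamma> \<rho> :: real and x1 :: 'b and d :: "nat \<Rightarrow> nat"
  assumes x1_in: "x1 \<in> S" and \<rho>_gt: "lam + \<kappa> < \<rho>" and \<gamma>_gt: "\<rho> < \<gamma>"
begin

abbreviation "p \<equiv> prox S (\<lambda>y. f y + r y) \<rho>"

sublocale obj: prox_function S "\<lambda>y. f y + r y" "Lf + L\<omega>" "lam + \<kappa>" \<rho>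
  by (rule prox_function_objective[OF \<rho>_gt])

lemma \<rho>_pos: "0 < \<rho>" using \<rho>_gt lam_nonneg \<kappa>_nonneg by linarith
lemma \<kappa>_less_\<gamma>: "\<kappa> < \<gamma>" using \<rho>_gt \<gamma>_gt lam_nonneg by linarith

text \<open>
  The sum of the two growth moduli \<open>\<gamma> - \<kappa>\<close> of the update and \<open>\<rho> - lam - \<kappa>\<close> of the proximal map.
\<close>

abbreviation "G \<equiv> \<gamma> + \<rho> - lam - 2 * \<kappa>"

lemma G_pos: "0 < G" using \<rho>_gt \<gamma>_gt lam_nonneg by linarith

text \<open>
  How much the sampled, stale model misjudges the change of \<open>f\<close> between \<open>x\<close> and its proximal point
  \<open>p x\<close>.  Neither point depends on the fresh sample, so this is the quantity whose mean can be computed.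
\<close>

definition noise :: "'b \<Rightarrow> 'b \<Rightarrow> 'a \<Rightarrow> real" where
  "noise z x s = partial_lin h c z (p x) s - partial_lin h c z x s - (f (p x) - f x)"

text \<open>
  Minimality of the new iterate, tested at \<open>p x\<close>, and minimality of \<open>p x\<close>, tested at the new
  iterate, are added.  The model at \<open>x\<^sup>+\<close> is compared with the model at \<open>x\<close>, and the objective at
  \<open>x\<close> with the objective at \<open>x\<^sup>+\<close>; both changes are linear in \<open>|x\<^sup>+ - x|\<close> and are absorbed by the
  surplus \<open>(\<gamma> - \<rho>)/2 |x\<^sup>+ - x|\<^sup>2\<close>.  Apart from the slope of the model, the noise is all that remains
  of the sample.
\<close>

lemma one_step:
  assumes s: "s \<in> space \<Xi>" and z: "z \<in> S" and x: "x \<in> S"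
  defines "x' \<equiv> prox S (\<lambda>y. partial_lin h c z y s + r y) \<gamma> x"
  shows "G * (norm (x' - p x))\<^sup>2
    \<le> (\<gamma> - \<rho>) * (norm (p x - x))\<^sup>2 + (Lh * Lcs s + Lf)\<^sup>2 / (\<gamma> - \<rho>) + 2 * noise z x s"
proof -
  interpret m: prox_function S "\<lambda>y. partial_lin h c z y s + r y" "Lh * Lcs s + L\<omega>" \<kappa> \<gamma>
    by (rule prox_function_model[OF s z \<kappa>_less_\<gamma>])
  have x'S: "x' \<in> S" unfolding x'_def by (rule m.prox_in)
  let ?n = "norm (x' - x)"
  let ?l = "Lh * Lcs s + Lf"
  have 1: "partial_lin h c z x' s + r x' + \<gamma> / 2 * ?n\<^sup>2 + (\<gamma> - \<kappa>) / 2 * (norm (x' - p x))\<^sup>2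
      \<le> partial_lin h c z (p x) s + r (p x) + \<gamma> / 2 * (norm (p x - x))\<^sup>2"
    using m.prox_quadratic_growth[OF obj.prox_in, of x x] unfolding x'_def by (simp add: norm_minus_commute)
  have 2: "f (p x) + r (p x) + \<rho> / 2 * (norm (p x - x))\<^sup>2 + (\<rho> - (lam + \<kappa>)) / 2 * (norm (x' - p x))\<^sup>2
      \<le> f x' + r x' + \<rho> / 2 * ?n\<^sup>2"
    using obj.prox_quadratic_growth[OF x'S, of x] by simp
  have 3: "partial_lin h c z x s \<le> partial_lin h c z x' s + Lh * Lcs s * ?n"
    using partial_lin_diff_le[OF s z x x'S] by (simp add: norm_minus_commute)
  have 4: "f x' \<le> f x + Lf * ?n"
    using lipschitz_onD[OF f_lipschitz x'S x] by (simp add: dist_real_def dist_norm)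
  have \<beta>: "0 < \<gamma> - \<rho>" using \<gamma>_gt by simp
  have sq: "(a - b * n)\<^sup>2 / b = a\<^sup>2 / b - 2 * (a * n) + b * n\<^sup>2" if "0 < b" for a b n :: real
    using that by (simp add: field_simps power2_eq_square)
  have "0 \<le> (?l - (\<gamma> - \<rho>) * ?n)\<^sup>2 / (\<gamma> - \<rho>)" using \<beta> by simp
  also have "(?l - (\<gamma> - \<rho>) * ?n)\<^sup>2 / (\<gamma> - \<rho>) = ?l\<^sup>2 / (\<gamma> - \<rho>) - 2 * (?l * ?n) + (\<gamma> - \<rho>) * ?n\<^sup>2"
    by (rule sq[OF \<beta>])
  finally have 5: "2 * (Lh * Lcs s * ?n) + 2 * (Lf * ?n) \<le> ?l\<^sup>2 / (\<gamma> - \<rho>) + (\<gamma> - \<rho>) * ?n\<^sup>2"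
    by (simp add: distrib_right)
  define Q where "Q = (norm (x' - p x))\<^sup>2"
  define P where "P = (norm (p x - x))\<^sup>2"
  define N where "N = ?n\<^sup>2"
  have "(\<gamma> - \<kappa>) * Q + (\<rho> - (lam + \<kappa>)) * Q \<le> (\<gamma> - \<rho>) * P - (\<gamma> - \<rho>) * N
      + 2 * noise z x s + 2 * (Lh * Lcs s * ?n) + 2 * (Lf * ?n)"
    using 1 2 3 4 unfolding noise_def Q_def[symmetric] P_def[symmetric] N_def[symmetric]
    by (simp add: field_simps)
  with 5 show ?thesis
    unfolding Q_def[symmetric] P_def[symmetric] N_def[symmetric] by (simp add: algebra_simps)
qed

text \<open>
  The old proximal point is a competitor in the definition of the envelope at the new iterate, so
  moving closer to it lowers the envelope.
\<close>

lemma env_descent: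
  assumes s: "s \<in> space \<Xi>" and z: "z \<in> S" and x: "x \<in> S"
  defines "x' \<equiv> prox S (\<lambda>y. partial_lin h c z y s + r y) \<gamma> x"
  shows "(2 * \<rho> - lam - 2 * \<kappa>) * (norm (p x - x))\<^sup>2
    \<le> 2 * G / \<rho> * (obj.env x - obj.env x') + (Lh * Lcs s + Lf)\<^sup>2 / (\<gamma> - \<rho>) + 2 * noise z x s"
proof -
  have "obj.env x' \<le> obj.env x + \<rho> / 2 * ((norm (x' - p x))\<^sup>2 - (norm (p x - x))\<^sup>2)"
    using obj.env_le[OF obj.prox_in, of x' x] unfolding obj.env_def[of x]
    by (simp add: norm_minus_commute algebra_simps)
  then have "(norm (p x - x))\<^sup>2 - (norm (x' - p x))\<^sup>2 \<le> 2 / \<rho> * (obj.env x - obj.env x')"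
    using \<rho>_pos by (simp add: field_simps)
  then have "G * ((norm (p x - x))\<^sup>2 - (norm (x' - p x))\<^sup>2) \<le> G * (2 / \<rho> * (obj.env x - obj.env x'))"
    using G_pos by (intro mult_left_mono) auto
  moreover have "G * (2 / \<rho> * (obj.env x - obj.env x')) = 2 * G / \<rho> * (obj.env x - obj.env x')"
    by (simp add: field_simps)
  ultimately show ?thesis
    using one_step[OF s z x] unfolding x'_def[symmetric] by (simp add: algebra_simps)
qed

text \<open>The residual along a run is bounded uniformly, which settles all questions of integrability for it and
  reduces those for the noise to the slope \<open>Lcs\<close>.\<close>

lemma p_dist_le: "x \<in> S \<Longrightarrow> norm (p x - x) \<le> (Lf + L\<omega>) / (\<rho> - (lam + \<kappa>) / 2)"
  using lipschitz_onD[OF obj.lipschitz _ obj.prox_in, of x x] obj.lipschitz[THEN lipschitz_on_nonneg]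
  by (intro obj.prox_step_le) (auto simp: dist_real_def dist_norm)

lemma p_measurable [measurable]: "p \<in> borel_measurable borel"
  by (intro borel_measurable_continuous_onI lipschitz_on_continuous_on[OF obj.prox_lipschitz])

lemma model_step_le:
  assumes s: "s \<in> space \<Xi>" and z: "z \<in> S" and x: "x \<in> S"
  shows "norm (prox S (\<lambda>y. partial_lin h c z y s + r y) \<gamma> x - x) \<le> (Lh * Lcs s + L\<omega>) / (\<gamma> - \<kappa> / 2)"
proof -
  interpret m: prox_function S "\<lambda>y. partial_lin h c z y s + r y" "Lh * Lcs s + L\<omega>" \<kappa> \<gamma>
    by (rule prox_function_model[OF s z \<kappa>_less_\<gamma>])
  show ?thesis
    using lipschitz_onD[OF m.lipschitz x m.prox_in, of x] m.lipschitz[THEN lipschitz_on_nonneg]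
    by (intro m.prox_step_le[OF x]) (auto simp: dist_real_def dist_norm)
qed

lemma noise_abs_le:
  assumes s: "s \<in> space \<Xi>" and z: "z \<in> S" and x: "x \<in> S"
  shows "\<bar>noise z x s\<bar> \<le> (Lh * Lcs s + Lf) * ((Lf + L\<omega>) / (\<rho> - (lam + \<kappa>) / 2))"
proof -
  have "\<bar>noise z x s\<bar> \<le> \<bar>partial_lin h c z (p x) s - partial_lin h c z x s\<bar> + \<bar>f (p x) - f x\<bar>"
    unfolding noise_def by (rule abs_triangle_ineq4)
  also have "\<dots> \<le> Lh * Lcs s * norm (p x - x) + Lf * norm (p x - x)"
    using partial_lin_diff_le[OF s z obj.prox_in x, of x] lipschitz_onD[OF f_lipschitz obj.prox_in x, of x]
    by (simp add: dist_real_def dist_norm)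
  also have "\<dots> = (Lh * Lcs s + Lf) * norm (p x - x)" by (simp add: distrib_right)
  also have "\<dots> \<le> (Lh * Lcs s + Lf) * ((Lf + L\<omega>) / (\<rho> - (lam + \<kappa>) / 2))"
    using p_dist_le[OF x] Lh_nonneg Lcs_nonneg[OF s] Lf_nonneg by (intro mult_left_mono) auto
  finally show ?thesis .
qed

text \<open>
  In the mean the linearisation at \<open>z\<close> is exact up to \<open>lam/2\<close> times the squared distance to \<open>z\<close>, at \<open>p x\<close>
  as well as at \<open>x\<close>; the distance from \<open>z\<close> to \<open>p x\<close> is split at \<open>x\<close>.
\<close>

lemma noise_mean_le:
  assumes z: "z \<in> S" and x: "x \<in> S"
  shows "(\<integral>s. noise z x s \<partial>\<Xi>) \<le> lam * (norm (p x - x))\<^sup>2 + 3 / 2 * lam * (norm (x - z))\<^sup>2"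
proof -
  note int = partial_lin_integrable[OF z]
  have "(\<integral>s. noise z x s \<partial>\<Xi>) = (\<integral>s. partial_lin h c z (p x) s \<partial>\<Xi>) - (\<integral>s. partial_lin h c z x s \<partial>\<Xi>) - (f (p x) - f x)"
    unfolding noise_def using int[OF obj.prox_in] int[OF x] by (simp add: law.prob_space)
  also have "\<dots> \<le> lam / 2 * (norm (p x - z))\<^sup>2 + lam / 2 * (norm (x - z))\<^sup>2"
    using mean_partial_lin_error[OF z obj.prox_in, of x] mean_partial_lin_error[OF z x]
    unfolding abs_le_iff by linarith
  also have "\<dots> \<le> lam / 2 * (2 * (norm (p x - x))\<^sup>2 + 2 * (norm (x - z))\<^sup>2) + lam / 2 * (norm (x - z))\<^sup>2"
  proof (intro add_right_mono mult_left_mono)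
    have "norm (p x - z) \<le> norm (p x - x) + norm (x - z)"
      using norm_triangle_ineq[of "p x - x" "x - z"] by simp
    then have "(norm (p x - z))\<^sup>2 \<le> (norm (p x - x) + norm (x - z))\<^sup>2" by (rule power_mono) simp
    also have "\<dots> \<le> 2 * (norm (p x - x))\<^sup>2 + 2 * (norm (x - z))\<^sup>2"
      using sum_squares_bound[of "norm (p x - x)" "norm (x - z)"] by (simp add: power2_sum)
    finally show "(norm (p x - z))\<^sup>2 \<le> 2 * (norm (p x - x))\<^sup>2 + 2 * (norm (x - z))\<^sup>2" .
  qed (use lam_nonneg in simp)
  finally show ?thesis by (simp add: algebra_simps)
qed

end

section \<open>The run for a fixed delay sequence\<close>

text \<open>
  Course-of-values recursion, kept apart from the particular update map \<open>T\<close>.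
\<close>

lemma stale_bounds: "1 \<le> k \<Longrightarrow> 1 \<le> stale k n \<and> stale k n \<le> k \<and> k - stale k n \<le> n"
  by (auto simp: stale_def)

function delayed_iterates ::
  "(nat \<Rightarrow> nat) \<Rightarrow> (nat \<Rightarrow> 'a \<Rightarrow> 'a \<Rightarrow> 'a) \<Rightarrow> 'a \<Rightarrow> nat \<Rightarrow> 'a" where
  "delayed_iterates d T x1 k = (if k \<le> 1 then x1 else
     T (k - 1) (delayed_iterates d T x1 (stale (k - 1) (d (k - 1)))) (delayed_iterates d T x1 (k - 1)))"
  by pat_completeness auto
termination
  by (relation "Wellfounded.measure (\<lambda>(d, T, x1, k). k)") (auto simp: stale_def)

declare delayed_iterates.simps [simp del]

lemma delayed_induct [consumes 1, case_names 1 Suc]: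
  assumes "1 \<le> k" and "P 1" and "\<And>k. 1 \<le> k \<Longrightarrow> P (stale k (d k)) \<Longrightarrow> P k \<Longrightarrow> P (Suc k)"
  shows "P k"
  using assms(1)
proof (induction k rule: less_induct)
  case (less k)
  show ?case
  proof (cases "k = 1")
    case False
    then obtain j where j: "k = Suc j" "1 \<le> j" using less.prems by (cases k) auto
    show ?thesis unfolding j(1)
      using stale_bounds[OF j(2), of "d j"] j by (intro assms(3) less.IH) auto
  qed (use assms(2) in simp)
qed

context delayed_run
begin

text \<open>
  The run as an explicit function of the sample path: \<open>s k\<close> is the sample used in update \<open>k\<close>.  Unlike a
  trajectory given by its optimality conditions, it is defined on every path, depends visibly only
  on the samples of earlier updates, and can be composed with other random variables.
\<close>

definition run :: "(nat \<Rightarrow> 'a) \<Rightarrow> nat \<Rightarrow> 'b" where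
  "run s = delayed_iterates d (\<lambda>k z. prox S (\<lambda>y. partial_lin h c z y (s k) + r y) \<gamma>) x1"

lemma run_1: "run s 1 = x1"
  by (simp add: run_def delayed_iterates.simps)

lemma run_Suc:
  "1 \<le> k \<Longrightarrow> run s (Suc k) =
    prox S (\<lambda>y. partial_lin h c (run s (stale k (d k))) y (s k) + r y) \<gamma> (run s k)"
  unfolding run_def by (subst delayed_iterates.simps) simp

lemma run_in_S:
  assumes "1 \<le> k" and "\<And>i. 1 \<le> i \<Longrightarrow> i < k \<Longrightarrow> s i \<in> space \<Xi>"
  shows "run s k \<in> S"
  using assms
proof (induction k rule: delayed_induct[where d = d])
  case 1
  then show ?case using x1_in by (simp add: run_1[simplified])
next
  case (Suc k)
  have "run s (stale k (d k)) \<in> S"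
    using stale_bounds[OF Suc.hyps, of "d k"] by (intro Suc.IH(1) Suc.prems) auto
  then interpret m: prox_function S "\<lambda>y. partial_lin h c (run s (stale k (d k))) y (s k) + r y"
      "Lh * Lcs (s k) + L\<omega>" \<kappa> \<gamma>
    using Suc by (intro prox_function_model \<kappa>_less_\<gamma>) auto
  show ?case unfolding run_Suc[OF Suc.hyps] by (rule m.prox_in)
qed

lemma run_cong:
  assumes "1 \<le> k" and "\<And>i. 1 \<le> i \<Longrightarrow> i < k \<Longrightarrow> s i = s' i"
  shows "run s k = run s' k"
  using assms
proof (induction k rule: delayed_induct[where d = d])
  case 1
  then show ?case by (simp add: run_1[simplified])
next
  case (Suc k)
  have "run s (stale k (d k)) = run s' (stale k (d k))"
    using stale_bounds[OF Suc.hyps, of "d k"] by (intro Suc.IH(1) Suc.prems) auto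
  moreover have "run s k = run s' k" by (intro Suc.IH(2) Suc.prems) auto
  ultimately show ?case using Suc.prems[of k] Suc.hyps by (simp add: run_Suc)
qed

lemma run_measurable:
  assumes "1 \<le> k" and "\<And>i. 1 \<le> i \<Longrightarrow> i < k \<Longrightarrow> (\<lambda>w. \<zeta> w i) \<in> N \<rightarrow>\<^sub>M \<Xi>"
  shows "(\<lambda>w. run (\<zeta> w) k) \<in> borel_measurable N"
  using assms
proof (induction k rule: delayed_induct[where d = d])
  case 1
  then show ?case by (simp add: run_1[simplified])
next
  case (Suc k)
  note b = stale_bounds[OF Suc.hyps, of "d k"]
  show ?case unfolding run_Suc[OF Suc.hyps]
  proof (rule prox_model_measurable[OF _ _ _ _ \<kappa>_less_\<gamma>])
    show "(\<lambda>w. run (\<zeta> w) (stale k (d k))) \<in> borel_measurable N"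
      using b by (intro Suc.IH(1) Suc.prems) auto
    show "(\<lambda>w. run (\<zeta> w) k) \<in> borel_measurable N"
      by (intro Suc.IH(2) Suc.prems) auto
    show "(\<lambda>w. \<zeta> w k) \<in> N \<rightarrow>\<^sub>M \<Xi>" using Suc by auto
    fix w assume "w \<in> space N"
    then have "\<zeta> w i \<in> space \<Xi>" if "1 \<le> i" "i < Suc k" for i
      using measurable_space[OF Suc.prems[OF that]] by blast
    then show "run (\<zeta> w) (stale k (d k)) \<in> S"
      using b by (intro run_in_S) auto
  qed
qed

end

section \<open>Expected progress for a fixed delay sequence\<close>

locale random_delayed_run = delayed_run + M: prob_space M
  for M :: "'w measure" +
  fixes \<zeta> :: "nat \<Rightarrow> 'w \<Rightarrow> 'a"
  assumes \<zeta>_indep: "M.indep_vars (\<lambda>_. \<Xi>) \<zeta> {1..}"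
    and \<zeta>_distr: "\<And>k. 1 \<le> k \<Longrightarrow> distr M \<Xi> (\<zeta> k) = \<Xi>"
begin

definition X :: "nat \<Rightarrow> 'w \<Rightarrow> 'b" where
  "X k w = run (\<lambda>i. \<zeta> i w) k"

abbreviation Z :: "nat \<Rightarrow> 'w \<Rightarrow> 'b" where
  "Z k \<equiv> X (stale k (d k))"

lemma \<zeta>_measurable: "1 \<le> k \<Longrightarrow> \<zeta> k \<in> M \<rightarrow>\<^sub>M \<Xi>"
  using \<zeta>_indep by (simp add: M.indep_vars_def)

lemma \<zeta>_space: "1 \<le> k \<Longrightarrow> w \<in> space M \<Longrightarrow> \<zeta> k w \<in> space \<Xi>"
  using \<zeta>_measurable by (rule measurable_space)

lemma X_measurable: "1 \<le> k \<Longrightarrow> X k \<in> borel_measurable M"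
  unfolding X_def[abs_def] by (rule run_measurable) (auto intro: \<zeta>_measurable)

lemma X_in_S: "1 \<le> k \<Longrightarrow> w \<in> space M \<Longrightarrow> X k w \<in> S"
  unfolding X_def by (rule run_in_S) (auto intro: \<zeta>_space)

lemma X_Suc: "1 \<le> k \<Longrightarrow> X (Suc k) w = prox S (\<lambda>y. partial_lin h c (Z k w) y (\<zeta> k w) + r y) \<gamma> (X k w)"
  unfolding X_def by (rule run_Suc)

lemma stale_pos: "1 \<le> k \<Longrightarrow> 1 \<le> stale k n"
  using stale_bounds by blast

lemma sample_integral:
  fixes g :: "'a \<Rightarrow> real"
  assumes "1 \<le> k" and "g \<in> borel_measurable \<Xi>"
  shows "(\<integral>w. g (\<zeta> k w) \<partial>M) = (\<integral>s. g s \<partial>\<Xi>)"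
    and "integrable M (\<lambda>w. g (\<zeta> k w)) \<longleftrightarrow> integrable \<Xi> g"
  using integral_distr[OF \<zeta>_measurable[OF assms(1)] assms(2)]
    integrable_distr_eq[OF \<zeta>_measurable[OF assms(1)] assms(2)] \<zeta>_distr[OF assms(1)] by simp_all

lemma slope_second_moment:
  assumes k: "1 \<le> k"
  shows "integrable M (\<lambda>w. (Lh * Lcs (\<zeta> k w) + a)\<^sup>2)"
    and "(\<integral>w. (Lh * Lcs (\<zeta> k w) + a)\<^sup>2 \<partial>M) \<le> 2 * (Lf\<^sup>2 + a\<^sup>2)"
proof -
  have meas: "(\<lambda>s. (Lh * Lcs s + a)\<^sup>2) \<in> borel_measurable \<Xi>" by measurable
  have int: "integrable \<Xi> (\<lambda>s. (Lh * Lcs s + a)\<^sup>2)"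
    unfolding power2_sum power_mult_distrib
    using Lcs_integrable Lcs_sq_integrable by (simp add: mult.assoc)
  show "integrable M (\<lambda>w. (Lh * Lcs (\<zeta> k w) + a)\<^sup>2)"
    using sample_integral(2)[OF k meas] int by simp
  have "(\<integral>w. (Lh * Lcs (\<zeta> k w) + a)\<^sup>2 \<partial>M) = (\<integral>s. (Lh * Lcs s + a)\<^sup>2 \<partial>\<Xi>)"
    by (rule sample_integral(1)[OF k meas])
  also have "\<dots> \<le> (\<integral>s. 2 * Lh\<^sup>2 * (Lcs s)\<^sup>2 + 2 * a\<^sup>2 \<partial>\<Xi>)"
  proof (rule integral_mono[OF int])
    show "(Lh * Lcs s + a)\<^sup>2 \<le> 2 * Lh\<^sup>2 * (Lcs s)\<^sup>2 + 2 * a\<^sup>2" for s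
      using sum_squares_bound[of "Lh * Lcs s" a] by (simp add: power2_sum power_mult_distrib)
  qed (use Lcs_sq_integrable in simp)
  also have "\<dots> = 2 * Lh\<^sup>2 * (\<integral>s. (Lcs s)\<^sup>2 \<partial>\<Xi>) + 2 * a\<^sup>2"
    using Lcs_sq_integrable by (simp add: law.prob_space)
  also have "\<dots> \<le> 2 * Lh\<^sup>2 * Lc\<^sup>2 + 2 * a\<^sup>2"
    using Lcs_second_moment by (intro add_right_mono mult_left_mono) auto
  finally show "(\<integral>w. (Lh * Lcs (\<zeta> k w) + a)\<^sup>2 \<partial>M) \<le> 2 * (Lf\<^sup>2 + a\<^sup>2)"
    by (simp add: power_mult_distrib)
qed

text \<open>A bound on the mean squared length of a single update.\<close>

abbreviation "V \<equiv> 2 * (Lf\<^sup>2 + L\<omega>\<^sup>2) / (\<gamma> - \<kappa> / 2)\<^sup>2"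

text \<open>
  Every step is short because the model is Lipschitz and the proximal weight is large; a stale
  iterate is at most \<open>n\<close> steps away, which gives \<open>n\<^sup>2\<close> by the inequality between arithmetic and
  quadratic mean.
\<close>

lemma drift_le:
  assumes i: "1 \<le> i" and ik: "i \<le> k" and n: "k - i \<le> n"
  shows "integrable M (\<lambda>w. (norm (X k w - X i w))\<^sup>2)"
    and "(\<integral>w. (norm (X k w - X i w))\<^sup>2 \<partial>M) \<le> (real n)\<^sup>2 * V"
proof -
  let ?b = "\<lambda>j w. (Lh * Lcs (\<zeta> j w) + L\<omega>)\<^sup>2 / (\<gamma> - \<kappa> / 2)\<^sup>2"
  have le: "(norm (X k w - X i w))\<^sup>2 \<le> real (k - i) * (\<Sum>j=i..<k. ?b j w)" if w: "w \<in> space M" for w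
  proof -
    have "norm (X k w - X i w) = norm (\<Sum>j=i..<k. X (Suc j) w - X j w)"
      using sum_Suc_diff'[OF ik, of "\<lambda>j. X j w"] by simp
    also have "\<dots> \<le> (\<Sum>j=i..<k. norm (X (Suc j) w - X j w))" by (rule norm_sum)
    finally have "(norm (X k w - X i w))\<^sup>2 \<le> (\<Sum>j=i..<k. norm (X (Suc j) w - X j w))\<^sup>2"
      by (rule power_mono) simp
    also have "\<dots> \<le> (\<Sum>j=i..<k. (norm (X (Suc j) w - X j w))\<^sup>2) * card {i..<k}"
      by (rule sum_squared_le_sum_of_squares)
    also have "\<dots> \<le> (\<Sum>j=i..<k. ?b j w) * card {i..<k}"
    proof (intro mult_right_mono sum_mono)
      fix j assume "j \<in> {i..<k}"
      then have j: "1 \<le> j" using i by simp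
      have "norm (X (Suc j) w - X j w) \<le> (Lh * Lcs (\<zeta> j w) + L\<omega>) / (\<gamma> - \<kappa> / 2)"
        unfolding X_Suc[OF j]
        by (rule model_step_le[OF \<zeta>_space[OF j w] X_in_S[OF stale_pos[OF j] w] X_in_S[OF j w]])
      then have "(norm (X (Suc j) w - X j w))\<^sup>2 \<le> ((Lh * Lcs (\<zeta> j w) + L\<omega>) / (\<gamma> - \<kappa> / 2))\<^sup>2"
        by (rule power_mono) simp
      then show "(norm (X (Suc j) w - X j w))\<^sup>2 \<le> ?b j w" by (simp add: power_divide)
    qed simp
    finally show ?thesis by (simp add: mult.commute)
  qed
  have int_b: "integrable M (?b j)" if "j \<in> {i..<k}" for j
    using slope_second_moment(1)[of j L\<omega>] that i by simp
  have int_s: "integrable M (\<lambda>w. real (k - i) * (\<Sum>j=i..<k. ?b j w))"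
    using int_b by (intro integrable_mult_right Bochner_Integration.integrable_sum) blast
  have [measurable]: "X k \<in> borel_measurable M" "X i \<in> borel_measurable M"
    using X_measurable i ik by auto
  show int: "integrable M (\<lambda>w. (norm (X k w - X i w))\<^sup>2)"
    by (rule Bochner_Integration.integrable_bound[OF int_s])
      (use le in \<open>auto intro!: AE_I2 order_trans[OF _ abs_ge_self]\<close>)
  have "(\<integral>w. (norm (X k w - X i w))\<^sup>2 \<partial>M) \<le> (\<integral>w. real (k - i) * (\<Sum>j=i..<k. ?b j w) \<partial>M)"
    by (rule integral_mono[OF int int_s le])
  also have "\<dots> = real (k - i) * (\<Sum>j=i..<k. \<integral>w. ?b j w \<partial>M)"
    using int_b by (simp del: sum_divide_distrib add: Bochner_Integration.integral_sum)
  also have "\<dots> \<le> real (k - i) * (\<Sum>j=i..<k. V)"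
    using slope_second_moment(2)[of _ L\<omega>] i
    by (intro mult_left_mono sum_mono) (auto intro!: divide_right_mono)
  also have "\<dots> = (real (k - i))\<^sup>2 * V" by (simp add: power2_eq_square)
  also have "\<dots> \<le> (real n)\<^sup>2 * V" using n by (intro mult_right_mono power_mono) auto
  finally show "(\<integral>w. (norm (X k w - X i w))\<^sup>2 \<partial>M) \<le> (real n)\<^sup>2 * V" .
qed

lemma stale_drift_le:
  assumes k: "1 \<le> k"
  shows "integrable M (\<lambda>w. (norm (X k w - Z k w))\<^sup>2)"
    and "(\<integral>w. (norm (X k w - Z k w))\<^sup>2 \<partial>M) \<le> (real (d k))\<^sup>2 * V"
  using drift_le stale_bounds[OF k, of "d k"] by blast+

lemma residual_integrable:
  assumes k: "1 \<le> k"
  shows "integrable M (\<lambda>w. (norm (p (X k w) - X k w))\<^sup>2)"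
proof (rule M.integrable_const_bound)
  show "AE w in M. norm ((norm (p (X k w) - X k w))\<^sup>2) \<le> ((Lf + L\<omega>) / (\<rho> - (lam + \<kappa>) / 2))\<^sup>2"
    using p_dist_le[OF X_in_S[OF k]] by (intro AE_I2) (auto intro!: power_mono)
  have [measurable]: "X k \<in> borel_measurable M" using k by (rule X_measurable)
  show "(\<lambda>w. (norm (p (X k w) - X k w))\<^sup>2) \<in> borel_measurable M" by measurable
qed

lemma noise_measurable:
  assumes [measurable]: "z \<in> borel_measurable N" "x \<in> borel_measurable N" "s \<in> N \<rightarrow>\<^sub>M \<Xi>"
    and "\<And>w. w \<in> space N \<Longrightarrow> x w \<in> S"
  shows "(\<lambda>w. noise (z w) (x w) (s w)) \<in> borel_measurable N"
proof -
  have "(\<lambda>w. f (p (x w))) \<in> borel_measurable N" "(\<lambda>w. f (x w)) \<in> borel_measurable N"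
    using assms(4) obj.prox_in by (auto intro!: f_measurable_comp)
  then show ?thesis
    unfolding noise_def by (intro borel_measurable_diff partial_lin_measurable) measurable
qed

text \<open>
  Update \<open>k\<close> reads a sample that none of the iterates \<open>X 1, \<dots>, X k\<close> has used; the two noise arguments
  are functions of the samples \<open>1, \<dots>, k - 1\<close>.
\<close>

lemma noise_expectation_le:
  assumes k: "1 \<le> k"
  shows "integrable M (\<lambda>w. noise (Z k w) (X k w) (\<zeta> k w))"
    and "(\<integral>w. noise (Z k w) (X k w) (\<zeta> k w) \<partial>M)
      \<le> lam * (\<integral>w. (norm (p (X k w) - X k w))\<^sup>2 \<partial>M) + 3 / 2 * lam * ((real (d k))\<^sup>2 * V)"
proof -
  note sb = stale_bounds[OF k, of "d k"]
  have Zk: "1 \<le> stale k (d k)" using sb by simp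
  \<comment> \<open>The fresh sample is kept as a function on \<open>{k}\<close>, so that it has the same type as the past.\<close>
  let ?past = "\<lambda>w. restrict (\<lambda>i. \<zeta> i w) {1..<k}"
  let ?fresh = "\<lambda>w. restrict (\<lambda>i. \<zeta> i w) {k}"
  let ?A = "PiM {1..<k} (\<lambda>_. \<Xi>)" and ?B = "PiM {k} (\<lambda>_. \<Xi>)"
  let ?g = "\<lambda>u v. noise (run u (stale k (d k))) (run u k) (v k)"
  have past: "run (?past w) j = X j w" if "1 \<le> j" "j \<le> k" for j w
    unfolding X_def using that by (intro run_cong) auto
  have g_eq: "?g (?past w) (?fresh v) = noise (Z k w) (X k w) (\<zeta> k v)" for w v
    using past[of k w] past[of "stale k (d k)" w] sb k by simp
  have indep: "M.indep_var ?A ?past ?B ?fresh"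
    using k by (intro M.indep_var_restrict[OF \<zeta>_indep]) auto
  have g_meas: "case_prod ?g \<in> borel_measurable (?A \<Otimes>\<^sub>M ?B)"
    unfolding case_prod_beta
  proof (rule noise_measurable)
    have comp: "(\<lambda>q. fst q i) \<in> ?A \<Otimes>\<^sub>M ?B \<rightarrow>\<^sub>M \<Xi>" if "1 \<le> i" "i < k" for i
      using that by (intro measurable_compose[OF measurable_fst measurable_component_singleton]) auto
    show "(\<lambda>q. run (fst q) (stale k (d k))) \<in> borel_measurable (?A \<Otimes>\<^sub>M ?B)"
      using sb by (intro run_measurable comp) auto
    show "(\<lambda>q. run (fst q) k) \<in> borel_measurable (?A \<Otimes>\<^sub>M ?B)"
      using k by (intro run_measurable comp) auto
    show "(\<lambda>q. snd q k) \<in> ?A \<Otimes>\<^sub>M ?B \<rightarrow>\<^sub>M \<Xi>"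
      by (intro measurable_compose[OF measurable_snd measurable_component_singleton]) auto
    fix q assume "q \<in> space (?A \<Otimes>\<^sub>M ?B)"
    then show "run (fst q) k \<in> S"
      using measurable_space[OF comp] k by (intro run_in_S) auto
  qed
  have XZ [measurable]: "X k \<in> borel_measurable M" "Z k \<in> borel_measurable M" "\<zeta> k \<in> M \<rightarrow>\<^sub>M \<Xi>"
    using X_measurable[OF k] X_measurable[OF Zk] \<zeta>_measurable[OF k] by auto
  show int: "integrable M (\<lambda>w. noise (Z k w) (X k w) (\<zeta> k w))"
  proof (rule Bochner_Integration.integrable_bound)
    show "integrable M (\<lambda>w. (Lh * Lcs (\<zeta> k w) + Lf) * ((Lf + L\<omega>) / (\<rho> - (lam + \<kappa>) / 2)))"
      using sample_integral(2)[OF k Lcs_measurable] Lcs_integrable by simp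
    show "(\<lambda>w. noise (Z k w) (X k w) (\<zeta> k w)) \<in> borel_measurable M"
      using X_in_S[OF k] by (intro noise_measurable) auto
    show "AE w in M. norm (noise (Z k w) (X k w) (\<zeta> k w))
        \<le> norm ((Lh * Lcs (\<zeta> k w) + Lf) * ((Lf + L\<omega>) / (\<rho> - (lam + \<kappa>) / 2)))"
    proof (intro AE_I2)
      fix w assume w: "w \<in> space M"
      from noise_abs_le[OF \<zeta>_space[OF k w] X_in_S[OF Zk w] X_in_S[OF k w]]
      show "norm (noise (Z k w) (X k w) (\<zeta> k w))
          \<le> norm ((Lh * Lcs (\<zeta> k w) + Lf) * ((Lf + L\<omega>) / (\<rho> - (lam + \<kappa>) / 2)))"
        unfolding real_norm_def by (rule order_trans[OF _ abs_ge_self])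
    qed
  qed
  let ?b = "\<lambda>w. lam * (norm (p (X k w) - X k w))\<^sup>2 + 3 / 2 * lam * (norm (X k w - Z k w))\<^sup>2"
  have int_b: "integrable M ?b"
    using residual_integrable[OF k] stale_drift_le(1)[OF k] by simp
  have "(\<integral>w. ?g (?past w) (?fresh w) \<partial>M) \<le> (\<integral>w. ?b w \<partial>M)"
  proof (rule M.expectation_le_by_conditioning[OF indep g_meas _ int_b])
    show "integrable M (\<lambda>w. ?g (?past w) (?fresh w))" unfolding g_eq by (rule int)
    fix w assume w: "w \<in> space M"
    note zS = X_in_S[OF Zk w] and xS = X_in_S[OF k w]
    have "(\<integral>v. ?g (?past w) (?fresh v) \<partial>M) = (\<integral>s. noise (Z k w) (X k w) s \<partial>\<Xi>)"
      unfolding g_eq using xS by (intro sample_integral(1)[OF k] noise_measurable) auto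
    also have "\<dots> \<le> ?b w" by (rule noise_mean_le[OF zS xS])
    finally show "(\<integral>v. ?g (?past w) (?fresh v) \<partial>M) \<le> ?b w" .
  qed
  also have "\<dots> = lam * (\<integral>w. (norm (p (X k w) - X k w))\<^sup>2 \<partial>M) + 3 / 2 * lam * (\<integral>w. (norm (X k w - Z k w))\<^sup>2 \<partial>M)"
    using residual_integrable[OF k] stale_drift_le(1)[OF k] by simp
  also have "\<dots> \<le> lam * (\<integral>w. (norm (p (X k w) - X k w))\<^sup>2 \<partial>M) + 3 / 2 * lam * ((real (d k))\<^sup>2 * V)"
    using stale_drift_le(2)[OF k] lam_nonneg by (intro add_left_mono mult_left_mono) auto
  finally show "(\<integral>w. noise (Z k w) (X k w) (\<zeta> k w) \<partial>M)
      \<le> lam * (\<integral>w. (norm (p (X k w) - X k w))\<^sup>2 \<partial>M) + 3 / 2 * lam * ((real (d k))\<^sup>2 * V)"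
    unfolding g_eq .
qed

text \<open>The descent inequalities telescope along each path; expectations are taken only afterwards.\<close>

lemma sum_residual_le:
  assumes lower: "\<And>y. y \<in> S \<Longrightarrow> B \<le> f y + r y"
  shows "(2 * \<rho> - 3 * lam - 2 * \<kappa>) * (\<Sum>k=1..K. \<integral>w. (norm (p (X k w) - X k w))\<^sup>2 \<partial>M)
    \<le> 2 * G / \<rho> * (obj.env x1 - B) + real K * (4 * Lf\<^sup>2 / (\<gamma> - \<rho>)) + 3 * lam * V * (\<Sum>k=1..K. (real (d k))\<^sup>2)"
proof -
  let ?e = "\<lambda>k. \<integral>w. (norm (p (X k w) - X k w))\<^sup>2 \<partial>M"
  let ?m = "2 * \<rho> - lam - 2 * \<kappa>"
  let ?t = "\<lambda>k w. (Lh * Lcs (\<zeta> k w) + Lf)\<^sup>2 / (\<gamma> - \<rho>) + 2 * noise (Z k w) (X k w) (\<zeta> k w)"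
  have \<beta>: "0 < \<gamma> - \<rho>" using \<gamma>_gt by simp
  have path: "?m * (\<Sum>k=1..K. (norm (p (X k w) - X k w))\<^sup>2) \<le> 2 * G / \<rho> * (obj.env x1 - B) + (\<Sum>k=1..K. ?t k w)"
    if w: "w \<in> space M" for w
  proof -
    have "?m * (\<Sum>k=1..K. (norm (p (X k w) - X k w))\<^sup>2)
        \<le> (\<Sum>k=1..K. 2 * G / \<rho> * (obj.env (X k w) - obj.env (X (Suc k) w)) + ?t k w)"
      unfolding sum_distrib_left
    proof (rule sum_mono)
      fix k assume "k \<in> {1..K}"
      then have k: "1 \<le> k" by simp
      from env_descent[OF \<zeta>_space[OF k w] X_in_S[OF stale_pos[OF k] w] X_in_S[OF k w], of "d k"]
      show "?m * (norm (p (X k w) - X k w))\<^sup>2 \<le> 2 * G / \<rho> * (obj.env (X k w) - obj.env (X (Suc k) w)) + ?t k w"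
        unfolding X_Suc[OF k, symmetric] by simp
    qed
    also have "\<dots> = 2 * G / \<rho> * (\<Sum>k=1..K. obj.env (X k w) - obj.env (X (Suc k) w)) + (\<Sum>k=1..K. ?t k w)"
      by (simp only: sum.distrib sum_distrib_left)
    also have "(\<Sum>k=1..K. obj.env (X k w) - obj.env (X (Suc k) w)) = obj.env x1 - obj.env (X (Suc K) w)"
      by (induction K) (simp_all add: X_def run_1[simplified])
    also have "2 * G / \<rho> * (obj.env x1 - obj.env (X (Suc K) w)) \<le> 2 * G / \<rho> * (obj.env x1 - B)"
    proof (intro mult_left_mono diff_left_mono)
      show "B \<le> obj.env (X (Suc K) w)"
        unfolding obj.env_def using lower[OF obj.prox_in] \<rho>_pos by (simp add: add_increasing2)
    qed (use G_pos \<rho>_pos in simp)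
    finally show ?thesis by simp
  qed
  have int_r: "integrable M (\<lambda>w. (norm (p (X k w) - X k w))\<^sup>2)" if "k \<in> {1..K}" for k
    using that by (intro residual_integrable) simp
  have int_1: "integrable M (\<lambda>w. (Lh * Lcs (\<zeta> k w) + Lf)\<^sup>2 / (\<gamma> - \<rho>))" if "k \<in> {1..K}" for k
    using slope_second_moment(1)[of k Lf] that by simp
  have int_2: "integrable M (\<lambda>w. 2 * noise (Z k w) (X k w) (\<zeta> k w))" if "k \<in> {1..K}" for k
    using noise_expectation_le(1)[of k] that by simp
  have int_t: "integrable M (?t k)" if "k \<in> {1..K}" for k
    using int_1[OF that] int_2[OF that] by (rule Bochner_Integration.integrable_add)
  have mean_t: "(\<integral>w. ?t k w \<partial>M) \<le> 4 * Lf\<^sup>2 / (\<gamma> - \<rho>) + 2 * lam * ?e k + 3 * lam * V * (real (d k))\<^sup>2"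
    if k: "k \<in> {1..K}" for k
  proof -
    have "(\<integral>w. ?t k w \<partial>M) = (\<integral>w. (Lh * Lcs (\<zeta> k w) + Lf)\<^sup>2 \<partial>M) / (\<gamma> - \<rho>)
        + 2 * (\<integral>w. noise (Z k w) (X k w) (\<zeta> k w) \<partial>M)"
      using int_1[OF k] int_2[OF k] by simp
    also have "(\<integral>w. (Lh * Lcs (\<zeta> k w) + Lf)\<^sup>2 \<partial>M) / (\<gamma> - \<rho>) \<le> 4 * Lf\<^sup>2 / (\<gamma> - \<rho>)"
      using slope_second_moment(2)[of k Lf] k \<beta> by (intro divide_right_mono) auto
    also have "2 * (\<integral>w. noise (Z k w) (X k w) (\<zeta> k w) \<partial>M)
        \<le> 2 * (lam * ?e k + 3 / 2 * lam * ((real (d k))\<^sup>2 * V))"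
      using noise_expectation_le(2)[of k] k by (intro mult_left_mono) auto
    also have "2 * (lam * ?e k + 3 / 2 * lam * ((real (d k))\<^sup>2 * V)) = 2 * lam * ?e k + 3 * lam * V * (real (d k))\<^sup>2"
      by (simp add: algebra_simps)
    finally show ?thesis by simp
  qed
  have "?m * (\<Sum>k=1..K. ?e k) = (\<integral>w. ?m * (\<Sum>k=1..K. (norm (p (X k w) - X k w))\<^sup>2) \<partial>M)"
    using int_r by (simp add: Bochner_Integration.integral_sum)
  also have "\<dots> \<le> (\<integral>w. 2 * G / \<rho> * (obj.env x1 - B) + (\<Sum>k=1..K. ?t k w) \<partial>M)"
    by (rule integral_mono[OF _ _ path])
      (intro integrable_mult_right Bochner_Integration.integrable_sum Bochner_Integration.integrable_add
        M.integrable_const int_r int_1 int_2; assumption)+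
  also have "\<dots> = 2 * G / \<rho> * (obj.env x1 - B) + (\<Sum>k=1..K. \<integral>w. ?t k w \<partial>M)"
  proof -
    have "(\<integral>w. (\<Sum>k=1..K. ?t k w) \<partial>M) = (\<Sum>k=1..K. \<integral>w. ?t k w \<partial>M)"
      by (rule Bochner_Integration.integral_sum) (rule int_t)
    moreover have "integrable M (\<lambda>w. \<Sum>k=1..K. ?t k w)"
      by (rule Bochner_Integration.integrable_sum) (rule int_t)
    ultimately show ?thesis by (subst Bochner_Integration.integral_add) (simp_all add: M.prob_space)
  qed
  also have "(\<Sum>k=1..K. \<integral>w. ?t k w \<partial>M)
      \<le> (\<Sum>k=1..K. 4 * Lf\<^sup>2 / (\<gamma> - \<rho>) + 2 * lam * ?e k + 3 * lam * V * (real (d k))\<^sup>2)"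
    by (rule sum_mono) (rule mean_t)
  also have "\<dots> = real K * (4 * Lf\<^sup>2 / (\<gamma> - \<rho>)) + 2 * lam * (\<Sum>k=1..K. ?e k) + 3 * lam * V * (\<Sum>k=1..K. (real (d k))\<^sup>2)"
    by (simp add: sum.distrib sum_distrib_left)
  finally show ?thesis by (simp add: algebra_simps)
qed

end

text \<open>
  With \<open>q = \<surd>K / \<alpha>\<close> the step-size terms are \<open>G = 2 \<rho> + 5 lam - \<kappa> + q\<close>, \<open>\<gamma> - \<rho> \<ge> q\<close> and
  \<open>\<gamma> - \<kappa>/2 \<ge> q\<close>; the coefficient \<open>2 \<rho> - 3 lam - 2 \<kappa>\<close> is at least twice \<open>\<rho> - 2 lam - \<kappa>\<close>.
\<close>

lemma rate_arithmetic:
  fixes A D T Lf L\<omega> \<kappa> lam \<rho> \<gamma> \<alpha> :: real and K :: nat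
  assumes K: "1 \<le> K" and \<alpha>: "0 < \<alpha>" and \<gamma>: "\<gamma> = \<rho> + 6 * lam + \<kappa> + sqrt (real K) / \<alpha>"
    and \<rho>: "2 * lam + \<kappa> < \<rho>" and lam: "0 \<le> lam" and \<kappa>: "0 \<le> \<kappa>" and Lf: "0 \<le> Lf" and L\<omega>: "0 \<le> L\<omega>"
    and A: "0 \<le> A" and D: "0 \<le> D" and T: "0 \<le> T"
    and le: "(2 * \<rho> - 3 * lam - 2 * \<kappa>) * A \<le> 2 * (\<gamma> + \<rho> - lam - 2 * \<kappa>) / \<rho> * D
        + real K * (4 * Lf\<^sup>2 / (\<gamma> - \<rho>)) + 3 * lam * (2 * (Lf\<^sup>2 + L\<omega>\<^sup>2) / (\<gamma> - \<kappa> / 2)\<^sup>2) * T"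
  shows "\<rho>\<^sup>2 * A / real K \<le> 2 * \<rho> / (\<rho> - 2 * lam - \<kappa>) *
    ((\<rho> + 4 * lam) * D / real K + D / (sqrt (real K) * \<alpha>) + 2 * \<rho> * Lf\<^sup>2 * \<alpha> / sqrt (real K)
      + 6 * \<rho> * lam * (Lf + L\<omega>)\<^sup>2 * \<alpha>\<^sup>2 / real K * (T / real K))"
proof -
  let ?K = "real K"
  define q where "q = sqrt ?K / \<alpha>"
  define e where "e = \<rho> - 2 * lam - \<kappa>"
  have K0: "0 < ?K" using K by simp
  have q: "0 < q" unfolding q_def using K0 \<alpha> by simp
  have e: "0 < e" unfolding e_def using \<rho> by simp
  have \<rho>0: "0 < \<rho>" using \<rho> lam \<kappa> by linarith
  have qK: "q / ?K = 1 / (sqrt ?K * \<alpha>)"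
    unfolding q_def using K0 \<alpha> by (simp add: field_simps)
  have q2: "1 / q\<^sup>2 = \<alpha>\<^sup>2 / ?K" unfolding q_def using K0 \<alpha> by (simp add: power_divide)
  have q1: "1 / q = \<alpha> / sqrt ?K" unfolding q_def by simp
  have t1: "2 * (\<gamma> + \<rho> - lam - 2 * \<kappa>) / \<rho> * D * (\<rho> / (4 * ?K)) \<le> (\<rho> + 4 * lam) * D / ?K + D / (sqrt ?K * \<alpha>)"
  proof -
    have "2 * g / \<rho> * D * (\<rho> / (4 * ?K)) = (g / 2) * (D / ?K)" for g
      using \<rho>0 by simp
    then have "2 * (\<gamma> + \<rho> - lam - 2 * \<kappa>) / \<rho> * D * (\<rho> / (4 * ?K)) = ((\<gamma> + \<rho> - lam - 2 * \<kappa>) / 2) * (D / ?K)" .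
    also have "\<dots> \<le> (\<rho> + 4 * lam + q) * (D / ?K)"
      using D K0 lam \<kappa> q by (intro mult_right_mono) (auto simp: \<gamma> q_def[symmetric])
    also have "\<dots> = (\<rho> + 4 * lam) * D / ?K + (q / ?K) * D"
      by (simp add: distrib_right add_divide_distrib)
    finally show ?thesis unfolding qK by simp
  qed
  have t2: "?K * (4 * Lf\<^sup>2 / (\<gamma> - \<rho>)) * (\<rho> / (4 * ?K)) \<le> 2 * \<rho> * Lf\<^sup>2 * \<alpha> / sqrt ?K"
  proof -
    have "?K * (4 * a / b) * (\<rho> / (4 * ?K)) = \<rho> * a * (1 / b)" for a b
      using K0 by simp
    then have "?K * (4 * Lf\<^sup>2 / (\<gamma> - \<rho>)) * (\<rho> / (4 * ?K)) = \<rho> * Lf\<^sup>2 * (1 / (\<gamma> - \<rho>))" .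
    also have "\<dots> \<le> \<rho> * Lf\<^sup>2 * (1 / q)"
      using q lam \<kappa> \<rho>0 by (intro mult_left_mono divide_left_mono) (auto simp: \<gamma> q_def[symmetric] intro!: mult_pos_pos)
    also have "\<rho> * Lf\<^sup>2 * (1 / q) \<le> 2 * (\<rho> * Lf\<^sup>2 * (1 / q))"
    proof -
      have "0 \<le> \<rho> * Lf\<^sup>2 * (1 / q)" using \<rho>0 q by simp
      then show ?thesis by linarith
    qed
    finally show ?thesis unfolding q1 by (simp add: mult.assoc)
  qed
  have t3: "3 * lam * (2 * (Lf\<^sup>2 + L\<omega>\<^sup>2) / (\<gamma> - \<kappa> / 2)\<^sup>2) * T * (\<rho> / (4 * ?K))
      \<le> 6 * \<rho> * lam * (Lf + L\<omega>)\<^sup>2 * \<alpha>\<^sup>2 / ?K * (T / ?K)"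
  proof -
    have "2 * (Lf\<^sup>2 + L\<omega>\<^sup>2) / (\<gamma> - \<kappa> / 2)\<^sup>2 \<le> 2 * (Lf + L\<omega>)\<^sup>2 / q\<^sup>2"
      using q lam \<kappa> \<rho>0 Lf L\<omega>
      by (intro frac_le power_mono) (auto simp: \<gamma> q_def[symmetric] power2_sum)
    then have "3 * lam * (2 * (Lf\<^sup>2 + L\<omega>\<^sup>2) / (\<gamma> - \<kappa> / 2)\<^sup>2) * T * (\<rho> / (4 * ?K))
        \<le> 3 * lam * (2 * (Lf + L\<omega>)\<^sup>2 / q\<^sup>2) * T * (\<rho> / (4 * ?K))"
      using lam T \<rho>0 K0 by (intro mult_right_mono mult_left_mono) auto
    also have "\<dots> = 3 / 2 * (\<rho> * lam * (Lf + L\<omega>)\<^sup>2 * (1 / q\<^sup>2) * (T / ?K))" by (simp add: mult_ac)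
    also have "\<dots> \<le> 6 * (\<rho> * lam * (Lf + L\<omega>)\<^sup>2 * (1 / q\<^sup>2) * (T / ?K))"
      using lam T \<rho>0 K0 by (intro mult_right_mono) auto
    finally show ?thesis unfolding q2 by (simp add: mult.assoc)
  qed
  have "2 * e * A \<le> (2 * \<rho> - 3 * lam - 2 * \<kappa>) * A"
    using lam A by (intro mult_right_mono) (auto simp: e_def)
  also note le
  finally have "2 * e * A * (\<rho> / (4 * ?K)) \<le> (2 * (\<gamma> + \<rho> - lam - 2 * \<kappa>) / \<rho> * D
      + ?K * (4 * Lf\<^sup>2 / (\<gamma> - \<rho>)) + 3 * lam * (2 * (Lf\<^sup>2 + L\<omega>\<^sup>2) / (\<gamma> - \<kappa> / 2)\<^sup>2) * T) * (\<rho> / (4 * ?K))"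
    using \<rho>0 K0 by (intro mult_right_mono) auto
  also have "\<dots> \<le> (\<rho> + 4 * lam) * D / ?K + D / (sqrt ?K * \<alpha>) + 2 * \<rho> * Lf\<^sup>2 * \<alpha> / sqrt ?K
      + 6 * \<rho> * lam * (Lf + L\<omega>)\<^sup>2 * \<alpha>\<^sup>2 / ?K * (T / ?K)" (is "_ \<le> ?R")
  proof -
    have split: "(a + b + c) * k = a * k + b * k + c * k" for a b c k :: real
      by (simp add: distrib_right)
    show ?thesis unfolding split using t1 t2 t3 by linarith
  qed
  finally have "2 * \<rho> / e * (2 * e * A * (\<rho> / (4 * ?K))) \<le> 2 * \<rho> / e * ?R"
    using \<rho>0 e by (intro mult_left_mono) auto
  moreover have "2 * \<rho> / e * (2 * e * A * (\<rho> / (4 * ?K))) = \<rho>\<^sup>2 * A / ?K"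
    using e by (simp add: power2_eq_square)
  ultimately show ?thesis unfolding e_def by simp
qed

section \<open>Conditioning on the delays\<close>

text \<open>
  Selects from the doubly indexed samples the ones that a given delay sequence consumes.
\<close>

lemma (in prob_space) indep_vars_reindex:
  assumes indep: "indep_vars M' X (\<sigma> ` I)" and inj: "inj_on \<sigma> I"
  shows "indep_vars (\<lambda>i. M' (\<sigma> i)) (\<lambda>i. X (\<sigma> i)) I"
  unfolding indep_vars_def2 indep_sets_def
proof (intro conjI ballI allI impI)
  let ?F = "\<lambda>i. {X i -` A \<inter> space M |A. A \<in> sets (M' i)}"
  have sets: "indep_sets ?F (\<sigma> ` I)" using indep by (simp add: indep_vars_def2)
  show "random_variable (M' (\<sigma> i)) (X (\<sigma> i))" if "i \<in> I" for i
    using indep that by (simp add: indep_vars_def2)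
  show "?F (\<sigma> i) \<subseteq> events" if "i \<in> I" for i
    using sets that unfolding indep_sets_def by blast
  fix J A assume J: "J \<subseteq> I" "J \<noteq> {}" "finite J" and A: "A \<in> (\<Pi> i\<in>J. ?F (\<sigma> i))"
  have inj_J: "inj_on \<sigma> J" using inj J(1) by (rule inj_on_subset)
  define B where "B = A \<circ> the_inv_into J \<sigma>"
  have B: "B (\<sigma> j) = A j" if "j \<in> J" for j
    using that by (simp add: B_def the_inv_into_f_f[OF inj_J])
  have "prob (\<Inter>i\<in>\<sigma> ` J. B i) = (\<Prod>i\<in>\<sigma> ` J. prob (B i))"
    using A J B by (intro indep_setsD[OF sets]) auto
  then show "prob (\<Inter>j\<in>J. A j) = (\<Prod>j\<in>J. prob (A j))"
    using B by (simp add: prod.reindex[OF inj_J] cong: INF_cong)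
qed

lemma (in prob_space) indep_set_commute: "indep_set A B \<Longrightarrow> indep_set B A"
  unfolding indep_sets2_eq
proof safe
  fix a b assume "\<forall>a\<in>A. \<forall>b\<in>B. prob (a \<inter> b) = prob a * prob b" and "a \<in> B" "b \<in> A"
  then have "prob (b \<inter> a) = prob b * prob a" by blast
  then show "prob (a \<inter> b) = prob a * prob b" by (simp only: Int_commute mult.commute)
qed

lemma subalgebra_vimage_algebra:
  "f \<in> M \<rightarrow>\<^sub>M N \<Longrightarrow> subalgebra M (vimage_algebra (space M) f N)"
  by (simp add: subalgebra_def sets_vimage_algebra2 measurable_space measurable_sets subset_eq Pi_iff image_iff)
     (auto simp: sets_vimage_algebra2 measurable_space)

lemma (in prob_space) nn_integral_indep_indicator:
  assumes indep: "indep_set (sets F) (sets G)" and F: "subalgebra M F"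
    and g: "g \<in> borel_measurable F" and A: "A \<in> sets G"
  shows "(\<integral>\<^sup>+w. g w * indicator A w \<partial>M) = (\<integral>\<^sup>+w. g w \<partial>M) * emeasure M A"
  using g
proof (induction rule: borel_measurable_induct)
  have sp: "space F = space M" using F by (simp add: subalgebra_def)
  case (cong f g)
  have "(\<integral>\<^sup>+w. f w * indicator A w \<partial>M) = (\<integral>\<^sup>+w. g w * indicator A w \<partial>M)"
    using cong sp by (intro nn_integral_cong) simp
  moreover have "(\<integral>\<^sup>+w. f w \<partial>M) = (\<integral>\<^sup>+w. g w \<partial>M)"
    using cong sp by (intro nn_integral_cong) simp
  ultimately show ?case using cong by simp
next
  case (set B)
  have AM: "A \<in> events" using indep_setD_ev2[OF indep] A by blast
  have BM: "B \<in> events" using indep_setD_ev1[OF indep] set by blast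
  have "(\<integral>\<^sup>+w. indicator B w * indicator A w \<partial>M) = emeasure M (B \<inter> A)"
    using AM BM by (simp flip: indicator_inter_arith)
  also have "\<dots> = ennreal (prob B * prob A)"
    by (simp add: emeasure_eq_measure indep_setD[OF indep set A])
  finally show ?case
    using AM BM by (simp add: emeasure_eq_measure ennreal_mult')
next
  case (mult u c)
  have AM [measurable]: "A \<in> events" using indep_setD_ev2[OF indep] A by blast
  have [measurable]: "u \<in> borel_measurable M" by (rule measurable_from_subalg[OF F mult(2)])
  show ?case using mult by (simp add: mult.assoc nn_integral_cmult)
next
  case (add u v)
  have AM [measurable]: "A \<in> events" using indep_setD_ev2[OF indep] A by blast
  have [measurable]: "u \<in> borel_measurable M" "v \<in> borel_measurable M"
    by (rule measurable_from_subalg[OF F], fact)+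
  show ?case using add by (simp add: distrib_right nn_integral_add)
next
  case (seq U)
  have AM [measurable]: "A \<in> events" using indep_setD_ev2[OF indep] A by blast
  have [measurable]: "U i \<in> borel_measurable M" for i
    by (rule measurable_from_subalg[OF F]) (rule seq)
  have inc: "incseq (\<lambda>i w. U i w * indicator A w)"
    using \<open>incseq U\<close> by (auto simp: incseq_def le_fun_def intro!: mult_right_mono)
  have "(\<integral>\<^sup>+w. (SUP i. U i) w * indicator A w \<partial>M) = (\<integral>\<^sup>+w. (SUP i. U i w * indicator A w) \<partial>M)"
    by (simp add: SUP_mult_right_ennreal image_comp)
  also have "\<dots> = (SUP i. \<integral>\<^sup>+w. U i w * indicator A w \<partial>M)"
    using inc by (intro nn_integral_monotone_convergence_SUP) auto
  also have "\<dots> = (SUP i. (\<integral>\<^sup>+w. U i w \<partial>M) * emeasure M A)" using seq by simp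
  also have "\<dots> = (SUP i. \<integral>\<^sup>+w. U i w \<partial>M) * emeasure M A" by (simp add: SUP_mult_right_ennreal)
  also have "(SUP i. \<integral>\<^sup>+w. U i w \<partial>M) = (\<integral>\<^sup>+w. (SUP i. U i) w \<partial>M)"
    using \<open>incseq U\<close> by (simp add: nn_integral_monotone_convergence_SUP image_comp)
  finally show ?case .
qed

text \<open>
  The value observed at a random index \<open>k\<close> of a run selected by a countable code.  On each event
  \<open>{code = n}\<close> the run is a fixed function of the samples, so both independences act there and the
  conditional expectation is an explicit function of the code.
\<close>

lemma (in prob_space) nn_cond_exp_random_index:
  fixes g :: "nat \<Rightarrow> nat \<Rightarrow> 'a \<Rightarrow> ennreal"
  assumes R: "subalgebra M R" and S: "subalgebra R S" and T: "subalgebra R T"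
    and indep: "indep_set (sets S) (sets T)"
    and index: "index \<in> M \<rightarrow>\<^sub>M count_space {1..K}"
    and index_indep: "indep_set (sets (vimage_algebra (space M) index (count_space {1..K}))) (sets R)"
    and uniform: "distr M (count_space {1..K}) index = uniform_count_measure {1..K}"
    and code: "code \<in> T \<rightarrow>\<^sub>M count_space UNIV"
    and g: "\<And>n k. k \<in> {1..K} \<Longrightarrow> g n k \<in> borel_measurable S"
  shows "(\<lambda>w. g (code w) (index w) w) \<in> borel_measurable M"
    and "AE w in M. nn_cond_exp M T (\<lambda>w. g (code w) (index w) w) w
      = (\<Sum>k=1..K. \<integral>\<^sup>+v. g (code w) k v \<partial>M) / of_nat K"
proof -
  let ?I = "\<lambda>k. {w \<in> space M. index w = k}"
  let ?VI = "vimage_algebra (space M) index (count_space {1..K})"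
  let ?f = "\<lambda>w. g (code w) (index w) w"
  have ST: "subalgebra M S" "subalgebra M T"
    using R S T by (auto simp: subalgebra_def)
  have sp: "space R = space M" "space S = space M" "space T = space M"
    using R ST by (auto simp: subalgebra_def)
  have code_M [measurable]: "code \<in> M \<rightarrow>\<^sub>M count_space UNIV"
    by (rule measurable_from_subalg[OF ST(2) code])
  have g_M [measurable]: "g n k \<in> borel_measurable M" if "k \<in> {1..K}" for n k
    by (rule measurable_from_subalg[OF ST(1) g[OF that]])
  show f_M: "?f \<in> borel_measurable M"
  proof (rule measurable_compose_countable'[where g = index and I = "{1..K}"])
    show "(\<lambda>w. g (code w) k w) \<in> borel_measurable M" if "k \<in> {1..K}" for k
      by (rule measurable_compose_countable[OF g_M[OF that] code_M])
  qed (use index in auto)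
  have index_in: "index w \<in> {1..K}" if "w \<in> space M" for w
    using measurable_space[OF index that] by simp
  have prob_I: "emeasure M (?I k) = 1 / of_nat K" if k: "k \<in> {1..K}" for k
  proof -
    have "emeasure M (?I k) = emeasure (distr M (count_space {1..K}) index) {k}"
      using k index by (subst emeasure_distr) (auto intro!: arg_cong[where f = "emeasure M"])
    also have "\<dots> = 1 / of_nat K"
      unfolding uniform using k by (subst emeasure_uniform_count_measure) (auto simp: divide_ennreal_def ennreal_divide_numeral inverse_ennreal ennreal_of_nat_eq_real_of_nat inverse_eq_divide)
    finally show ?thesis .
  qed
  have VI: "subalgebra M ?VI" using index by (rule subalgebra_vimage_algebra)
  have I_VI: "?I k \<in> sets ?VI" if "k \<in> {1..K}" for k
  proof -
    have "?I k = index -` {k} \<inter> space M" by auto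
    then show ?thesis using that by (auto intro!: in_vimage_algebra)
  qed
  have I_M [measurable]: "?I k \<in> events" if "k \<in> {1..K}" for k
    using I_VI[OF that] VI by (auto simp: subalgebra_def)
  have piece: "(\<integral>\<^sup>+w\<in>B. ?f w \<partial>M) = (\<Sum>k=1..K. \<integral>\<^sup>+v. g n k v \<partial>M) / of_nat K * emeasure M B"
    if B: "B \<in> sets T" and n: "\<And>w. w \<in> B \<Longrightarrow> code w = n" for B n
  proof -
    have B_M [measurable]: "B \<in> events" using B ST by (auto simp: subalgebra_def)
    have B_R: "B \<in> sets R" using B T by (auto simp: subalgebra_def)
    have "(\<integral>\<^sup>+w\<in>B. ?f w \<partial>M) = (\<integral>\<^sup>+w. (\<Sum>k=1..K. indicator (?I k) w * (g n k w * indicator B w)) \<partial>M)"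
    proof (rule nn_integral_cong)
      fix w assume w: "w \<in> space M"
      have "(\<Sum>k=1..K. indicator (?I k) w * (g n k w * indicator B w))
          = (\<Sum>k=1..K. if k = index w then g n k w * indicator B w else 0)"
        using w by (intro sum.cong) (auto simp: indicator_def)
      also have "\<dots> = g n (index w) w * indicator B w" using index_in[OF w] by simp
      finally show "?f w * indicator B w = (\<Sum>k=1..K. indicator (?I k) w * (g n k w * indicator B w))"
        using n by (auto simp: indicator_def)
    qed
    also have "\<dots> = (\<Sum>k=1..K. \<integral>\<^sup>+w. indicator (?I k) w * (g n k w * indicator B w) \<partial>M)"
      by (intro nn_integral_sum) auto
    also have "\<dots> = (\<Sum>k=1..K. (\<integral>\<^sup>+v. g n k v \<partial>M) * emeasure M B * (1 / of_nat K))"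
    proof (rule sum.cong[OF refl])
      fix k assume k: "k \<in> {1..K}"
      have "indep_set (sets R) (sets ?VI)"
        using index_indep by (rule indep_set_commute)
      moreover have "(\<lambda>w. g n k w * indicator B w) \<in> borel_measurable R"
        using measurable_from_subalg[OF S g[OF k]] B_R by simp
      ultimately have "(\<integral>\<^sup>+w. (g n k w * indicator B w) * indicator (?I k) w \<partial>M)
          = (\<integral>\<^sup>+w. g n k w * indicator B w \<partial>M) * emeasure M (?I k)"
        by (intro nn_integral_indep_indicator[OF _ R _ I_VI[OF k]])
      also have "(\<integral>\<^sup>+w. g n k w * indicator B w \<partial>M) = (\<integral>\<^sup>+v. g n k v \<partial>M) * emeasure M B"
        by (rule nn_integral_indep_indicator[OF indep ST(1) g[OF k] B])
      finally show "(\<integral>\<^sup>+w. indicator (?I k) w * (g n k w * indicator B w) \<partial>M)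
          = (\<integral>\<^sup>+v. g n k v \<partial>M) * emeasure M B * (1 / of_nat K)"
        unfolding prob_I[OF k] by (simp add: mult.commute)
    qed
    also have "\<dots> = (\<Sum>k=1..K. \<integral>\<^sup>+v. g n k v \<partial>M) / of_nat K * emeasure M B"
      by (simp add: divide_ennreal_def sum_distrib_left mult_ac)
    finally show ?thesis .
  qed
  let ?c = "\<lambda>w. (\<Sum>k=1..K. \<integral>\<^sup>+v. g (code w) k v \<partial>M) / of_nat K"
  have c_T: "?c \<in> borel_measurable T"
    by (rule measurable_compose[OF code]) simp
  have c_M [measurable]: "?c \<in> borel_measurable M"
    by (rule measurable_from_subalg[OF ST(2) c_T])
  interpret sub: finite_measure_subalgebra M T
    by unfold_locales (rule ST(2))
  have "AE w in M. ?c w = nn_cond_exp M T ?f w"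
  proof (rule sub.nn_cond_exp_charact[OF _ f_M c_T])
    fix A assume A: "A \<in> sets T"
    define B where "B n = {w \<in> A. code w = n}" for n
    have A_sub: "A \<subseteq> space T" using A by (rule sets.sets_into_space)
    have B: "B n \<in> sets T" for n
    proof -
      have "B n = A \<inter> (code -` {n} \<inter> space T)" using A_sub by (auto simp: B_def)
      then show ?thesis using A measurable_sets[OF code, of "{n}"] by auto
    qed
    then have B_M: "B n \<in> sets M" for n using ST by (auto simp: subalgebra_def)
    have disj: "disjoint_family B" by (auto simp: disjoint_family_on_def B_def)
    have AB: "A = (\<Union>n. B n)" by (auto simp: B_def)
    have "(\<integral>\<^sup>+w\<in>B n. ?f w \<partial>M) = (\<integral>\<^sup>+w\<in>B n. ?c w \<partial>M)" for n
    proof -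
      have "(\<integral>\<^sup>+w\<in>B n. ?c w \<partial>M)
          = (\<integral>\<^sup>+w. (\<Sum>k=1..K. \<integral>\<^sup>+v. g n k v \<partial>M) / of_nat K * indicator (B n) w \<partial>M)"
        by (intro nn_integral_cong) (auto simp: indicator_def B_def)
      also have "\<dots> = (\<Sum>k=1..K. \<integral>\<^sup>+v. g n k v \<partial>M) / of_nat K * emeasure M (B n)"
        by (rule nn_integral_cmult_indicator[OF B_M])
      finally show ?thesis using piece[OF B, of n n] by (simp add: B_def)
    qed
    then show "(\<integral>\<^sup>+w\<in>A. ?f w \<partial>M) = (\<integral>\<^sup>+w\<in>A. ?c w \<partial>M)"
      unfolding AB using B_M
      by (simp only: nn_integral_disjoint_family[OF f_M _ disj] nn_integral_disjoint_family[OF c_M _ disj])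
  qed
  then show "AE w in M. nn_cond_exp M T ?f w = ?c w"
    by eventually_elim (rule sym)
qed

section \<open>The rate\<close>

text \<open>
  Minimisers of the strongly convex subproblems are unique, so a trajectory that satisfies the
  optimality conditions is the explicit run, as long as the delays agree.
\<close>

lemma (in delayed_run) dspl_eq_run:
  assumes dom: "\<And>y. y \<in> S \<Longrightarrow> \<omega> y = ereal (r y)" "\<And>y. y \<notin> S \<Longrightarrow> \<omega> y = \<infinity>"
    and dspl: "dspl h c \<omega> (\<lambda>_. \<gamma>) x1 \<xi> \<tau> x"
    and \<xi>: "\<And>j k. 1 \<le> j \<Longrightarrow> 1 \<le> k \<Longrightarrow> \<xi> j k \<in> space \<Xi>"
    and k: "1 \<le> k" and \<tau>: "\<And>i. 1 \<le> i \<Longrightarrow> i < k \<Longrightarrow> \<tau> i = d i"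
  shows "x k = run (\<lambda>i. \<xi> (stale i (d i)) i) k"
  using k \<tau>
proof (induction k rule: delayed_induct[where d = d])
  case 1
  then show ?case using dspl by (simp add: dspl_def run_1[simplified])
next
  case (Suc k)
  let ?s = "\<lambda>i. \<xi> (stale i (d i)) i"
  note sb = stale_bounds[OF Suc.hyps, of "d k"]
  have \<tau>k: "\<tau> k = d k" using Suc.prems[of k] Suc.hyps by simp
  have z: "x (stale k (d k)) = run ?s (stale k (d k))"
    using sb by (intro Suc.IH(1) Suc.prems) auto
  have y: "x k = run ?s k" by (intro Suc.IH(2) Suc.prems) auto
  have s: "?s i \<in> space \<Xi>" if "1 \<le> i" for i
    using that stale_bounds[OF that, of "d i"] by (intro \<xi>) auto
  have zS: "run ?s (stale k (d k)) \<in> S" using sb s by (intro run_in_S) auto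
  let ?q = "\<lambda>y. partial_lin h c (run ?s (stale k (d k))) y (?s k)"
  interpret m: prox_function S "\<lambda>y. ?q y + r y" "Lh * Lcs (?s k) + L\<omega>" \<kappa> \<gamma>
    by (intro prox_function_model s Suc.hyps zS \<kappa>_less_\<gamma>)
  have "is_arg_min (\<lambda>y. ereal (partial_lin h c (x (stale k (\<tau> k))) y (\<xi> (stale k (\<tau> k)) k)) + \<omega> y
      + ereal (\<gamma> / 2 * (norm (y - x k))\<^sup>2)) (\<lambda>_. True) (x (Suc k))"
    using dspl Suc.hyps unfolding dspl_def by blast
  then have "is_arg_min (\<lambda>y. ereal (?q y) + \<omega> y + ereal (\<gamma> / 2 * (norm (y - run ?s k))\<^sup>2)) (\<lambda>_. True) (x (Suc k))"
    unfolding \<tau>k z y .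
  then have min: "ereal (?q (x (Suc k))) + \<omega> (x (Suc k)) + ereal (\<gamma> / 2 * (norm (x (Suc k) - run ?s k))\<^sup>2)
      \<le> ereal (?q y) + \<omega> y + ereal (\<gamma> / 2 * (norm (y - run ?s k))\<^sup>2)" for y
    by (simp add: is_arg_min_linorder)
  have xS: "x (Suc k) \<in> S"
    using min[of x1] dom x1_in by (cases "x (Suc k) \<in> S") auto
  have "x (Suc k) = prox S (\<lambda>y. ?q y + r y) \<gamma> (run ?s k)"
  proof (rule m.prox_unique[OF xS])
    show "?q (x (Suc k)) + r (x (Suc k)) + \<gamma> / 2 * (norm (x (Suc k) - run ?s k))\<^sup>2
        \<le> ?q y + r y + \<gamma> / 2 * (norm (y - run ?s k))\<^sup>2" if "y \<in> S" for y
      using min[of y] dom(1)[OF xS] dom(1)[OF that] by simp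
  qed
  then show ?case by (simp add: run_Suc[OF Suc.hyps])
qed

lemma (in random_delayed_run) mean_rate:
  assumes K: "1 \<le> K" and \<alpha>: "0 < \<alpha>" and \<gamma>: "\<gamma> = \<rho> + 6 * lam + \<kappa> + sqrt (real K) / \<alpha>"
    and \<rho>: "2 * lam + \<kappa> < \<rho>" and lower: "\<And>y. y \<in> S \<Longrightarrow> B \<le> f y + r y"
  shows "(\<Sum>k=1..K. \<integral>\<^sup>+w. ennreal ((norm (\<rho> *\<^sub>R (X k w - p (X k w))))\<^sup>2) \<partial>M) / of_nat K
    \<le> ennreal (2 * \<rho> / (\<rho> - 2 * lam - \<kappa>) *
      ((\<rho> + 4 * lam) * (obj.env x1 - B) / real K + (obj.env x1 - B) / (sqrt (real K) * \<alpha>)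
        + 2 * \<rho> * Lf\<^sup>2 * \<alpha> / sqrt (real K)
        + 6 * \<rho> * lam * (Lf + L\<omega>)\<^sup>2 * \<alpha>\<^sup>2 / real K * ((\<Sum>k=1..K. (real (d k))\<^sup>2) / real K)))"
proof -
  let ?e = "\<lambda>k. \<integral>w. (norm (p (X k w) - X k w))\<^sup>2 \<partial>M"
  have eq: "(\<integral>\<^sup>+w. ennreal ((norm (\<rho> *\<^sub>R (X k w - p (X k w))))\<^sup>2) \<partial>M) = ennreal (\<rho>\<^sup>2 * ?e k)" if "k \<in> {1..K}" for k
  proof -
    have "integrable M (\<lambda>w. \<rho>\<^sup>2 * (norm (p (X k w) - X k w))\<^sup>2)"
      using residual_integrable[of k] that by simp
    then have "(\<integral>\<^sup>+w. ennreal (\<rho>\<^sup>2 * (norm (p (X k w) - X k w))\<^sup>2) \<partial>M) = ennreal (\<rho>\<^sup>2 * ?e k)"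
      by (subst nn_integral_eq_integral) auto
    then show ?thesis by (simp add: power_mult_distrib norm_minus_commute)
  qed
  have "(\<Sum>k=1..K. \<integral>\<^sup>+w. ennreal ((norm (\<rho> *\<^sub>R (X k w - p (X k w))))\<^sup>2) \<partial>M) / of_nat K
      = (\<Sum>k=1..K. ennreal (\<rho>\<^sup>2 * ?e k)) / ennreal (real K)"
    unfolding ennreal_of_nat_eq_real_of_nat by (rule arg_cong2[OF sum.cong[OF refl eq] refl])
  also have "(\<Sum>k=1..K. ennreal (\<rho>\<^sup>2 * ?e k)) = ennreal (\<rho>\<^sup>2 * (\<Sum>k=1..K. ?e k))"
    unfolding sum_distrib_left by (rule sum_ennreal) simp
  also have "\<dots> / ennreal (real K) = ennreal (\<rho>\<^sup>2 * (\<Sum>k=1..K. ?e k) / real K)"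
    using K by (intro divide_ennreal) (auto intro!: mult_nonneg_nonneg sum_nonneg)
  also have "\<dots> \<le> ennreal (2 * \<rho> / (\<rho> - 2 * lam - \<kappa>) *
      ((\<rho> + 4 * lam) * (obj.env x1 - B) / real K + (obj.env x1 - B) / (sqrt (real K) * \<alpha>)
        + 2 * \<rho> * Lf\<^sup>2 * \<alpha> / sqrt (real K)
        + 6 * \<rho> * lam * (Lf + L\<omega>)\<^sup>2 * \<alpha>\<^sup>2 / real K * ((\<Sum>k=1..K. (real (d k))\<^sup>2) / real K)))"
  proof (intro ennreal_leI rate_arithmetic[OF K \<alpha> \<gamma> \<rho> lam_nonneg \<kappa>_nonneg Lf_nonneg L\<omega>_nonneg])
    show "0 \<le> obj.env x1 - B"
      unfolding obj.env_def using lower[OF obj.prox_in, of x1] \<rho>_pos by (simp add: add_increasing2)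
    show "(2 * \<rho> - 3 * lam - 2 * \<kappa>) * (\<Sum>k=1..K. ?e k) \<le> 2 * (\<gamma> + \<rho> - lam - 2 * \<kappa>) / \<rho> * (obj.env x1 - B)
        + real K * (4 * Lf\<^sup>2 / (\<gamma> - \<rho>)) + 3 * lam * V * (\<Sum>k=1..K. (real (d k))\<^sup>2)"
      by (rule sum_residual_le[OF lower])
  qed (auto intro!: sum_nonneg)
  finally show ?thesis .
qed

text \<open>
  At a limit point outside \<open>edom \<omega>\<close> lower semicontinuity would force \<open>\<omega>\<close> to blow up along the domain,
  where it is Lipschitz.
\<close>

lemma closed_edom:
  fixes \<omega> :: "'a::real_normed_vector \<Rightarrow> ereal"
  assumes lsc: "lower_semicontinuous \<omega>" and proper: "\<And>y. \<omega> y \<noteq> -\<infinity>"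
    and lip: "L-lipschitz_on (edom \<omega>) (\<lambda>y. real_of_ereal (\<omega> y))"
  shows "closed (edom \<omega>)"
proof (rule ccontr)
  assume "\<not> closed (edom \<omega>)"
  then obtain y where y: "y \<in> closure (edom \<omega>)" "y \<notin> edom \<omega>"
    using closure_subset_eq by blast
  then obtain a where a: "a \<in> edom \<omega>" "dist a y < 1" by (meson closure_approachable zero_less_one)
  have L0: "0 \<le> L" using lip by (rule lipschitz_on_nonneg)
  define B where "B = real_of_ereal (\<omega> a) + 2 * L"
  have "\<omega> y \<le> Liminf (nhds y) \<omega>" using lsc by (simp add: lower_semicontinuous_def)
  moreover have "\<omega> y = \<infinity>" using y(2) by (simp add: edom_def)
  ultimately have "ereal B < Liminf (nhds y) \<omega>" by simp
  then have "\<forall>\<^sub>F u in nhds y. ereal B < \<omega> u" by (rule less_LiminfD)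
  then obtain e where e: "0 < e" "\<And>u. dist u y < e \<Longrightarrow> ereal B < \<omega> u"
    unfolding eventually_nhds_metric by blast
  obtain b where b: "b \<in> edom \<omega>" "dist b y < min 1 e"
    using y(1) e(1) by (meson closure_approachable zero_less_one min_less_iff_conj)
  have "real_of_ereal (\<omega> b) - real_of_ereal (\<omega> a) \<le> L * dist b a"
    using lipschitz_onD[OF lip b(1) a(1)] by (simp add: dist_real_def)
  also have "\<dots> \<le> L * 2"
    using dist_triangle2[of b a y] a(2) b(2) L0 by (intro mult_left_mono) auto
  finally have "real_of_ereal (\<omega> b) \<le> B" unfolding B_def by simp
  moreover have "ereal B < \<omega> b" using e(2) b(2) by simp
  moreover have "\<omega> b = ereal (real_of_ereal (\<omega> b))"
    using b(1) proper[of b] by (cases "\<omega> b") (auto simp: edom_def)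
  ultimately show False by (metis ereal_less_eq(3) not_less)
qed

lemma weakly_convex_edom:
  fixes \<omega> :: "'a::real_inner \<Rightarrow> ereal"
  assumes wc: "weakly_convex \<kappa> \<omega>" and proper: "\<And>y. \<omega> y \<noteq> -\<infinity>"
  shows "convex (edom \<omega>)" and "weakly_convex_on (edom \<omega>) \<kappa> (\<lambda>y. real_of_ereal (\<omega> y))"
proof -
  let ?r = "\<lambda>y. real_of_ereal (\<omega> y)"
  have fin: "\<omega> y = ereal (?r y)" if "y \<in> edom \<omega>" for y
    using that proper[of y] by (cases "\<omega> y") (auto simp: edom_def)
  have le: "\<omega> ((1 - t) *\<^sub>R x + t *\<^sub>R y) + ereal (\<kappa> / 2 * (norm ((1 - t) *\<^sub>R x + t *\<^sub>R y))\<^sup>2)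
      \<le> ereal ((1 - t) * (?r x + \<kappa> / 2 * (norm x)\<^sup>2) + t * (?r y + \<kappa> / 2 * (norm y)\<^sup>2))"
    if x: "x \<in> edom \<omega>" and y: "y \<in> edom \<omega>" and t: "0 \<le> t" "t \<le> 1" for x y and t :: real
  proof -
    have "\<omega> ((1 - t) *\<^sub>R x + t *\<^sub>R y) + ereal (\<kappa> / 2 * (norm ((1 - t) *\<^sub>R x + t *\<^sub>R y))\<^sup>2)
      \<le> ereal (1 - t) * (\<omega> x + ereal (\<kappa> / 2 * (norm x)\<^sup>2)) + ereal t * (\<omega> y + ereal (\<kappa> / 2 * (norm y)\<^sup>2))"
      using wc t unfolding weakly_convex_def ereal_convex_def by blast
    moreover obtain v w where "\<omega> x = ereal v" "\<omega> y = ereal w" using fin x y by blast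
    ultimately show ?thesis by simp
  qed
  have mem: "(1 - t) *\<^sub>R x + t *\<^sub>R y \<in> edom \<omega>"
    if "x \<in> edom \<omega>" "y \<in> edom \<omega>" "0 \<le> t" "t \<le> 1" for x y and t :: real
    using le[OF that] by (cases "\<omega> ((1 - t) *\<^sub>R x + t *\<^sub>R y)") (auto simp: edom_def)
  then show "convex (edom \<omega>)" by (auto simp: convex_alt)
  have cancel: "u \<le> (1 - t) * v + t * w + \<kappa> / 2 * (t * (1 - t)) * c"
    if "u + \<kappa> / 2 * ((1 - t) * a + t * b - t * (1 - t) * c) \<le> (1 - t) * (v + \<kappa> / 2 * a) + t * (w + \<kappa> / 2 * b)"
    for u v w a b c t :: real
    using that by (simp add: field_simps)
  show "weakly_convex_on (edom \<omega>) \<kappa> ?r"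
    unfolding weakly_convex_on_def
  proof (intro ballI allI impI)
    fix x y t assume a: "x \<in> edom \<omega>" "y \<in> edom \<omega>" "0 \<le> t" "t \<le> (1::real)"
    let ?u = "(1 - t) *\<^sub>R x + t *\<^sub>R y"
    have "?r ?u + \<kappa> / 2 * (norm ?u)\<^sup>2 \<le> (1 - t) * (?r x + \<kappa> / 2 * (norm x)\<^sup>2) + t * (?r y + \<kappa> / 2 * (norm y)\<^sup>2)"
    proof -
      obtain v where "\<omega> ?u = ereal v" using fin[OF mem[OF a]] by blast
      then show ?thesis using le[OF a] by simp
    qed
    then show "?r ?u \<le> (1 - t) * ?r x + t * ?r y + \<kappa> / 2 * (t * (1 - t)) * (norm (x - y))\<^sup>2"
      unfolding norm_sq_convex_combination by (rule cancel)
  qed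
qed

lemma sample_seq_measurable:
  assumes "\<And>j k. 1 \<le> j \<Longrightarrow> 1 \<le> k \<Longrightarrow> \<xi> j k \<in> M \<rightarrow>\<^sub>M \<Xi>"
  shows "sample_seq \<xi> \<in> M \<rightarrow>\<^sub>M sample_space \<Xi>"
  unfolding sample_seq_def[abs_def] sample_space_def
  by (rule measurable_restrict) (auto intro: assms)

lemma delay_seq_measurable:
  assumes "\<And>k. 1 \<le> k \<Longrightarrow> \<tau> k \<in> M \<rightarrow>\<^sub>M count_space UNIV"
  shows "delay_seq \<tau> \<in> M \<rightarrow>\<^sub>M delay_space"
  unfolding delay_seq_def[abs_def] delay_space_def
  by (rule measurable_restrict) (auto intro: assms)

lemma sample_measurable_sample_algebra:
  assumes "\<And>j k. 1 \<le> j \<Longrightarrow> 1 \<le> k \<Longrightarrow> \<xi> j k \<in> M \<rightarrow>\<^sub>M \<Xi>" and jk: "1 \<le> j" "1 \<le> k"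
  shows "\<xi> j k \<in> sample_algebra M \<Xi> \<xi> \<rightarrow>\<^sub>M \<Xi>"
proof -
  have seq: "sample_seq \<xi> \<in> M \<rightarrow>\<^sub>M sample_space \<Xi>" by (rule sample_seq_measurable) (rule assms(1))
  have "sample_seq \<xi> \<in> sample_algebra M \<Xi> \<xi> \<rightarrow>\<^sub>M sample_space \<Xi>"
    unfolding sample_algebra_def
    by (rule measurable_vimage_algebra1) (auto intro: measurable_space[OF seq])
  moreover have "(\<lambda>f. f (j, k)) \<in> sample_space \<Xi> \<rightarrow>\<^sub>M \<Xi>"
    unfolding sample_space_def using jk by (intro measurable_component_singleton) auto
  ultimately have "(\<lambda>w. sample_seq \<xi> w (j, k)) \<in> sample_algebra M \<Xi> \<xi> \<rightarrow>\<^sub>M \<Xi>"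
    by (rule measurable_compose)
  then show ?thesis using jk by (simp add: sample_seq_def)
qed

lemma delay_measurable_delay_algebra:
  assumes "\<And>k. 1 \<le> k \<Longrightarrow> \<tau> k \<in> M \<rightarrow>\<^sub>M count_space UNIV" and k: "1 \<le> k"
  shows "\<tau> k \<in> delay_algebra M \<tau> \<rightarrow>\<^sub>M count_space UNIV"
proof -
  have seq: "delay_seq \<tau> \<in> M \<rightarrow>\<^sub>M delay_space" by (rule delay_seq_measurable) (rule assms(1))
  have "delay_seq \<tau> \<in> delay_algebra M \<tau> \<rightarrow>\<^sub>M delay_space"
    unfolding delay_algebra_def
    by (rule measurable_vimage_algebra1) (auto intro: measurable_space[OF seq])
  moreover have "(\<lambda>f. f k) \<in> delay_space \<rightarrow>\<^sub>M count_space UNIV"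
    unfolding delay_space_def using k by (intro measurable_component_singleton) auto
  ultimately have "(\<lambda>w. delay_seq \<tau> w k) \<in> delay_algebra M \<tau> \<rightarrow>\<^sub>M count_space UNIV"
    by (rule measurable_compose)
  then show ?thesis using k by (simp add: delay_seq_def)
qed

lemma run_algebra_subalgebras:
  assumes s: "sample_seq \<xi> \<in> M \<rightarrow>\<^sub>M sample_space \<Xi>" and t: "delay_seq \<tau> \<in> M \<rightarrow>\<^sub>M delay_space"
  shows "subalgebra M (run_algebra M \<Xi> \<xi> \<tau>)"
    and "subalgebra (run_algebra M \<Xi> \<xi> \<tau>) (sample_algebra M \<Xi> \<xi>)"
    and "subalgebra (run_algebra M \<Xi> \<xi> \<tau>) (delay_algebra M \<tau>)"
proof -
  let ?R = "run_algebra M \<Xi> \<xi> \<tau>"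
  have pair: "(\<lambda>w. (sample_seq \<xi> w, delay_seq \<tau> w)) \<in> M \<rightarrow>\<^sub>M sample_space \<Xi> \<Otimes>\<^sub>M delay_space"
    using s t by (rule measurable_Pair)
  show "subalgebra M ?R" unfolding run_algebra_def by (rule subalgebra_vimage_algebra[OF pair])
  have sp: "space ?R = space M" by (simp add: run_algebra_def)
  have R: "(\<lambda>w. (sample_seq \<xi> w, delay_seq \<tau> w)) \<in> ?R \<rightarrow>\<^sub>M sample_space \<Xi> \<Otimes>\<^sub>M delay_space"
    unfolding run_algebra_def
    by (rule measurable_vimage_algebra1) (rule funcsetI, rule measurable_space[OF pair])
  have "sample_seq \<xi> \<in> ?R \<rightarrow>\<^sub>M sample_space \<Xi>" "delay_seq \<tau> \<in> ?R \<rightarrow>\<^sub>M delay_space"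
    using measurable_compose[OF R measurable_fst] measurable_compose[OF R measurable_snd] by simp_all
  from this[THEN subalgebra_vimage_algebra]
  show "subalgebra ?R (sample_algebra M \<Xi> \<xi>)" "subalgebra ?R (delay_algebra M \<tau>)"
    unfolding sp sample_algebra_def delay_algebra_def .
qed

theorem theorem2:
  fixes M :: "'w measure" and \<Xi> :: "'s measure"
    and h :: "real \<Rightarrow> real" and c :: "'a::euclidean_space \<Rightarrow> 's \<Rightarrow> real" and \<omega> :: "'a \<Rightarrow> ereal"
    and Cs Lcs :: "'s \<Rightarrow> real" and C Lc Lh L\<omega> Lf \<kappa> lam \<rho> \<gamma> \<alpha> \<tau>bar \<tau>sig :: real
    and \<xi> :: "nat \<Rightarrow> nat \<Rightarrow> 'w \<Rightarrow> 's" and \<tau> :: "nat \<Rightarrow> 'w \<Rightarrow> nat" and kstar :: "'w \<Rightarrow> nat"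
    and x :: "nat \<Rightarrow> 'w \<Rightarrow> 'a" and x1 :: 'a and K :: nat
    and \<psi> :: "'a \<Rightarrow> ereal" and D :: ereal and \<Delta>2 :: "'w \<Rightarrow> real"
  assumes "prob_space M" and "prob_space \<Xi>"
    \<comment> \<open>the problem\<close>
    and "\<And>y. \<omega> y \<noteq> -\<infinity>" and "lower_semicontinuous \<omega>"
    and "\<And>y. (\<lambda>s. c y s) \<in> borel_measurable \<Xi>"
    and "\<And>y. y \<in> edom \<omega> \<Longrightarrow> integrable \<Xi> (\<lambda>s. h (c y s))"
    and "\<And>s y. s \<in> space \<Xi> \<Longrightarrow> (\<lambda>z. c z s) differentiable (at y)"
    and \<psi>: "\<psi> = objective \<Xi> h c \<omega>"
    \<comment> \<open>(i)\<close>
    and "prob_space.indep_vars M (\<lambda>_. \<Xi>) (\<lambda>(j, k). \<xi> j k) ({1..} \<times> {1..})"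
    and "\<And>j k. j \<ge> 1 \<Longrightarrow> k \<ge> 1 \<Longrightarrow> distr M \<Xi> (\<xi> j k) = \<Xi>"
    \<comment> \<open>(ii), (iii)\<close>
    and "L\<omega>-lipschitz_on (edom \<omega>) (\<lambda>y. real_of_ereal (\<omega> y))"
    and "weakly_convex \<kappa> \<omega>"
    \<comment> \<open>(iv)\<close>
    and "convex_on UNIV h" and "Lh-lipschitz_on UNIV h"
    and "\<And>s. s \<in> space \<Xi> \<Longrightarrow> (Cs s)-lipschitz_on (edom \<omega>) (gradient (\<lambda>z. c z s))"
    and "\<And>s. s \<in> space \<Xi> \<Longrightarrow> (Lcs s)-lipschitz_on (edom \<omega>) (\<lambda>z. c z s)"
    and "Cs \<in> borel_measurable \<Xi>" and "integrable \<Xi> (\<lambda>s. (Cs s)\<^sup>2)"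
    and "0 \<le> C" and "(\<integral>s. (Cs s)\<^sup>2 \<partial>\<Xi>) \<le> C\<^sup>2"
    and "Lcs \<in> borel_measurable \<Xi>" and "integrable \<Xi> (\<lambda>s. (Lcs s)\<^sup>2)"
    and "0 \<le> Lc" and "(\<integral>s. (Lcs s)\<^sup>2 \<partial>\<Xi>) \<le> Lc\<^sup>2"
    \<comment> \<open>(v); the delays are random, and independent of the samples\<close>
    and "prob_space.indep_set M (sets (sample_algebra M \<Xi> \<xi>)) (sets (delay_algebra M \<tau>))"
    and "\<And>k. k \<ge> 1 \<Longrightarrow> integrable M (\<lambda>w. real (\<tau> k w))"
    and "\<And>k. k \<ge> 1 \<Longrightarrow> (\<integral>w. real (\<tau> k w) \<partial>M) \<le> \<tau>bar"
    and "\<And>k. k \<ge> 1 \<Longrightarrow> integrable M (\<lambda>w. (real (\<tau> k w))\<^sup>2)"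
    and "\<And>k. k \<ge> 1 \<Longrightarrow> (\<integral>w. (real (\<tau> k w))\<^sup>2 \<partial>M) \<le> \<tau>sig"
    \<comment> \<open>parameters and the run\<close>
    and "Lf = Lh * Lc" and "lam = Lh * C"
    and "\<rho> > 2 * lam + \<kappa>" and "\<alpha> > 0" and "K \<ge> 1"
    and "\<gamma> = \<rho> + 6 * lam + \<kappa> + sqrt (real K) / \<alpha>"
    and "x1 \<in> edom \<omega>"
    and "\<And>w. w \<in> space M \<Longrightarrow>
           dspl h c \<omega> (\<lambda>_. \<gamma>) x1 (\<lambda>j k. \<xi> j k w) (\<lambda>k. \<tau> k w) (\<lambda>k. x k w)"
    \<comment> \<open>\<open>kstar\<close> is uniform on \<open>{1..K}\<close>, independent of samples and delays\<close>
    and "kstar \<in> M \<rightarrow>\<^sub>M count_space {1..K}"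
    and "distr M (count_space {1..K}) kstar = uniform_count_measure {1..K}"
    and "prob_space.indep_set M (sets (vimage_algebra (space M) kstar (count_space {1..K})))
           (sets (run_algebra M \<Xi> \<xi> \<tau>))"
    and "D = moreau \<psi> \<rho> x1 - (INF y. \<psi> y)"
    and "\<And>w. \<Delta>2 w = (\<Sum>k = 1..K. (real (\<tau> k w))\<^sup>2) / real K"
  shows "(\<lambda>w. (norm (grad_moreau \<psi> \<rho> (x (kstar w) w)))\<^sup>2) \<in> borel_measurable M \<and>
    (AE w in M.
      enn2ereal (nn_cond_exp M (delay_algebra M \<tau>)
        (\<lambda>w. ennreal ((norm (grad_moreau \<psi> \<rho> (x (kstar w) w)))\<^sup>2)) w)
      \<le> ereal (2 * \<rho> / (\<rho> - 2 * lam - \<kappa>)) *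
          (ereal (\<rho> + 4 * lam) * D / ereal (real K)
           + D / ereal (sqrt (real K) * \<alpha>)
           + ereal (2 * \<rho> * Lf\<^sup>2 * \<alpha> / sqrt (real K))
           + ereal (6 * \<rho> * lam * (Lf + L\<omega>)\<^sup>2 * \<alpha>\<^sup>2 / real K * \<Delta>2 w)))"
proof -
  note prob_M = assms(1) and prob_\<Xi> = assms(2) and proper = assms(3) and lsc = assms(4)
    and lip = assms(11) and wc = assms(12) and \<xi>_indep = assms(9) and \<xi>_distr = assms(10)
    and \<tau>_int = assms(26) and Lf = assms(30) and lam = assms(31) and \<rho> = assms(32) and \<alpha> = assms(33) and K = assms(34)
    and \<gamma> = assms(35) and x1 = assms(36) and dspl = assms(37)
    and D = assms(41) and \<Delta>2 = assms(42)
  let ?S = "edom \<omega>" and ?r = "\<lambda>y. real_of_ereal (\<omega> y)"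
  interpret M: prob_space M by (rule prob_M)
  have \<kappa>0: "0 \<le> \<kappa>" using wc by (simp add: weakly_convex_def)
  interpret composite_problem \<Xi> h c ?S ?r Cs Lcs C Lc Lh L\<omega> \<kappa>
  proof (intro composite_problem.intro[OF prob_\<Xi>] composite_problem_axioms.intro)
    show "?S \<noteq> {}" using x1 by blast
    show "closed ?S" by (rule closed_edom[OF lsc proper lip])
    show "convex ?S" "weakly_convex_on ?S \<kappa> ?r" by (rule weakly_convex_edom[OF wc proper])+
  qed (fact assms \<kappa>0)+
  have lam0: "0 \<le> lam" unfolding lam by (rule lam_nonneg)
  have \<rho>': "Lh * C + \<kappa> < \<rho>" using \<rho> lam0 unfolding lam by linarith
  have sqrt_pos: "0 < sqrt (real K) / \<alpha>" using K \<alpha> by simp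
  have \<gamma>': "\<rho> < \<gamma>" unfolding \<gamma> using lam0 \<kappa>0 sqrt_pos by linarith
  interpret obj: prox_function ?S "\<lambda>y. f y + ?r y" "Lh * Lc + L\<omega>" "Lh * C + \<kappa>" \<rho>
    by (rule prox_function_objective[OF \<rho>'])
  have fin: "\<omega> y = ereal (?r y)" if "y \<in> ?S" for y
    using that proper[of y] by (cases "\<omega> y") (auto simp: edom_def)
  have inf: "\<omega> y = \<infinity>" if "y \<notin> ?S" for y
    using that by (simp add: edom_def)
  have \<psi>_fin: "\<psi> y = ereal (f y + ?r y)" if "y \<in> ?S" for y
    unfolding \<psi> objective_def f_def using fin[OF that] by (metis plus_ereal.simps(1))
  have \<psi>_inf: "\<psi> y = \<infinity>" if "y \<notin> ?S" for y
    unfolding \<psi> objective_def using inf[OF that] by simp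
  have grad: "grad_moreau \<psi> \<rho> y = \<rho> *\<^sub>R (y - prox ?S (\<lambda>y. f y + ?r y) \<rho> y)" for y
    by (rule obj.grad_moreau_eq[OF \<psi>_fin \<psi>_inf])
  have grad_measurable: "grad_moreau \<psi> \<rho> \<in> borel_measurable borel"
    unfolding grad[abs_def]
    by (intro borel_measurable_continuous_onI continuous_intros lipschitz_on_continuous_on[OF obj.prox_lipschitz])
  have \<xi>_meas: "\<xi> j k \<in> M \<rightarrow>\<^sub>M \<Xi>" if "1 \<le> j" "1 \<le> k" for j k
    using \<xi>_indep that by (auto simp: M.indep_vars_def)
  have \<tau>_meas: "\<tau> k \<in> M \<rightarrow>\<^sub>M count_space UNIV" if "1 \<le> k" for k
  proof -
    have [measurable]: "(\<lambda>w. real (\<tau> k w)) \<in> borel_measurable M"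
      using \<tau>_int[OF that] by (rule borel_measurable_integrable)
    have "(\<lambda>w. nat \<lfloor>real (\<tau> k w)\<rfloor>) \<in> M \<rightarrow>\<^sub>M count_space UNIV" by measurable
    then show ?thesis by simp
  qed
  let ?SA = "sample_algebra M \<Xi> \<xi>" and ?TA = "delay_algebra M \<tau>" and ?RA = "run_algebra M \<Xi> \<xi> \<tau>"
  have "sample_seq \<xi> \<in> M \<rightarrow>\<^sub>M sample_space \<Xi>" by (rule sample_seq_measurable) (rule \<xi>_meas)
  moreover have "delay_seq \<tau> \<in> M \<rightarrow>\<^sub>M delay_space" by (rule delay_seq_measurable) (rule \<tau>_meas)
  ultimately have sub: "subalgebra M ?RA" "subalgebra ?RA ?SA" "subalgebra ?RA ?TA"
    by (rule run_algebra_subalgebras)+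
  \<comment> \<open>The delays of the first \<open>K\<close> updates take countably many values, encoded as numbers.  The value of
    \<open>del n\<close> beyond update \<open>K\<close> is arbitrary; the iterates up to \<open>K\<close> do not see it.\<close>
  define code where "code w = to_nat (map (\<lambda>k. \<tau> k w) [1..<Suc K])" for w
  define del where "del n k = (from_nat n :: nat list) ! (k - 1)" for n k
  have del: "del (code w) k = \<tau> k w" if "k \<in> {1..K}" for w k
    using that by (auto simp: del_def code_def nth_map_upt simp del: upt_Suc)
  have code: "code \<in> ?TA \<rightarrow>\<^sub>M count_space UNIV"
  proof -
    have "(\<lambda>w. map (\<lambda>k. \<tau> k w) ks) \<in> ?TA \<rightarrow>\<^sub>M count_space UNIV" if "set ks \<subseteq> {1..}" for ks
      using that
    proof (induction ks)
      case (Cons k ks)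
      have [measurable]: "\<tau> k \<in> ?TA \<rightarrow>\<^sub>M count_space UNIV"
        using Cons.prems by (intro delay_measurable_delay_algebra \<tau>_meas) auto
      have [measurable]: "(\<lambda>w. map (\<lambda>k. \<tau> k w) ks) \<in> ?TA \<rightarrow>\<^sub>M count_space UNIV"
        using Cons by simp
      have "(\<lambda>w. \<tau> k w # map (\<lambda>k. \<tau> k w) ks) \<in> ?TA \<rightarrow>\<^sub>M count_space UNIV" by measurable
      then show ?case by simp
    qed simp
    from this[of "[1..<Suc K]"] show ?thesis
      unfolding code_def[abs_def] by (rule measurable_compose) auto
  qed
  \<comment> \<open>With the delays frozen, update \<open>k\<close> consumes the sample at \<open>(stale k (d k), k)\<close>; the second index
    makes these pairs distinct, so the consumed samples are independent.\<close>
  have run_locale: "random_delayed_run \<Xi> h c ?S ?r Cs Lcs C Lc Lh L\<omega> \<kappa> \<gamma> \<rho> x1 M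
      (\<lambda>k. \<xi> (stale k (d k)) k)" for d
  proof (intro random_delayed_run.intro random_delayed_run_axioms.intro delayed_run.intro
      delayed_run_axioms.intro composite_problem_axioms prob_M x1 \<rho>' \<gamma>')
    let ?\<sigma> = "\<lambda>k. (stale k (d k), k)"
    have pos: "1 \<le> stale k (d k)" if "1 \<le> k" for k using stale_bounds[OF that] by blast
    have "M.indep_vars (\<lambda>_. \<Xi>) (\<lambda>(j, k). \<xi> j k) (?\<sigma> ` {1..})"
      using pos by (intro M.indep_vars_subset[OF \<xi>_indep]) auto
    from M.indep_vars_reindex[OF this]
    show "M.indep_vars (\<lambda>_. \<Xi>) (\<lambda>k. \<xi> (stale k (d k)) k) {1..}" by (simp add: inj_on_def)
    show "distr M \<Xi> (\<xi> (stale k (d k)) k) = \<Xi>" if "1 \<le> k" for k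
      using \<xi>_distr[OF pos[OF that] that] .
  qed
  define Y where "Y n k w = delayed_run.run h c ?S ?r \<gamma> x1 (del n) (\<lambda>i. \<xi> (stale i (del n i)) i w) k" for n k w
  have Y_eq: "x k w = Y (code w) k w" if w: "w \<in> space M" and k: "k \<in> {1..K}" for k w
  proof -
    interpret R: random_delayed_run \<Xi> h c ?S ?r Cs Lcs C Lc Lh L\<omega> \<kappa> \<gamma> \<rho> x1 "del (code w)" M
        "\<lambda>k. \<xi> (stale k (del (code w) k)) k"
      by (rule run_locale)
    show ?thesis unfolding Y_def
      by (rule R.dspl_eq_run[OF fin inf dspl[OF w]]) (use k del w \<xi>_meas in \<open>auto intro: measurable_space\<close>)
  qed
  have Y_measurable: "Y n k \<in> borel_measurable ?SA" if k: "k \<in> {1..K}" for n k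
  proof -
    interpret R: random_delayed_run \<Xi> h c ?S ?r Cs Lcs C Lc Lh L\<omega> \<kappa> \<gamma> \<rho> x1 "del n" M
        "\<lambda>k. \<xi> (stale k (del n k)) k"
      by (rule run_locale)
    show ?thesis unfolding Y_def[abs_def]
    proof (rule R.run_measurable)
      fix i :: nat assume "1 \<le> i"
      then show "(\<lambda>w. \<xi> (stale i (del n i)) i w) \<in> ?SA \<rightarrow>\<^sub>M \<Xi>"
        using stale_bounds[of i "del n i"] by (intro sample_measurable_sample_algebra \<xi>_meas) auto
    qed (use k in simp)
  qed
  define g where "g n k w = ennreal ((norm (grad_moreau \<psi> \<rho> (Y n k w)))\<^sup>2)" for n k w
  have g_measurable: "g n k \<in> borel_measurable ?SA" if "k \<in> {1..K}" for n k
  proof -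
    have [measurable]: "(\<lambda>w. grad_moreau \<psi> \<rho> (Y n k w)) \<in> borel_measurable ?SA"
      by (rule measurable_compose[OF Y_measurable[OF that] grad_measurable])
    show ?thesis unfolding g_def[abs_def] by measurable
  qed
  let ?F = "\<lambda>w. ennreal ((norm (grad_moreau \<psi> \<rho> (x (kstar w) w)))\<^sup>2)"
  note index = assms(38) and uniform = assms(39) and index_indep = assms(40) and indep = assms(25)
  have cond: "(\<lambda>w. g (code w) (kstar w) w) \<in> borel_measurable M"
    "AE w in M. nn_cond_exp M ?TA (\<lambda>w. g (code w) (kstar w) w) w
      = (\<Sum>k=1..K. \<integral>\<^sup>+v. g (code w) k v \<partial>M) / of_nat K"
    by (rule M.nn_cond_exp_random_index[OF sub indep index index_indep uniform code], rule g_measurable, assumption)+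
  have F_eq: "?F w = g (code w) (kstar w) w" if "w \<in> space M" for w
    using Y_eq[OF that measurable_space[OF index that, unfolded space_count_space]] by (simp add: g_def)
  have F_measurable: "?F \<in> borel_measurable M"
    using cond(1) F_eq by (simp cong: measurable_cong)
  have "(\<lambda>w. enn2real (?F w)) \<in> borel_measurable M"
    using F_measurable by measurable
  then have goal1: "(\<lambda>w. (norm (grad_moreau \<psi> \<rho> (x (kstar w) w)))\<^sup>2) \<in> borel_measurable M"
    by simp
  interpret T: finite_measure_subalgebra M ?TA
    using sub by unfold_locales (auto simp: subalgebra_def)
  have "AE w in M. nn_cond_exp M ?TA ?F w = nn_cond_exp M ?TA (\<lambda>w. g (code w) (kstar w) w) w"
    using F_eq by (intro T.nn_cond_exp_cong F_measurable cond(1)) auto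
  with cond(2) have F_cond: "AE w in M. nn_cond_exp M ?TA ?F w = (\<Sum>k=1..K. \<integral>\<^sup>+v. g (code w) k v \<partial>M) / of_nat K"
    by eventually_elim simp
  have env: "moreau \<psi> \<rho> x1 = ereal (obj.env x1)"
    by (rule obj.moreau_eq_env[OF \<psi>_fin \<psi>_inf])
  let ?C = "2 * \<rho> / (\<rho> - 2 * lam - \<kappa>)"
  have C_pos: "0 < ?C" using \<rho> lam0 \<kappa>0 by simp
  have bound: "enn2ereal ((\<Sum>k=1..K. \<integral>\<^sup>+v. g (code w) k v \<partial>M) / of_nat K)
      \<le> ereal ?C * (ereal (\<rho> + 4 * lam) * D / ereal (real K) + D / ereal (sqrt (real K) * \<alpha>)
         + ereal (2 * \<rho> * Lf\<^sup>2 * \<alpha> / sqrt (real K))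
         + ereal (6 * \<rho> * lam * (Lf + L\<omega>)\<^sup>2 * \<alpha>\<^sup>2 / real K * \<Delta>2 w))" for w
  proof (cases "(INF y. \<psi> y) = -\<infinity>")
    case True
    \<comment> \<open>An objective unbounded below makes the right-hand side infinite.\<close>
    then have "D = \<infinity>" unfolding D env by simp
    then show ?thesis using C_pos \<rho> lam0 \<kappa>0 K \<alpha> by simp
  next
    case False
    have "(INF y. \<psi> y) \<le> \<psi> x1" by (rule INF_lower) simp
    then obtain B where B: "(INF y. \<psi> y) = ereal B"
      using False \<psi>_fin[OF x1] by (cases "INF y. \<psi> y") auto
    have lower: "B \<le> f y + ?r y" if "y \<in> ?S" for y
    proof -
      have "ereal B \<le> \<psi> y" unfolding B[symmetric] by (rule INF_lower) simp
      then show ?thesis using \<psi>_fin[OF that] by simp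
    qed
    interpret R: random_delayed_run \<Xi> h c ?S ?r Cs Lcs C Lc Lh L\<omega> \<kappa> \<gamma> \<rho> x1 "del (code w)" M
        "\<lambda>k. \<xi> (stale k (del (code w) k)) k"
      by (rule run_locale)
    have D': "D = ereal (obj.env x1 - B)" unfolding D env B by simp
    have g_eq: "g (code w) k v = ennreal ((norm (\<rho> *\<^sub>R (R.X k v - prox ?S (\<lambda>y. f y + ?r y) \<rho> (R.X k v))))\<^sup>2)" for k v
      unfolding g_def grad Y_def R.X_def ..
    have \<Delta>: "(\<Sum>k=1..K. (real (del (code w) k))\<^sup>2) / real K = \<Delta>2 w"
      unfolding \<Delta>2 by (intro arg_cong2[where f = "(/)"] sum.cong) (simp_all add: del)
    let ?B = "?C * ((\<rho> + 4 * lam) * (obj.env x1 - B) / real K + (obj.env x1 - B) / (sqrt (real K) * \<alpha>)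
        + 2 * \<rho> * Lf\<^sup>2 * \<alpha> / sqrt (real K)
        + 6 * \<rho> * lam * (Lf + L\<omega>)\<^sup>2 * \<alpha>\<^sup>2 / real K * \<Delta>2 w)"
    have le: "(\<Sum>k=1..K. \<integral>\<^sup>+v. g (code w) k v \<partial>M) / of_nat K \<le> ennreal ?B"
      using R.mean_rate[OF K \<alpha> \<gamma>[unfolded lam] \<rho>[unfolded lam] lower]
      unfolding g_eq \<Delta> lam[symmetric] Lf[symmetric] .
    have "0 \<le> obj.env x1 - B"
      unfolding obj.env_def using lower[OF obj.prox_in, of x1] obj.\<gamma>_gt obj.m_nonneg by (simp add: add_increasing2)
    then have "0 \<le> ?B"
      unfolding \<Delta>2 using C_pos \<rho> lam0 \<kappa>0 \<alpha>
      by (intro mult_nonneg_nonneg add_nonneg_nonneg divide_nonneg_nonneg sum_nonneg) auto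
    then have "enn2ereal ((\<Sum>k=1..K. \<integral>\<^sup>+v. g (code w) k v \<partial>M) / of_nat K) \<le> ereal ?B"
      using le by (simp add: less_eq_ennreal.rep_eq)
    also have "ereal ?B = ereal ?C * (ereal (\<rho> + 4 * lam) * D / ereal (real K) + D / ereal (sqrt (real K) * \<alpha>)
         + ereal (2 * \<rho> * Lf\<^sup>2 * \<alpha> / sqrt (real K))
         + ereal (6 * \<rho> * lam * (Lf + L\<omega>)\<^sup>2 * \<alpha>\<^sup>2 / real K * \<Delta>2 w))"
      unfolding D' using K \<alpha> by simp
    finally show ?thesis .
  qed
  have "AE w in M. enn2ereal (nn_cond_exp M ?TA ?F w)
      \<le> ereal ?C * (ereal (\<rho> + 4 * lam) * D / ereal (real K) + D / ereal (sqrt (real K) * \<alpha>)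
         + ereal (2 * \<rho> * Lf\<^sup>2 * \<alpha> / sqrt (real K))
         + ereal (6 * \<rho> * lam * (Lf + L\<omega>)\<^sup>2 * \<alpha>\<^sup>2 / real K * \<Delta>2 w))"
    using F_cond by eventually_elim (simp only: bound)
  with goal1 show ?thesis by blast
qed

end
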